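(* The problem $d$-$SC1S$-$RC$ — given a binary matrix $M$ and an integer $d\ge0$ (the parameter), decide whether there are a set $R'$ of rows and a set $C'$ of columns of $M$ with $|R'|+|C'|\le d$ such that deleting them from $M$ yields a matrix with the simultaneous consecutive ones property — is fixed-parameter tractable on general binary matrices, solvable in time $O^*(2^{d\log d})$.
   Context: A binary matrix has the consecutive ones property (C1P) for rows if its columns can be permuted so that in every row the $1$-entries occur consecutively; it has the C1P for columns if its rows can be permuted so that in every column the $1$-entries occur consecutively. It has the simultaneous consecutive ones property (SC1P) if it has both. $O^*(f(d))$ denotes $f(d)\cdot N^{O(1)}$ where $N$ is the input size. *)

theory Defs
  imports
    Complex_Main
    "HOL-Combinatorics.Permutations"
    "Jordan_Normal_Form.DL_Submatrix"
begin

section \<open>The consecutive ones property and the deletion problem\<close>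

text \<open>A binary matrix is a matrix over \<^typ>\<open>bool\<close>, with \<^const>\<open>True\<close> in the role of the entry 1.\<close>

definition C1P_rows :: "bool mat \<Rightarrow> bool" where
  "C1P_rows M \<longleftrightarrow>
     (\<exists>\<pi>. \<pi> permutes {..<dim_col M} \<and>
        (\<forall>i<dim_row M. \<forall>a b c. a < b \<longrightarrow> b < c \<longrightarrow> c < dim_col M \<longrightarrow>
           M $$ (i, \<pi> a) \<longrightarrow> M $$ (i, \<pi> c) \<longrightarrow> M $$ (i, \<pi> b)))"

definition C1P_cols :: "bool mat \<Rightarrow> bool" where
  "C1P_cols M \<longleftrightarrow>
     (\<exists>\<pi>. \<pi> permutes {..<dim_row M} \<and>
        (\<forall>j<dim_col M. \<forall>a b c. a < b \<longrightarrow> b < c \<longrightarrow> c < dim_row M \<longrightarrow>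
           M $$ (\<pi> a, j) \<longrightarrow> M $$ (\<pi> c, j) \<longrightarrow> M $$ (\<pi> b, j)))"

definition SC1P :: "bool mat \<Rightarrow> bool" where
  "SC1P M \<longleftrightarrow> C1P_rows M \<and> C1P_cols M"

definition delete_rows_cols :: "'a mat \<Rightarrow> nat set \<Rightarrow> nat set \<Rightarrow> 'a mat" where
  "delete_rows_cols M R C = submatrix M ({..<dim_row M} - R) ({..<dim_col M} - C)"

fun SC1S_RC :: "bool mat \<times> nat \<Rightarrow> bool" where
  "SC1S_RC (M, d) \<longleftrightarrow>
     (\<exists>R \<subseteq> {..<dim_row M}. \<exists>C \<subseteq> {..<dim_col M}.
        card R + card C \<le> d \<and> SC1P (delete_rows_cols M R C))"


section \<open>Model of computation\<close>

text \<open>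
  Algorithms are programs of a first-order, call-by-value functional language on binary trees
  with unit cost, in the style of Jones' languages F and WHILE. A program is a finite list of
  bodies of unary, mutually recursive functions; function 0 is the main function. In an
  expression, \<open>EVar i\<close> is a de Bruijn index into the environment, which consists of the
  argument of the current function and the enclosing \<open>ELet\<close>s.

  Since trees can be shared, and the only test is whether a tree is a leaf, every unit of cost is
  a constant number of steps of a random access machine (the constant depends on the program only)
  whose registers hold numbers bounded by the input size plus the number of steps.
\<close>

datatype val = Leaf | Node val val

fun left :: "val \<Rightarrow> val" where
  "left Leaf = Leaf"
| "left (Node u v) = u"

fun right :: "val \<Rightarrow> val" where
  "right Leaf = Leaf"
| "right (Node u v) = v"

datatype expr =
    EVar nat
  | ELeaf
  | ENode expr expr
  | ELeft expr
  | ERight expr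
  | EIf expr expr expr
  | ELet expr expr
  | ECall nat expr

type_synonym prog = "expr list"

text \<open>\<open>eval P env e v t\<close>: in program \<open>P\<close>, expression \<open>e\<close> evaluates to \<open>v\<close> at cost \<open>t\<close>.\<close>

inductive eval :: "prog \<Rightarrow> val list \<Rightarrow> expr \<Rightarrow> val \<Rightarrow> nat \<Rightarrow> bool" for P :: prog where
  Var: "i < length env \<Longrightarrow> eval P env (EVar i) (env ! i) 1"
| ELeaf: "eval P env ELeaf Leaf 1"
| ENode: "eval P env e1 v1 t1 \<Longrightarrow> eval P env e2 v2 t2 \<Longrightarrow>
    eval P env (ENode e1 e2) (Node v1 v2) (t1 + t2 + 1)"
| ELeft: "eval P env e v t \<Longrightarrow> eval P env (ELeft e) (left v) (t + 1)"
| ERight: "eval P env e v t \<Longrightarrow> eval P env (ERight e) (right v) (t + 1)"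
| IfTrue: "eval P env e0 v0 t0 \<Longrightarrow> v0 \<noteq> Leaf \<Longrightarrow> eval P env e1 v t1 \<Longrightarrow>
    eval P env (EIf e0 e1 e2) v (t0 + t1 + 1)"
| IfFalse: "eval P env e0 v0 t0 \<Longrightarrow> v0 = Leaf \<Longrightarrow> eval P env e2 v t2 \<Longrightarrow>
    eval P env (EIf e0 e1 e2) v (t0 + t2 + 1)"
| Let: "eval P env e1 v1 t1 \<Longrightarrow> eval P (v1 # env) e2 v t2 \<Longrightarrow>
    eval P env (ELet e1 e2) v (t1 + t2 + 1)"
| Call: "eval P env e u t1 \<Longrightarrow> f < length P \<Longrightarrow> eval P [u] (P ! f) v t2 \<Longrightarrow>
    eval P env (ECall f e) v (t1 + t2 + 1)"

inductive_cases eval_VarE: "eval P env (EVar i) v t"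
inductive_cases eval_ELeafE: "eval P env ELeaf v t"
inductive_cases eval_ENodeE: "eval P env (ENode e1 e2) v t"
inductive_cases eval_ELeftE: "eval P env (ELeft e) v t"
inductive_cases eval_ERightE: "eval P env (ERight e) v t"
inductive_cases eval_IfE: "eval P env (EIf e0 e1 e2) v t"
inductive_cases eval_LetE: "eval P env (ELet e1 e2) v t"
inductive_cases eval_CallE: "eval P env (ECall f e) v t"

lemma eval_deterministic:
  assumes "eval P env e v t" and "eval P env e v' t'"
  shows "v' = v \<and> t' = t"
  using assms
proof (induction arbitrary: v' t' rule: eval.induct)
  case (Var i env)
  from Var.prems show ?case by (rule eval_VarE) simp
next
  case (ELeaf env)
  from ELeaf.prems show ?case by (rule eval_ELeafE) simp
next
  case (ENode env e1 v1 t1 e2 v2 t2)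
  from ENode.prems show ?case
    by (rule eval_ENodeE) (simp, drule ENode.IH(1), drule ENode.IH(2), simp)
next
  case (ELeft env e v t)
  from ELeft.prems show ?case by (rule eval_ELeftE) (drule ELeft.IH, simp)
next
  case (ERight env e v t)
  from ERight.prems show ?case by (rule eval_ERightE) (drule ERight.IH, simp)
next
  case (IfTrue env e0 v0 t0 e1 v t1 e2)
  from IfTrue.prems show ?case
  proof (rule eval_IfE)
    fix w0 s0 s1
    assume "t' = Suc (s0 + s1)" and 0: "eval P env e0 w0 s0" and 1: "eval P env e1 v' s1"
    with IfTrue.IH(1)[OF 0] IfTrue.IH(2)[OF 1] show ?thesis by simp
  next
    fix s0 s2
    assume 0: "eval P env e0 Leaf s0"
    with IfTrue.IH(1)[OF 0] IfTrue.hyps show ?thesis by simp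
  qed
next
  case (IfFalse env e0 v0 t0 e2 v t2 e1)
  from IfFalse.prems show ?case
  proof (rule eval_IfE)
    fix w0 s0 s1
    assume 0: "eval P env e0 w0 s0" and "w0 \<noteq> Leaf"
    with IfFalse.IH(1)[OF 0] IfFalse.hyps show ?thesis by simp
  next
    fix s0 s2
    assume "t' = Suc (s0 + s2)" and 0: "eval P env e0 Leaf s0" and 2: "eval P env e2 v' s2"
    with IfFalse.IH(1)[OF 0] IfFalse.IH(2)[OF 2] show ?thesis by simp
  qed
next
  case (Let env e1 v1 t1 e2 v t2)
  from Let.prems show ?case
  proof (rule eval_LetE)
    fix w1 s1 s2
    assume "t' = Suc (s1 + s2)" and 1: "eval P env e1 w1 s1" and 2: "eval P (w1 # env) e2 v' s2"
    from Let.IH(1)[OF 1] have "w1 = v1" "s1 = t1" by simp_all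
    with 2 Let.IH(2)[of v' s2] \<open>t' = Suc (s1 + s2)\<close> show ?thesis by simp
  qed
next
  case (Call env e u t1 f v t2)
  from Call.prems show ?case
  proof (rule eval_CallE)
    fix w s1 s2
    assume "t' = Suc (s1 + s2)" and 1: "eval P env e w s1" and 2: "eval P [w] (P ! f) v' s2"
    from Call.IH(1)[OF 1] have "w = u" "s1 = t1" by simp_all
    with 2 Call.IH(2)[of v' s2] \<open>t' = Suc (s1 + s2)\<close> show ?thesis by simp
  qed
qed

definition run :: "prog \<Rightarrow> val \<Rightarrow> val \<Rightarrow> nat \<Rightarrow> bool" where
  "run P x y t \<longleftrightarrow> 0 < length P \<and> eval P [x] (P ! 0) y t"


section \<open>Encodings\<close>

fun val_size :: "val \<Rightarrow> nat" where
  "val_size Leaf = 1"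
| "val_size (Node u v) = val_size u + val_size v + 1"

fun enc_bool :: "bool \<Rightarrow> val" where
  "enc_bool False = Leaf"
| "enc_bool True = Node Leaf Leaf"

fun enc_list :: "('a \<Rightarrow> val) \<Rightarrow> 'a list \<Rightarrow> val" where
  "enc_list enc [] = Leaf"
| "enc_list enc (x # xs) = Node (enc x) (enc_list enc xs)"

text \<open>Numbers are written in binary, least significant bit first.\<close>

fun enc_nat :: "nat \<Rightarrow> val" where
  "enc_nat n = (if n = 0 then Leaf else Node (enc_bool (odd n)) (enc_nat (n div 2)))"

declare enc_nat.simps [simp del]

fun enc_instance :: "bool mat \<times> nat \<Rightarrow> val" where
  "enc_instance (M, d) = Node (enc_list (enc_list enc_bool) (mat_to_list M)) (enc_nat d)"


section \<open>Parameterized complexity\<close>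

text \<open>
  A parameterized problem is given by an encoding \<open>enc\<close> of its instances, a parameter \<open>\<kappa>\<close> and
  the predicate \<open>L\<close> of the yes-instances. The following says that it is solvable in time
  \<open>O\<^sup>*(f(d))\<close>, that is, \<open>f(d) \<cdot> N\<^sup>k\<close> for a constant \<open>k\<close>, where \<open>N\<close> is the size of the encoded
  instance. A constant factor would be redundant: every instance of the problem above has
  \<open>N \<ge> 3\<close>.
\<close>

definition solvable_in_O_star ::
  "('a \<Rightarrow> val) \<Rightarrow> ('a \<Rightarrow> nat) \<Rightarrow> ('a \<Rightarrow> bool) \<Rightarrow> (nat \<Rightarrow> real) \<Rightarrow> bool" where
  "solvable_in_O_star enc \<kappa> L f \<longleftrightarrow>
     (\<exists>P k. \<forall>x. \<exists>t. run P (enc x) (enc_bool (L x)) t \<and>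
        real t \<le> f (\<kappa> x) * real (val_size (enc x)) ^ k)"

definition computable :: "(nat \<Rightarrow> nat) \<Rightarrow> bool" where
  "computable f \<longleftrightarrow> (\<exists>P. \<forall>n. \<exists>t. run P (enc_nat n) (enc_nat (f n)) t)"

definition fixed_parameter_tractable ::
  "('a \<Rightarrow> val) \<Rightarrow> ('a \<Rightarrow> nat) \<Rightarrow> ('a \<Rightarrow> bool) \<Rightarrow> bool" where
  "fixed_parameter_tractable enc \<kappa> L \<longleftrightarrow>
     (\<exists>f. computable f \<and> solvable_in_O_star enc \<kappa> L (\<lambda>d. real (f d)))"

end

theory Submission
  imports Defs
begin

text \<open>
  View a matrix as a bipartite graph on its rows and columns. By a theorem of Tucker, a matrix has the
  simultaneous consecutive ones property iff this graph has no asteroidal triple, that is, no three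
  vertices on the same side such that any two of them are joined by a walk avoiding the neighbourhood of
  the third. So the task is to destroy all asteroidal triples by deleting at most \<open>d\<close> vertices.

  If some asteroidal triple is witnessed by three walks of length at most 1000, one of boundedly many
  vertices has to be deleted. Otherwise every asteroidal triple comes from an induced cycle
  (a hole) of length more than 1000. Locally such a graph is as thin as the hole: a hole dominates its
  component, and removing the neighbourhood of any of its vertices leaves a graph with the consecutive ones
  property. Hence an inclusion-minimal solution in a component cuts it at one place of the
  hole, and the vertices of the cut are exactly those with two common neighbours \<open>x\<close>, \<open>x'\<close> or
  \<open>y\<close>, \<open>y'\<close>, where these four vertices face each other across the cut. This leaves polynomially many candidates,
  and deleting a smallest one is optimal. The search tree has depth at most \<open>d\<close> and bounded degree, so the running
  time is \<open>C\<^sup>d\<close> times a polynomial, and \<open>C\<^sup>d \<le> C\<^sup>C \<cdot> d\<^sup>d\<close>.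
\<close>

section \<open>Tucker's theorem\<close>

text \<open>The local structure rests on one observation. If there is no short asteroidal triple and
  an edge \<open>v w\<close> touches an induced path away from its ends, say \<open>v\<close> is
  adjacent to \<open>p k\<close>, then \<open>w\<close> is adjacent to some \<open>p j\<close> with
  \<open>j\<close> at most 6 away from \<open>k\<close>. Otherwise the two directions of the path
  and the dangling vertex would form a short triple. So a walk travels along a path or a hole at
  bounded speed and never loses contact with it. From this come the domination by holes, the
  shortening of long triples, and all constants, which are chosen generously: 1000 leaves room for a
  hole to look like a path around \<open>p 0\<close> and around \<open>p 100\<close> with a large
  distance in between.

  The obstacle is that a cut can have arbitrarily many vertices, so its vertices cannot be branched
  on. Two facts overcome it: four vertices suffice to name a cut, and deleting a smallest cut is a
  safe move, because every solution contains some cut of the same component and components do not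
  interact. Hence only the bounded triples branch, and as every move deletes at least one vertex,
  the parameter bounds the depth.\<close>

definition consec :: "'a set \<Rightarrow> 'a list \<Rightarrow> bool" where
  "consec r cs \<longleftrightarrow> (\<exists>xs ys zs. cs = xs @ ys @ zs \<and> set ys \<subseteq> r \<and> set xs \<inter> r = {} \<and> set zs \<inter> r = {})"

text \<open>One step between columns through a row that misses \<open>c\<close>: in the bipartite
  graph this is a walk of length two that avoids the neighbours of \<open>c\<close>.\<close>

definition linked :: "'a set set \<Rightarrow> 'a set \<Rightarrow> 'a \<Rightarrow> 'a \<Rightarrow> 'a \<Rightarrow> bool" where
  "linked F C c x y \<longleftrightarrow> x \<in> C \<and> y \<in> C \<and> (\<exists>r\<in>F. x \<in> r \<and> y \<in> r \<and> c \<notin> r)"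

abbreviation joined :: "'a set set \<Rightarrow> 'a set \<Rightarrow> 'a \<Rightarrow> 'a \<Rightarrow> 'a \<Rightarrow> bool" where
  "joined F C c \<equiv> (linked F C c)\<^sup>*\<^sup>*"

definition at_free :: "'a set set \<Rightarrow> 'a set \<Rightarrow> bool" where
  "at_free F C \<longleftrightarrow> (\<forall>a\<in>C. \<forall>b\<in>C. \<forall>c\<in>C. a \<noteq> b \<longrightarrow> b \<noteq> c \<longrightarrow> a \<noteq> c \<longrightarrow>
     \<not> (joined F C c a b \<and> joined F C a b c \<and> joined F C b c a))"

lemma consecI:
  "cs = xs @ ys @ zs \<Longrightarrow> set ys \<subseteq> r \<Longrightarrow> set xs \<inter> r = {} \<Longrightarrow> set zs \<inter> r = {} \<Longrightarrow> consec r cs"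
  unfolding consec_def by blast

lemma consec_all: "set cs \<subseteq> r \<Longrightarrow> consec r cs"
  by (rule consecI[of _ "[]" cs "[]"]) auto

lemma consec_none: "set cs \<inter> r = {} \<Longrightarrow> consec r cs"
  by (rule consecI[of _ cs "[]" "[]"]) auto

lemma distinct_singletonI: "distinct zs \<Longrightarrow> set zs \<subseteq> {t} \<Longrightarrow> t \<in> set zs \<Longrightarrow> zs = [t]"
  by (cases zs; cases "tl zs") auto

lemma consec_rev: "consec r cs \<Longrightarrow> consec r (rev cs)"
  unfolding consec_def
proof (elim exE conjE)
  fix xs ys zs
  assume "cs = xs @ ys @ zs" "set ys \<subseteq> r" "set xs \<inter> r = {}" "set zs \<inter> r = {}"
  then show "\<exists>xs ys zs. rev cs = xs @ ys @ zs \<and> set ys \<subseteq> r \<and> set xs \<inter> r = {} \<and> set zs \<inter> r = {}"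
    by (intro exI[of _ "rev zs"] exI[of _ "rev ys"] exI[of _ "rev xs"]) auto
qed

section \<open>Connections through rows that avoid an element\<close>

lemma joined_sym: "joined F C c x y \<Longrightarrow> joined F C c y x"
proof (induction rule: rtranclp_induct)
  case (step y z)
  from step(2) have "linked F C c z y" unfolding linked_def by blast
  with step(3) show ?case by (meson converse_rtranclp_into_rtranclp)
qed simp

lemma joined_mono: "C' \<subseteq> C \<Longrightarrow> joined F C' c x y \<Longrightarrow> joined F C c x y"
  by (erule rtranclp_mono[THEN predicate2D, rotated]) (auto simp: linked_def)

lemma at_free_mono: "at_free F C \<Longrightarrow> C' \<subseteq> C \<Longrightarrow> at_free F C'"
  unfolding at_free_def using joined_mono[of C' C F] by (meson subsetD)

lemma joined_in: "joined F C c x y \<Longrightarrow> x \<in> C \<Longrightarrow> y \<in> C"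
  by (induction rule: rtranclp_induct) (auto simp: linked_def)

lemma joined_ne: "joined F C c x y \<Longrightarrow> x \<noteq> c \<Longrightarrow> y \<noteq> c"
  by (induction rule: rtranclp_induct) (auto simp: linked_def)

lemma joined_row: "joined F C c x y \<Longrightarrow> r \<in> F \<Longrightarrow> c \<notin> r \<Longrightarrow> y \<in> r \<Longrightarrow> y \<in> C \<Longrightarrow> z \<in> r \<Longrightarrow> z \<in> C \<Longrightarrow> joined F C c x z"
  by (erule rtranclp.rtrancl_into_rtrancl) (auto simp: linked_def)

text \<open>The list \<open>L\<close> orders a module and replaces its representative \<open>s\<close>.\<close>
lemma consec_substitute:
  assumes c1: "consec r (P @ [s] @ Q)" and c2: "consec r L" and s: "s \<in> set L"
    and mod: "set L \<subseteq> r \<or> set L \<inter> r = {} \<or> (set P \<union> set Q) \<inter> r = {}"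
    and dist: "s \<notin> set P" "s \<notin> set Q"
  shows "consec r (P @ L @ Q)"
proof -
  consider "(set P \<union> set Q) \<inter> r = {}" | "set L \<subseteq> r" | "set L \<inter> r = {}" using mod by blast
  then show ?thesis
  proof cases
    case 1
    obtain xs ys zs where "L = xs @ ys @ zs" "set ys \<subseteq> r" "set xs \<inter> r = {}" "set zs \<inter> r = {}"
      using c2 unfolding consec_def by blast
    with 1 show ?thesis by (intro consecI[of _ "P @ xs" ys "zs @ Q"]) auto
  next
    case 2
    with s have "s \<in> r" by blast
    obtain xs ys zs where e: "P @ [s] @ Q = xs @ ys @ zs" "set ys \<subseteq> r" "set xs \<inter> r = {}" "set zs \<inter> r = {}"
      using c1 unfolding consec_def by blast
    have "s \<in> set (xs @ ys @ zs)" using e(1) by (metis in_set_conv_decomp append_Cons append_Nil)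
    with \<open>s \<in> r\<close> e have "s \<in> set ys" by auto
    then obtain y1 y2 where ys: "ys = y1 @ s # y2" by (meson split_list)
    from e(1) ys have "P @ s # Q = (xs @ y1) @ s # (y2 @ zs)" by simp
    then have "P = xs @ y1 \<and> Q = y2 @ zs"
      using dist by (metis append_Cons_eq_iff in_set_conv_decomp append_eq_append_conv2 append_Cons)
    with e 2 ys show ?thesis by (intro consecI[of _ xs "y1 @ L @ y2" zs]) auto
  next
    case 3
    with s have "s \<notin> r" by blast
    obtain xs ys zs where e: "P @ [s] @ Q = xs @ ys @ zs" "set ys \<subseteq> r" "set xs \<inter> r = {}" "set zs \<inter> r = {}"
      using c1 unfolding consec_def by blast
    have "s \<in> set (xs @ ys @ zs)" using e(1) by (metis in_set_conv_decomp append_Cons append_Nil)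
    with \<open>s \<notin> r\<close> e have "s \<in> set xs \<or> s \<in> set zs" by auto
    then show ?thesis
    proof
      assume "s \<in> set xs"
      then obtain x1 x2 where xs: "xs = x1 @ s # x2" by (meson split_list)
      from e(1) xs have "P @ s # Q = x1 @ s # (x2 @ ys @ zs)" by simp
      then have "P = x1 \<and> Q = x2 @ ys @ zs"
        using dist by (metis append_Cons_eq_iff)
      with e xs 3 show ?thesis by (intro consecI[of _ "P @ L @ x2" ys zs]) auto
    next
      assume "s \<in> set zs"
      then obtain z1 z2 where zs: "zs = z1 @ s # z2" by (meson split_list)
      from e(1) zs have "P @ s # Q = (xs @ ys @ z1) @ s # z2" by simp
      then have "P = xs @ ys @ z1 \<and> Q = z2"
        using dist by (metis append_Cons_eq_iff)
      with e zs 3 show ?thesis by (intro consecI[of _ xs ys "z1 @ L @ Q"]) auto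
    qed
  qed
qed

section \<open>Orders that start at a given element\<close>

text \<open>
  With \<open>s\<close> as the first element, \<open>A a\<close> has to precede \<open>a\<close>. These sets form a chain, which gives the order.
\<close>
locale tucker =
  fixes F :: "'a set set" and C :: "'a set" and s :: 'a
  assumes s: "s \<in> C" and fin: "finite C" and at_free: "at_free F C"
    and conn: "\<And>a b. a \<in> C \<Longrightarrow> b \<in> C \<Longrightarrow> a \<noteq> s \<Longrightarrow> b \<noteq> s \<Longrightarrow> joined F C s a b"
    and IH: "\<And>C'. C' \<subset> C \<Longrightarrow> \<exists>cs. distinct cs \<and> set cs = C' \<and> (\<forall>r\<in>F. consec r cs)"
begin

definition A :: "'a \<Rightarrow> 'a set" where "A a = {y. joined F C a s y}"

lemma A_sub: "A a \<subseteq> C"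
  using joined_in s unfolding A_def by fastforce

lemma s_A: "s \<in> A a"
  unfolding A_def by simp

lemma self_A: "a \<noteq> s \<Longrightarrow> a \<notin> A a"
  unfolding A_def using joined_ne by fastforce

text \<open>Otherwise \<open>a\<close>, \<open>b\<close> and \<open>s\<close> would be asteroidal:
  the assumption \<open>conn\<close> supplies the connection of \<open>a\<close> and
  \<open>b\<close> that avoids \<open>s\<close>.\<close>

lemma A_total:
  assumes "a \<in> C" "b \<in> C" "a \<noteq> s" "b \<noteq> s" "a \<noteq> b"
  shows "b \<notin> A a \<or> a \<notin> A b"
proof (rule ccontr)
  assume "\<not> ?thesis"
  then have "joined F C a s b" "joined F C b s a" unfolding A_def by auto
  moreover have "joined F C s a b" using conn assms by blast
  ultimately show False using at_free s assms joined_sym unfolding at_free_def by metis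
qed

text \<open>A row that crosses the boundary of \<open>A a\<close> and misses \<open>a\<close> would
  extend the connection to \<open>y\<close>.\<close>

lemma A_row: "r \<in> F \<Longrightarrow> x \<in> r \<Longrightarrow> x \<in> A a \<Longrightarrow> y \<in> r \<Longrightarrow> y \<in> C \<Longrightarrow> y \<notin> A a \<Longrightarrow> a \<in> r"
  using joined_row[of F C a s x r y] A_sub[of a] unfolding A_def by blast

text \<open>If a row on a connection from \<open>s\<close> that avoids \<open>a\<close> contained
  \<open>b\<close>, then \<open>b\<close> would be in \<open>A a\<close>. So the connection avoids
  \<open>b\<close> as well. Together with \<open>A_total\<close> this makes the sets
  \<open>A a\<close> a chain.\<close>

lemma A_mono:
  assumes "a \<noteq> s" "b \<in> C" "b \<notin> A a"
  shows "A a \<subseteq> A b"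
proof
  fix y assume "y \<in> A a"
  then have "joined F C a s y" unfolding A_def by simp
  then have "joined F C a s y \<and> joined F C b s y"
  proof (induction rule: rtranclp_induct)
    case (step y z)
    then obtain r where r: "r \<in> F" "y \<in> r" "z \<in> r" "a \<notin> r" "y \<in> C" "z \<in> C"
      unfolding linked_def by blast
    have "b \<notin> r"
      using joined_row[OF conjunct1[OF step.IH] r(1,4,2,5), of b] assms unfolding A_def by auto
    with r step show ?case
      by (metis joined_row)
  qed simp
  then show "y \<in> A b" unfolding A_def by simp
qed

text \<open>Rows that meet \<open>A a\<close> have to be initial segments of the tail, so that they
  can be continued to the left. The tail is assembled from classes of elements with equal
  \<open>A\<close>, along the chain.\<close>

lemma tail_order:
  assumes "a \<in> C" "a \<noteq> s"
  shows "\<exists>ws. distinct ws \<and> set ws = C - A a \<and>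
    (\<forall>r\<in>F. (r \<inter> A a = {} \<longrightarrow> consec r ws) \<and>
       (r \<inter> A a \<noteq> {} \<longrightarrow> (\<exists>ys zs. ws = ys @ zs \<and> set ys \<subseteq> r \<and> set zs \<inter> r = {})))"
  using assms
proof (induction "card (C - A a)" arbitrary: a rule: less_induct)
  case less
  \<comment> \<open>The chain does not distinguish the elements of \<open>B\<close>, but by
    \<open>A_row\<close> each row that crosses the boundary of \<open>A a\<close> contains all of
    them.\<close>
  define B where "B = {b \<in> C. b \<noteq> s \<and> A b = A a}"
  have BA: "b \<notin> A a" if "b \<in> B" for b using that self_A unfolding B_def by blast
  have aB: "a \<in> B" using less.prems unfolding B_def by simp
  have Ball: "B \<subseteq> r" if r: "r \<in> F" "r \<inter> A a \<noteq> {}" "r \<inter> (C - A a) \<noteq> {}" for r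
  proof
    fix b assume "b \<in> B"
    then have "A b = A a" unfolding B_def by simp
    moreover obtain x y where "x \<in> r" "x \<in> A a" "y \<in> r" "y \<in> C" "y \<notin> A a"
      using r(2,3) by blast
    ultimately show "b \<in> r" using A_row[of r x b y] r(1) by simp
  qed
  have Bsub: "B \<subset> C" using s BA s_A unfolding B_def by blast
  show ?case
  proof (cases "C - A a = B")
    case True
    obtain L where L: "distinct L" "set L = B" "\<forall>r\<in>F. consec r L" using IH[OF Bsub] by blast
    show ?thesis
    proof (rule exI[of _ L], intro conjI ballI impI)
      fix r assume r: "r \<in> F" "r \<inter> A a \<noteq> {}"
      show "\<exists>ys zs. L = ys @ zs \<and> set ys \<subseteq> r \<and> set zs \<inter> r = {}"
      proof (cases "r \<inter> (C - A a) = {}")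
        case True
        then show ?thesis using L(2) \<open>C - A a = B\<close> by (intro exI[of _ "[]"] exI[of _ L]) auto
      next
        case False
        then show ?thesis using L(2) Ball[OF r] by (intro exI[of _ L] exI[of _ "[]"]) auto
      qed
    qed (use L True in auto)
  next
    case False
    define R where "R = C - A a - B"
    have Rne: "R \<noteq> {}" using False BA unfolding R_def B_def by blast
    have finR: "finite R" using fin unfolding R_def by simp
    \<comment> \<open>The next class is that of \<open>t\<close>. Minimality of
      \<open>card (A t)\<close> forces \<open>A t\<close> to be exactly \<open>A a\<close> together
      with \<open>B\<close>.\<close>
    define t where "t = arg_min_on (\<lambda>y. card (A y)) R"
    have tR: "t \<in> R" unfolding t_def by (rule arg_min_if_finite(1)[OF finR Rne])
    have tmin: "\<not> card (A y) < card (A t)" if "y \<in> R" for y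
      using arg_min_if_finite(2)[OF finR Rne, of "\<lambda>y. card (A y)"] that unfolding t_def by blast
    have tC: "t \<in> C" "t \<notin> A a" "t \<notin> B" "t \<noteq> s" using tR s_A unfolding R_def by auto
    have At: "A a \<subseteq> A t" using A_mono less.prems tC by blast
    have tne: "A t \<noteq> A a" using tC unfolding B_def by blast
    have "A t = A a \<union> B"
    proof
      show "A t \<subseteq> A a \<union> B"
      proof
        fix y assume y: "y \<in> A t"
        show "y \<in> A a \<union> B"
        proof (rule ccontr)
          assume n: "y \<notin> A a \<union> B"
          then have yR: "y \<in> R" "y \<noteq> s" using y A_sub s_A unfolding R_def by auto
          then have yt: "y \<noteq> t" using y self_A tC by blast
          have yC: "y \<in> C" using y A_sub by blast
          have "t \<notin> A y" using A_total[of t y] tC y yt yC yR by blast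
          then have "A y \<subseteq> A t" using A_mono[OF yR(2) tC(1)] by blast
          moreover have "y \<notin> A y" using self_A yR by blast
          ultimately have "A y \<subset> A t" using y by blast
          then have "card (A y) < card (A t)"
            using psubset_card_mono finite_subset[OF A_sub fin] by blast
          then show False using tmin yR by blast
        qed
      qed
      show "A a \<union> B \<subseteq> A t"
      proof -
        have "b \<in> A t" if "b \<in> B" for b
        proof (rule ccontr)
          assume "b \<notin> A t"
          then have "A t \<subseteq> A b" using A_mono tC that unfolding B_def by blast
          then show False using At tne that unfolding B_def by auto
        qed
        then show ?thesis using At by blast
      qed
    qed
    note At_eq = this
    have "card (C - A t) < card (C - A a)"
      using aB BA[OF aB] less.prems At_eq fin by (intro psubset_card_mono) auto
    from less.hyps[OF this tC(1,4)] obtain ws where ws0: "distinct ws" "set ws = C - A t"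
      "\<forall>r\<in>F. (r \<inter> A t = {} \<longrightarrow> consec r ws) \<and>
       (r \<inter> A t \<noteq> {} \<longrightarrow> (\<exists>ys zs. ws = ys @ zs \<and> set ys \<subseteq> r \<and> set zs \<inter> r = {}))"
      by (elim exE conjE)
    have ws: "distinct ws" "set ws = C - A t"
      "\<And>r. r \<in> F \<Longrightarrow> r \<inter> A t = {} \<Longrightarrow> consec r ws"
      "\<And>r. r \<in> F \<Longrightarrow> r \<inter> A t \<noteq> {} \<Longrightarrow> \<exists>ys zs. ws = ys @ zs \<and> set ys \<subseteq> r \<and> set zs \<inter> r = {}"
      using ws0(1,2) bspec[OF ws0(3)] by simp_all
    have "insert t B \<subset> C" using Bsub tC s s_A BA by blast
    from IH[OF this] obtain L0 where L0: "distinct L0" "set L0 = insert t B" "\<forall>r\<in>F. consec r L0" by blast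
    \<comment> \<open>As \<open>a\<close> is in \<open>A t\<close>, some row that avoids
      \<open>t\<close> leaves \<open>A a\<close>, and it contains \<open>B\<close> by
      \<open>Ball\<close>. This row forces \<open>t\<close> to an end of every consecutive order of
      \<open>insert t B\<close>.\<close>
    obtain \<alpha> where \<alpha>: "\<alpha> \<in> F" "B \<subseteq> \<alpha>" "t \<notin> \<alpha>"
    proof -
      have "joined F C t s z \<Longrightarrow> z \<in> A a \<or> (\<exists>x y. x \<in> A a \<and> y \<notin> A a \<and> linked F C t x y)" for z
        by (induction rule: rtranclp_induct) (use s_A in blast)+
      moreover have "joined F C t s a" using At_eq aB unfolding A_def by blast
      ultimately obtain x y where xy: "x \<in> A a" "y \<notin> A a" "linked F C t x y" using BA aB by blast
      then obtain r where "r \<in> F" "x \<in> r" "y \<in> r" "t \<notin> r" "y \<in> C" unfolding linked_def by blast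
      moreover then have "B \<subseteq> r" using xy by (intro Ball) auto
      ultimately show thesis using that by blast
    qed
    \<comment> \<open>Here \<open>t\<close> is only a marker for the rest of the tail: it makes the
      rows through \<open>t\<close> extend to the right end of \<open>L\<close>, where
      \<open>ws\<close> is attached.\<close>
    have "\<exists>L. distinct (L @ [t]) \<and> set L = B \<and> (\<forall>r\<in>F. consec r (L @ [t]))"
    proof -
      have "consec \<alpha> L0" using L0(3) \<alpha>(1) by blast
      then obtain xs ys zs where e: "L0 = xs @ ys @ zs" "set ys \<subseteq> \<alpha>" "set xs \<inter> \<alpha> = {}" "set zs \<inter> \<alpha> = {}"
        unfolding consec_def by blast
      have sub: "set xs \<subseteq> {t}" "set zs \<subseteq> {t}" using e L0(2) \<alpha> by auto
      have "t \<in> set L0" using L0 by simp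
      then have "t \<in> set xs \<or> t \<in> set zs" using e \<alpha> by auto
      then show ?thesis
      proof
        assume "t \<in> set zs"
        moreover have "distinct zs" using e L0 by simp
        ultimately have "zs = [t]" using sub distinct_singletonI[of zs t] by simp
        moreover have "xs = []" using sub e L0 \<open>t \<in> set zs\<close> by (cases xs) auto
        ultimately have "L0 = ys @ [t]" using e by simp
        then show ?thesis using L0 tC by (intro exI[of _ ys]) auto
      next
        assume "t \<in> set xs"
        moreover have "distinct xs" using e L0 by simp
        ultimately have "xs = [t]" using sub distinct_singletonI[of xs t] by simp
        moreover have "zs = []" using sub e L0 \<open>t \<in> set xs\<close> by (cases zs) auto
        ultimately have "rev L0 = rev ys @ [t]" using e by simp
        moreover have "\<forall>r\<in>F. consec r (rev L0)" using L0 consec_rev by blast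
        moreover have "distinct (rev L0)" "set (rev L0) = insert t B" using L0 by auto
        ultimately show ?thesis using tC by (intro exI[of _ "rev ys"]) auto
      qed
    qed
    then obtain L where L: "distinct (L @ [t])" "set L = B" "\<And>r. r \<in> F \<Longrightarrow> consec r (L @ [t])" by blast
    show ?thesis
    proof (rule exI[of _ "L @ ws"], intro conjI ballI impI)
      show "distinct (L @ ws)" using L ws At_eq by auto
      show "set (L @ ws) = C - A a" using L ws At_eq BA Bsub by auto
    next
      fix r assume r: "r \<in> F" "r \<inter> A a \<noteq> {}"
      show "\<exists>ys zs. L @ ws = ys @ zs \<and> set ys \<subseteq> r \<and> set zs \<inter> r = {}"
      proof (cases "r \<inter> (C - A a) = {}")
        case True
        then show ?thesis using L ws At_eq BA Bsub by (intro exI[of _ "[]"] exI[of _ "L @ ws"]) auto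
      next
        case False
        with Ball[OF r] have "B \<subseteq> r" by blast
        moreover obtain ys zs where "ws = ys @ zs" "set ys \<subseteq> r" "set zs \<inter> r = {}"
          using ws(4)[OF r(1)] r At by blast
        ultimately show ?thesis using L by (intro exI[of _ "L @ ys"] exI[of _ zs]) auto
      qed
    next
      fix r assume r: "r \<in> F" "r \<inter> A a = {}"
      show "consec r (L @ ws)"
      proof (cases "r \<inter> B = {}")
        case True
        with r At_eq have "r \<inter> A t = {}" by blast
        from ws(3)[OF r(1) this] obtain xs ys zs where
          "ws = xs @ ys @ zs" "set ys \<subseteq> r" "set xs \<inter> r = {}" "set zs \<inter> r = {}" unfolding consec_def by blast
        with True L show ?thesis by (intro consecI[of _ "L @ xs" ys zs]) auto
      next
        case False
        from L(3)[OF r(1)] obtain xs ys zs where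
          e: "L @ [t] = xs @ ys @ zs" "set ys \<subseteq> r" "set xs \<inter> r = {}" "set zs \<inter> r = {}" unfolding consec_def by blast
        show ?thesis
        proof (cases "t \<in> r")
          case True
          have "zs = []"
          proof (rule ccontr)
            assume "zs \<noteq> []"
            then have "last (L @ [t]) = last zs" using e by simp
            then have "t \<in> set zs" using \<open>zs \<noteq> []\<close> by simp
            with True e show False by auto
          qed
          moreover have "ys \<noteq> []" using True e calculation by auto
          ultimately obtain ys' where ys': "ys = ys' @ [t]" "L = xs @ ys'"
            using e(1) by (metis append_Nil2 append_assoc butlast_snoc last_appendR last_snoc append_butlast_last_id)
          have "r \<inter> A t \<noteq> {}" using False At_eq by blast
          from ws(4)[OF r(1) this] obtain y2 z2 where "ws = y2 @ z2" "set y2 \<subseteq> r" "set z2 \<inter> r = {}" by blast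
          with e ys' show ?thesis by (intro consecI[of _ xs "ys' @ y2" z2]) auto
        next
          case tr: False
          \<comment> \<open>A row that meets \<open>A t\<close> and misses \<open>t\<close> cannot
            leave \<open>A t\<close>, so it contains nothing of \<open>ws\<close>.\<close>
          have "r \<inter> (C - A t) = {}" proof -
            obtain x where "x \<in> r" "x \<in> A t" using False At_eq by blast
            then show ?thesis using A_row[OF r(1), of x t] tr by blast
          qed
          then have w: "set ws \<inter> r = {}" using ws by blast
          show ?thesis
          proof (cases "zs = []")
            case True
            then have "ys \<noteq> [] \<Longrightarrow> t \<in> set ys" using e(1) by (metis append_Nil2 last_appendR last_in_set last_snoc)
            then have "ys = []" using e tr by auto
            with True e False L(2) have False by auto
            then show ?thesis ..
          next
            case False
            then have "L = xs @ ys @ butlast zs" using e(1) by (metis butlast_append butlast_snoc append_is_Nil_conv)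
            moreover have "set (butlast zs) \<inter> r = {}" using e by (meson disjoint_iff in_set_butlastD)
            ultimately show ?thesis using w e by (intro consecI[of _ xs ys "butlast zs @ ws"]) auto
          qed
        qed
      qed
    qed
  qed
qed

text \<open>An \<open>a\<close> with the smallest \<open>A a\<close> has \<open>A a = {s}\<close>.
  Then the rows through \<open>s\<close> are initial segments of the tail, and \<open>s\<close> can
  be put in front.\<close>

lemma rooted_order: "\<exists>cs. distinct cs \<and> set cs = C \<and> (\<forall>r\<in>F. consec r cs)"
proof (cases "C = {s}")
  case True
  moreover have "consec r [s]" for r
    by (cases "s \<in> r") (simp_all add: consec_none consec_all)
  ultimately show ?thesis
    by (intro exI[of _ "[s]"]) auto
next
  case False
  define R where "R = C - {s}"
  have R: "finite R" "R \<noteq> {}" using fin False s unfolding R_def by auto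
  define a where "a = arg_min_on (\<lambda>y. card (A y)) R"
  have aR: "a \<in> R" unfolding a_def by (rule arg_min_if_finite(1)[OF R])
  have amin: "\<not> card (A y) < card (A a)" if "y \<in> R" for y
    using arg_min_if_finite(2)[OF R, of "\<lambda>y. card (A y)"] that unfolding a_def by blast
  have a: "a \<in> C" "a \<noteq> s" using aR unfolding R_def by auto
  have "A a = {s}"
  proof (rule ccontr)
    assume "A a \<noteq> {s}"
    then obtain y where y: "y \<in> A a" "y \<noteq> s" using s_A by blast
    then have yC: "y \<in> C" using A_sub by blast
    have "y \<noteq> a" using y self_A a by blast
    then have "a \<notin> A y" using A_total[of a y] a y yC by blast
    then have "A y \<subseteq> A a" using A_mono[OF y(2) a(1)] by blast
    then have "A y \<subset> A a" using y self_A by blast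
    then have "card (A y) < card (A a)" using psubset_card_mono finite_subset[OF A_sub fin] by blast
    then show False using amin y yC unfolding R_def by blast
  qed
  from tail_order[OF a] this obtain ws where ws: "distinct ws" "set ws = C - {s}"
    "\<And>r. r \<in> F \<Longrightarrow> s \<notin> r \<Longrightarrow> consec r ws"
    "\<And>r. r \<in> F \<Longrightarrow> s \<in> r \<Longrightarrow> \<exists>ys zs. ws = ys @ zs \<and> set ys \<subseteq> r \<and> set zs \<inter> r = {}"
    by auto
  show ?thesis
  proof (intro exI[of _ "s # ws"] conjI ballI)
    fix r assume r: "r \<in> F"
    show "consec r (s # ws)"
    proof (cases "s \<in> r")
      case True
      from ws(4)[OF r True] obtain ys zs where "ws = ys @ zs" "set ys \<subseteq> r" "set zs \<inter> r = {}" by blast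
      with True show ?thesis by (intro consecI[of _ "[]" "s # ys" zs]) auto
    next
      case False
      from ws(3)[OF r False] obtain xs ys zs where
        "ws = xs @ ys @ zs" "set ys \<subseteq> r" "set xs \<inter> r = {}" "set zs \<inter> r = {}" unfolding consec_def by blast
      with False show ?thesis by (intro consecI[of _ "s # xs" ys zs]) auto
    qed
  qed (use ws s in auto)
qed

end

text \<open>The extremal choice is an avoided element \<open>s\<close> and a component
  \<open>D p\<close> of largest size among the elements joined without \<open>s\<close>. Then the
  complement \<open>E\<close> of \<open>D p\<close> is a module: a row that meets \<open>D p\<close>
  and \<open>E\<close> contains all of \<open>E\<close>. If \<open>E = {s}\<close>, the order can
  start with \<open>s\<close>; otherwise \<open>E\<close> is ordered on its own and substituted for
  \<open>s\<close> in an order of \<open>insert s (D p)\<close>.\<close>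

lemma at_free_imp_order:
  assumes "finite C" "at_free F C"
  shows "\<exists>cs. distinct cs \<and> set cs = C \<and> (\<forall>r\<in>F. consec r cs)"
  using assms
proof (induction "card C" arbitrary: C rule: less_induct)
  case less
  have IH: "\<exists>cs. distinct cs \<and> set cs = C' \<and> (\<forall>r\<in>F. consec r cs)" if "C' \<subset> C" for C'
    using less.hyps[OF psubset_card_mono[OF less.prems(1) that]] that less.prems at_free_mono
    by (meson finite_subset psubset_imp_subset)
  \<comment> \<open>The first component of \<open>p\<close> is the avoided element, the second one
    the starting point.\<close>
  define D where "D p = {y. joined F C (fst p) (snd p) y}" for p
  define Z where "Z = {p \<in> C \<times> C. fst p \<noteq> snd p}"
  show ?case
  proof (cases "Z = {}")
    case True
    show ?thesis
    proof (cases "C = {}")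
      case True
      then show ?thesis by (intro exI[of _ "[]"]) (auto intro: consec_none)
    next
      case False
      then obtain s where s: "s \<in> C" by blast
      with \<open>Z = {}\<close> have "C = {s}" unfolding Z_def by auto
      moreover have "consec r [s]" for r
        by (cases "s \<in> r") (simp_all add: consec_none consec_all)
      ultimately show ?thesis by (intro exI[of _ "[s]"]) auto
    qed
  next
    case False
    have finZ: "finite Z" using less.prems(1) unfolding Z_def by simp
    have Dsub: "D p \<subseteq> C" if "p \<in> Z" for p
      using joined_in that unfolding D_def Z_def by fastforce
    obtain p where p: "p \<in> Z" "\<And>q. q \<in> Z \<Longrightarrow> card (D q) \<le> card (D p)"
    proof -
      have "Max ((\<lambda>q. card (D q)) ` Z) \<in> (\<lambda>q. card (D q)) ` Z"
        using finZ False by (intro Max_in) auto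
      then obtain p where "p \<in> Z" "card (D p) = Max ((\<lambda>q. card (D q)) ` Z)" by auto
      with that[of p] finZ show thesis by simp
    qed
    obtain s d where sd: "p = (s, d)" "s \<in> C" "d \<in> C" "s \<noteq> d"
      using p(1) unfolding Z_def by auto
    have dD: "d \<in> D p" unfolding D_def by (simp add: sd)
    have sD: "s \<notin> D p" using joined_ne[of F C s d s] sd unfolding D_def by auto
    have DC: "D p \<subseteq> C" using Dsub p by blast
    define E where "E = C - D p"
    have sE: "s \<in> E" using sD sd unfolding E_def by simp
    have Drow: "r \<inter> C \<subseteq> D p" if r: "r \<in> F" "s \<notin> r" "r \<inter> D p \<noteq> {}" for r
    proof
      fix z assume z: "z \<in> r \<inter> C"
      obtain y where "y \<in> r" "y \<in> D p" using r(3) by blast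
      with z joined_row[of F C s d y r z] r sd DC show "z \<in> D p" unfolding D_def by auto
    qed
    \<comment> \<open>If such a row missed some \<open>e\<close> in \<open>E\<close>, then avoiding
      \<open>e\<close> instead of \<open>s\<close> would keep \<open>D p\<close> connected and add
      \<open>s\<close>, against the maximality of \<open>D p\<close>.\<close>
    have module: "E \<subseteq> r" if r: "r \<in> F" "r \<inter> D p \<noteq> {}" "r \<inter> E \<noteq> {}" for r
    proof
      have sr: "s \<in> r" using Drow[OF r(1) _ r(2)] r(3) unfolding E_def by blast
      fix e assume e: "e \<in> E"
      show "e \<in> r"
      proof (rule ccontr)
        assume er: "e \<notin> r"
        then have es: "e \<noteq> s" using sr by blast
        have 1: "joined F C s d y \<Longrightarrow> joined F C e d y \<and> joined F C s d y" for y
        proof (induction rule: rtranclp_induct)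
          case (step y z)
          then obtain q where q: "q \<in> F" "y \<in> q" "z \<in> q" "s \<notin> q" "y \<in> C" "z \<in> C"
            unfolding linked_def by blast
          have "y \<in> D p" using step sd unfolding D_def by simp
          then have "e \<notin> q" using Drow[of q] q e unfolding E_def by blast
          with q step show ?case by (metis joined_row)
        qed simp
        obtain y where y: "y \<in> r" "y \<in> D p" using r(2) by blast
        have "joined F C e d s"
          using joined_row[of F C e d y r s] 1[of y] y er r sr sd DC unfolding D_def by auto
        then have "insert s (D p) \<subseteq> D (e, d)"
          using 1 sd unfolding D_def by auto
        moreover have edZ: "(e, d) \<in> Z" using e dD sd unfolding E_def Z_def by auto
        ultimately have "card (insert s (D p)) \<le> card (D (e, d))"
          using Dsub less.prems(1) by (intro card_mono) (auto intro: finite_subset)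
        also have "\<dots> \<le> card (D p)" using p edZ by blast
        finally show False using sD finite_subset[OF DC less.prems(1)] by simp
      qed
    qed
    show ?thesis
    proof (cases "E = {s}")
      case True
      interpret tucker F C s
      proof
        fix a b assume ab: "a \<in> C" "b \<in> C" "a \<noteq> s" "b \<noteq> s"
        with True have "a \<in> D p" "b \<in> D p" unfolding E_def by auto
        then have "joined F C s d a" "joined F C s d b" unfolding D_def by (auto simp: sd)
        then show "joined F C s a b" using joined_sym by (metis rtranclp_trans)
      qed (use less.prems sd IH in auto)
      show ?thesis by (rule rooted_order)
    next
      case False
      then have "insert s (D p) \<subset> C" using sE sd DC unfolding E_def by blast
      from IH[OF this] obtain L1 where L1: "distinct L1" "set L1 = insert s (D p)" "\<forall>r\<in>F. consec r L1"
        by blast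
      have "E \<subset> C" using dD sd unfolding E_def by blast
      from IH[OF this] obtain L where L: "distinct L" "set L = E" "\<forall>r\<in>F. consec r L" by blast
      from L1(2) obtain P Q where PQ: "L1 = P @ s # Q" by (metis insertI1 split_list)
      with L1 sD have PQ2: "set P \<union> set Q = D p" "s \<notin> set P" "s \<notin> set Q" by auto
      show ?thesis
      proof (intro exI[of _ "P @ L @ Q"] conjI ballI)
        show "distinct (P @ L @ Q)" using PQ PQ2 L1 L unfolding E_def by auto
        show "set (P @ L @ Q) = C" using PQ2 L DC unfolding E_def by auto
        fix r assume r: "r \<in> F"
        show "consec r (P @ L @ Q)"
        proof (rule consec_substitute[of r P s Q L])
          show "set L \<subseteq> r \<or> set L \<inter> r = {} \<or> (set P \<union> set Q) \<inter> r = {}"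
            using module[OF r] L(2) PQ2(1) by blast
        qed (use L1 L r PQ PQ2 sE in auto)
      qed
    qed
  qed
qed

section \<open>Holes and asteroidal triples\<close>

locale bipartite =
  fixes adj :: "'a \<Rightarrow> 'a \<Rightarrow> bool" and side :: "'a \<Rightarrow> bool"
  assumes adj_sym: "adj u v \<Longrightarrow> adj v u" and adj_side: "adj u v \<Longrightarrow> side u \<noteq> side v"
begin

lemma adj_commute: "adj u v \<longleftrightarrow> adj v u"
  using adj_sym by blast

definition nb :: "'a \<Rightarrow> 'a set" where "nb c = {v. adj c v}"

lemma in_nb [simp]: "v \<in> nb c \<longleftrightarrow> adj c v"
  unfolding nb_def by simp

inductive walk :: "'a set \<Rightarrow> nat \<Rightarrow> 'a \<Rightarrow> 'a \<Rightarrow> bool" for X where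
  walk0: "u \<in> X \<Longrightarrow> walk X 0 u u"
| walkS: "u \<in> X \<Longrightarrow> adj u w \<Longrightarrow> walk X n w v \<Longrightarrow> walk X (Suc n) u v"

inductive_cases walk0E: "walk X 0 u v"
inductive_cases walkSE: "walk X (Suc n) u v"

lemma walk_0 [simp]: "walk X 0 u v \<longleftrightarrow> u = v \<and> u \<in> X"
  by (auto intro: walk0 elim: walk0E)

lemma walk_in: "walk X n u v \<Longrightarrow> u \<in> X \<and> v \<in> X"
  by (induction rule: walk.induct) auto

lemma walk_mono: "walk X n u v \<Longrightarrow> X \<subseteq> Y \<Longrightarrow> walk Y n u v"
  by (induction rule: walk.induct) (auto intro: walk.intros)

lemma walk_trans: "walk X n u v \<Longrightarrow> walk X m v w \<Longrightarrow> walk X (n + m) u w"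
  by (induction rule: walk.induct) (auto intro: walk.intros)

lemma walk_1: "u \<in> X \<Longrightarrow> v \<in> X \<Longrightarrow> adj u v \<Longrightarrow> walk X 1 u v"
  using walkS[of u X v 0 v] by simp

lemma walk_snoc: "walk X n u v \<Longrightarrow> adj v w \<Longrightarrow> w \<in> X \<Longrightarrow> walk X (Suc n) u w"
  using walk_trans[of X n u v 1 w] walk_1[of v X w] walk_in by auto

lemma walk_rev: "walk X n u v \<Longrightarrow> walk X n v u"
  by (induction rule: walk.induct) (auto intro: walk_snoc adj_sym)

lemma walk_parity: "walk X n u v \<Longrightarrow> even n \<longleftrightarrow> side u = side v"
  by (induction rule: walk.induct) (auto dest: adj_side)

lemma walk_split: "walk X (n + m) u v \<Longrightarrow> \<exists>w. walk X n u w \<and> walk X m w v"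
proof (induction n arbitrary: u)
  case 0
  then show ?case using walk_in by auto
next
  case (Suc n)
  then have "walk X (Suc (n + m)) u v" by simp
  then obtain w where w: "u \<in> X" "adj u w" "walk X (n + m) w v" by (auto elim: walkSE)
  from Suc.IH[OF w(3)] w show ?case by (auto intro: walkS)
qed

text \<open>Follows a walk up to its first entry into \<open>M\<close>: \<open>w\<close> is the
  vertex of entry and \<open>v'\<close> the last vertex before it.\<close>

lemma walk_first:
  assumes "walk X n u v" "u \<notin> M"
  shows "walk (X - M) n u v \<or> (\<exists>i v' w. i < n \<and> walk (X - M) i u v' \<and> adj v' w \<and> w \<in> M \<and> w \<in> X)"
  using assms
proof (induction rule: walk.induct)
  case (walkS u w n v)
  show ?case
  proof (cases "w \<in> M")
    case True
    then show ?thesis using walkS walk_in by (intro disjI2 exI[of _ 0] exI[of _ u] exI[of _ w]) auto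
  next
    case False
    from walkS.IH[OF False] show ?thesis
    proof (elim disjE exE conjE)
      assume "walk (X - M) n w v"
      then show ?thesis using walkS by (intro disjI1 walk.walkS[of u _ w]) auto
    next
      fix i v' w' assume "i < n" "walk (X - M) i w v'" "adj v' w'" "w' \<in> M" "w' \<in> X"
      then show ?thesis using walkS
        by (intro disjI2 exI[of _ "Suc i"] exI[of _ v'] exI[of _ w']) (auto intro!: walk.walkS[of u _ w])
    qed
  qed
qed simp

lemma walk_closed:
  assumes "walk X n u v" "u \<in> K" "\<And>a b. a \<in> K \<Longrightarrow> b \<in> X \<Longrightarrow> adj a b \<Longrightarrow> b \<in> K"
  shows "walk (X \<inter> K) n u v"
  using assms(1,2)
proof (induction rule: walk.induct)
  case (walkS u w n v)
  then have "w \<in> K" using assms(3) walk_in by blast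
  with walkS show ?case by (intro walk.walkS[of u _ w]) auto
qed simp

text \<open>Avoiding \<open>nb c\<close> keeps the walk away from \<open>c\<close> too, since
  \<open>c\<close> is not an endpoint. The lengths are recorded because they are bounded in
  \<open>good\<close> and their sum is minimised in \<open>has_AT_imp_hole\<close>.\<close>

definition AT :: "'a set \<Rightarrow> 'a \<Rightarrow> 'a \<Rightarrow> 'a \<Rightarrow> nat \<Rightarrow> nat \<Rightarrow> nat \<Rightarrow> bool" where
  "AT X a b c i j k \<longleftrightarrow> a \<noteq> b \<and> b \<noteq> c \<and> c \<noteq> a \<and> side a = side b \<and> side b = side c \<and> a \<in> X \<and> b \<in> X \<and> c \<in> X \<and>
     walk (X - nb c) i a b \<and> walk (X - nb a) j b c \<and> walk (X - nb b) k c a"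

definition has_AT :: "'a set \<Rightarrow> bool" where
  "has_AT X \<longleftrightarrow> (\<exists>a b c i j k. AT X a b c i j k)"

definition good :: "nat \<Rightarrow> 'a set \<Rightarrow> bool" where
  "good B X \<longleftrightarrow> (\<forall>a b c i j k. AT X a b c i j k \<longrightarrow> \<not> (i \<le> B \<and> j \<le> B \<and> k \<le> B))"

lemma AT_rot: "AT X a b c i j k \<Longrightarrow> AT X b c a j k i"
  unfolding AT_def by metis

lemma AT_refl: "AT X a b c i j k \<Longrightarrow> AT X b a c i k j"
  unfolding AT_def using walk_rev by metis

lemma AT_mono: "AT X a b c i j k \<Longrightarrow> X \<subseteq> Y \<Longrightarrow> AT Y a b c i j k"
  unfolding AT_def by (meson Diff_mono order_refl subsetD walk_mono)

lemma has_AT_mono: "has_AT X \<Longrightarrow> X \<subseteq> Y \<Longrightarrow> has_AT Y"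
  unfolding has_AT_def using AT_mono by meson

lemma good_mono: "good B Y \<Longrightarrow> X \<subseteq> Y \<Longrightarrow> good B X"
  unfolding good_def using AT_mono by meson

lemma goodD: "good B X \<Longrightarrow> AT X a b c i j k \<Longrightarrow> i \<le> B \<Longrightarrow> j \<le> B \<Longrightarrow> k \<le> B \<Longrightarrow> False"
  unfolding good_def by blast

lemma ATI:
  assumes "a \<noteq> b" "b \<noteq> c" "c \<noteq> a" "side a = side b" "side b = side c"
    "walk (X - nb c) i a b" "walk (X - nb a) j b c" "walk (X - nb b) k c a"
  shows "AT X a b c i j k"
  using assms walk_in[OF assms(6)] walk_in[OF assms(7)] unfolding AT_def by blast

section \<open>Induced paths and what is adjacent to them\<close>

definition induced_path :: "(int \<Rightarrow> 'a) \<Rightarrow> int \<Rightarrow> int \<Rightarrow> bool" where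
  "induced_path p l u \<longleftrightarrow> (\<forall>i\<in>{l..u}. \<forall>j\<in>{l..u}. adj (p i) (p j) \<longleftrightarrow> \<bar>i - j\<bar> = 1)"

lemma induced_pathD: "induced_path p l u \<Longrightarrow> l \<le> i \<Longrightarrow> i \<le> u \<Longrightarrow> l \<le> j \<Longrightarrow> j \<le> u \<Longrightarrow> adj (p i) (p j) \<longleftrightarrow> \<bar>i - j\<bar> = 1"
  unfolding induced_path_def by simp

lemma induced_path_sub: "induced_path p l u \<Longrightarrow> l \<le> l' \<Longrightarrow> u' \<le> u \<Longrightarrow> induced_path p l' u'"
  unfolding induced_path_def by simp

lemma induced_path_shift: "induced_path p l u \<Longrightarrow> induced_path (\<lambda>i. p (k + i)) (l - k) (u - k)"
  unfolding induced_path_def by simp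

lemma induced_path_flip: "induced_path p l u \<Longrightarrow> induced_path (\<lambda>i. p (k - i)) (k - u) (k - l)"
  unfolding induced_path_def by (auto simp: abs_if)

lemma induced_path_side:
  assumes "induced_path p l u" "l \<le> i" "i \<le> u" "l \<le> j" "j \<le> u"
  shows "side (p i) = side (p j) \<longleftrightarrow> even (i - j)"
proof -
  have *: "l \<le> i \<Longrightarrow> i + int n \<le> u \<Longrightarrow> side (p (i + int n)) = side (p i) \<longleftrightarrow> even n" for i n
  proof (induction n)
    case (Suc n)
    have "adj (p (i + int n)) (p (i + int (Suc n)))"
      using Suc.prems assms(1) by (subst induced_pathD[OF assms(1)]) auto
    with adj_side Suc show ?case by auto
  qed simp
  show ?thesis
  proof (cases "i \<le> j")
    case True
    with *[of i "nat (j - i)"] assms show ?thesis by (auto simp: even_nat_iff)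
  next
    case False
    with *[of j "nat (i - j)"] assms show ?thesis by (auto simp: even_nat_iff)
  qed
qed

lemma walk_path_aux:
  assumes "\<And>k. i \<le> k \<Longrightarrow> k \<le> i + int n \<Longrightarrow> p k \<in> Y" "\<And>k. i \<le> k \<Longrightarrow> k < i + int n \<Longrightarrow> adj (p k) (p (k + 1))"
  shows "walk Y n (p i) (p (i + int n))"
  using assms
proof (induction n)
  case (Suc n)
  have "walk Y n (p i) (p (i + int n))" using Suc by force
  moreover have "adj (p (i + int n)) (p (i + int n + 1))" using Suc.prems by simp
  moreover have "p (i + int n + 1) \<in> Y" using Suc.prems by simp
  ultimately show ?case using walk_snoc by (simp add: add.commute add.left_commute)
qed simp

lemma walk_path:
  assumes "induced_path p l u" "l \<le> i" "i \<le> j" "j \<le> u" "\<And>k. i \<le> k \<Longrightarrow> k \<le> j \<Longrightarrow> p k \<in> Y"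
  shows "walk Y (nat (j - i)) (p i) (p j)"
  using walk_path_aux[of i "nat (j - i)" p Y] assms by (auto simp: induced_pathD)

text \<open>If \<open>v\<close> skipped more than four edges of the path, then
  \<open>p (i - 1)\<close>, \<open>p (i + 3)\<close>, \<open>p (j + 1)\<close> would be a triple
  with short walks: the outer two are connected through \<open>v\<close>, which is on the side of
  \<open>p (i + 3)\<close> and so not adjacent to it.\<close>

lemma spread:
  assumes g: "good B X" and B: "B \<ge> 40" and p: "induced_path p l u" and pX: "\<And>i. l \<le> i \<Longrightarrow> i \<le> u \<Longrightarrow> p i \<in> X"
    and v: "v \<in> X" "adj v (p i)" "adj v (p j)" and ij: "l < i" "i < j" "j < u" "j - i \<le> 30"
  shows "j - i \<le> 4"
proof (rule ccontr)
  assume "\<not> ?thesis"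
  moreover have "side (p i) = side (p j)" using v adj_side by blast
  then have ev: "even (i - j)" using induced_path_side[OF p] ij by auto
  \<comment> \<open>By parity the gap is at least 6, which keeps \<open>p (i + 3)\<close> away from
    both ends of the detour.\<close>
  ultimately have d: "j - i \<ge> 6" by presburger
  note pD = induced_pathD[OF p]
  have nv: "v \<noteq> p k" if "l \<le> k" "k \<le> u" for k
    using v pD[of k i] pD[of k j] that ij d by (auto simp: abs_if split: if_splits)
  have sv: "side v = side (p (i+3))"
  proof -
    have "side (p i) \<noteq> side (p (i + 3))" using induced_path_side[OF p, of i "i+3"] ij d by auto
    then show ?thesis using adj_side[OF v(2)] by auto
  qed
  have "AT X (p (i - 1)) (p (i + 3)) (p (j + 1)) (nat 4) (nat (j - i - 2)) 4"
  proof (rule ATI)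
    show "side (p (i - 1)) = side (p (i + 3))" using induced_path_side[OF p] ij d by auto
    show "side (p (i + 3)) = side (p (j + 1))" using induced_path_side[OF p] ij d ev by auto
    show "p (i - 1) \<noteq> p (i + 3)" using pD[of "i-1" i] pD[of "i+3" i] ij d by auto
    show "p (i + 3) \<noteq> p (j + 1)" using pD[of "i+3" j] pD[of "j+1" j] ij d by auto
    show "p (j + 1) \<noteq> p (i - 1)" using pD[of "i-1" i] pD[of "j+1" i] ij d by auto
    show "walk (X - nb (p (j + 1))) (nat 4) (p (i - 1)) (p (i + 3))"
      using walk_path[OF p, of "i - 1" "i + 3" "X - nb (p (j+1))"] ij d pX by (auto simp: pD)
    show "walk (X - nb (p (i - 1))) (nat (j - i - 2)) (p (i + 3)) (p (j + 1))"
    proof -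
      have "walk (X - nb (p (i - 1))) (nat (j + 1 - (i + 3))) (p (i + 3)) (p (j + 1))"
        using ij d pX by (intro walk_path[OF p]) (auto simp: pD)
      then show ?thesis by (simp add: algebra_simps)
    qed
    have a: "adj (p (j+1)) (p j)" "adj (p i) (p (i - 1))" using ij d by (auto simp: pD)
    have m: "p k \<in> X - nb (p (i + 3))" if "k \<in> {i - 1, i, j, j + 1}" for k
      using that ij d pX by (auto simp: pD)
    have "v \<in> X - nb (p (i + 3))" using v sv adj_side by auto
    then show "walk (X - nb (p (i + 3))) 4 (p (j + 1)) (p (i - 1))"
      using a v m adj_sym by (simp add: numeral_eq_Suc) (auto intro!: walkS[OF _ a(1)] walkS[OF _ adj_sym[OF v(3)]] walkS[OF _ v(2)] walkS[OF _ a(2)])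
  qed
  then show False using goodD[OF g] ij B by force
qed

text \<open>Let \<open>p l\<close> and \<open>p u\<close> be the outermost neighbours of
  \<open>v\<close>. If \<open>w\<close> saw nothing near \<open>p 0\<close>, then
  \<open>p (l - 2)\<close>, \<open>p (u + 2)\<close> and \<open>w\<close> would be a triple with
  walks of length at most 8, as both path vertices reach \<open>w\<close> through \<open>v\<close>.
  Since \<open>u - l \<le> 4\<close> by \<open>spread\<close>, the indices \<open>l - 2\<close> and
  \<open>u + 2\<close> are within 6 of 0.\<close>

lemma edge_local0:
  assumes g: "good B X" and B: "B \<ge> 40" and p: "induced_path p (-12) 12" and pX: "\<And>i. -12 \<le> i \<Longrightarrow> i \<le> 12 \<Longrightarrow> p i \<in> X"
    and v: "v \<in> X" "adj v (p 0)" and w: "w \<in> X" "adj v w"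
  shows "\<exists>j. \<bar>j\<bar> \<le> 6 \<and> adj w (p j)"
proof (rule ccontr)
  assume contra: "\<not> ?thesis"
  note pD = induced_pathD[OF p]
  \<comment> \<open>The window of radius 10 bounds the gap by 20, so that \<open>spread\<close>
    applies and reduces it to 4.\<close>
  define N where "N = {j \<in> {-10..10}. adj v (p j)}"
  have "N \<subseteq> {-10..10}" "0 \<in> N" using v unfolding N_def by auto
  then have fin: "finite N" "N \<noteq> {}" "0 \<in> N" using finite_subset by auto
  define l where "l = Min N"
  define u where "u = Max N"
  have lu: "l \<in> N" "u \<in> N" "l \<le> 0" "0 \<le> u" using fin unfolding l_def u_def by auto
  have le: "l \<le> j" "j \<le> u" if "j \<in> N" for j using that fin unfolding l_def u_def by auto
  have sp: "u - l \<le> 4"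
  proof (cases "l = u")
    case False
    then show ?thesis
      using spread[OF g B p pX v(1), of l u] lu unfolding N_def by auto
  qed simp
  have nw: "\<not> adj w (p j)" if "\<bar>j\<bar> \<le> 6" for j using contra that by blast
  have nv: "\<not> adj v (p (l - 2))" "\<not> adj v (p (u + 2))"
    using le[of "l-2"] le[of "u+2"] sp lu unfolding N_def by auto
  have a: "adj v (p l)" "adj v (p u)" using lu unfolding N_def by auto
  have sl: "side (p l) = side (p u)" using a adj_side by blast
  then have ev: "even (l - u)" using induced_path_side[OF p] lu sp by auto
  have sw: "side w = side (p l)" using adj_side[OF w(2)] adj_side[OF a(1)] by auto
  have wn: "w \<noteq> p k" if "\<bar>k\<bar> \<le> 7" for k
  proof
    assume walk: "w = p k"
    have "\<bar>k - 1\<bar> \<le> 6 \<or> \<bar>k + 1\<bar> \<le> 6" using that by auto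
    then show False using nw[of "k-1"] nw[of "k+1"] pD[of k "k-1"] pD[of k "k+1"] that walk by auto
  qed
  have "AT X (p (l - 2)) (p (u + 2)) w (nat (u - l + 4)) 4 4"
  proof (rule ATI)
    show "side (p (l - 2)) = side (p (u + 2))" "side (p (u + 2)) = side w"
      using induced_path_side[OF p, of "l-2" "u+2"] induced_path_side[OF p, of "l" "u+2"] ev lu sp sw by auto
    show "p (l - 2) \<noteq> p (u + 2)" using pD[of "l-2" "l-3"] pD[of "u+2" "l-3"] lu sp by auto
    show "p (u + 2) \<noteq> w" "w \<noteq> p (l - 2)" using wn[of "u+2"] wn[of "l-2"] lu sp by auto
    have "walk (X - nb w) (nat (u + 2 - (l - 2))) (p (l - 2)) (p (u + 2))"
      using lu sp nw pX by (intro walk_path[OF p]) auto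
    then show "walk (X - nb w) (nat (u - l + 4)) (p (l - 2)) (p (u + 2))" by (simp add: algebra_simps)
    have a1: "adj (p (u+2)) (p (u+1))" "adj (p (u+1)) (p u)" "adj (p u) v"
      using lu sp a adj_sym by (auto simp: pD)
    have wA: "w \<in> X - nb (p (l - 2))" "w \<in> X - nb (p (u + 2))"
      using nw[of "l-2"] nw[of "u+2"] w lu sp by (auto simp: adj_commute)
    have vA: "v \<in> X - nb (p (l - 2))" "v \<in> X - nb (p (u + 2))"
      using nv v by (auto simp: adj_commute)
    have m: "p k \<in> X - nb (p (l - 2))" if "k \<in> {u, u+1, u+2}" for k
      using that lu sp pX by (auto simp: pD)
    show "walk (X - nb (p (l - 2))) 4 (p (u + 2)) w"
      using walkS[OF m[of "u+2"] a1(1) walkS[OF m[of "u+1"] a1(2) walkS[OF m[of u] a1(3) walk_1[OF vA(1) wA(1) w(2)]]]]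
      by (simp add: numeral_eq_Suc)
    have a2: "adj (p l) (p (l-1))" "adj (p (l-1)) (p (l-2))"
      using lu sp a by (auto simp: pD)
    have m: "p k \<in> X - nb (p (u + 2))" if "k \<in> {l, l-1, l-2}" for k
      using that lu sp pX by (auto simp: pD)
    show "walk (X - nb (p (u + 2))) 4 w (p (l - 2))"
      using walkS[OF wA(2) adj_sym[OF w(2)] walkS[OF vA(2) a(1) walkS[OF m[of l] a2(1) walk_1[OF m[of "l-1"] m[of "l-2"] a2(2)]]]]
      by (simp add: numeral_eq_Suc)
  qed
  then show False using goodD[OF g] sp lu B by force
qed

lemma edge_local:
  assumes g: "good B X" and B: "B \<ge> 40" and p: "induced_path p (k - 12) (k + 12)"
    and pX: "\<And>i. k - 12 \<le> i \<Longrightarrow> i \<le> k + 12 \<Longrightarrow> p i \<in> X"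
    and v: "v \<in> X" "adj v (p k)" and w: "w \<in> X" "adj v w"
  shows "\<exists>j. \<bar>j - k\<bar> \<le> 6 \<and> adj w (p j)"
proof -
  have "\<exists>j. \<bar>j\<bar> \<le> 6 \<and> adj w (p (k + j))"
    using induced_path_shift[OF p, of k] by (intro edge_local0[OF g B, of "\<lambda>i. p (k + i)"]) (use pX v w in auto)
  then obtain j where "\<bar>j\<bar> \<le> 6" "adj w (p (k + j))" by blast
  then show ?thesis by (intro exI[of _ "k + j"]) simp
qed

section \<open>Shortest walks and holes\<close>

lemma walk_fun:
  "walk Y n a b \<Longrightarrow> \<exists>p. p 0 = a \<and> p n = b \<and> (\<forall>i\<le>n. p i \<in> Y) \<and> (\<forall>i<n. adj (p i) (p (Suc i)))"
proof (induction rule: walk.induct)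
  case (walkS u w n v)
  then obtain p where p: "p 0 = w" "p n = v" "\<forall>i\<le>n. p i \<in> Y" "\<forall>i<n. adj (p i) (p (Suc i))" by blast
  show ?case
    by (rule exI[of _ "\<lambda>i. case i of 0 \<Rightarrow> u | Suc i \<Rightarrow> p i"]) (use p walkS in \<open>auto split: nat.split\<close>)
qed auto

lemma fun_walk:
  "i \<le> j \<Longrightarrow> \<forall>k\<le>j. p k \<in> Y \<Longrightarrow> \<forall>k<j. adj (p k) (p (Suc k)) \<Longrightarrow> walk Y (j - i) (p i) (p j)"
proof (induction j)
  case (Suc j)
  show ?case
  proof (cases "i = Suc j")
    case False
    then have "walk Y (j - i) (p i) (p j)" using Suc by simp
    then have "walk Y (Suc (j - i)) (p i) (p (Suc j))" using Suc.prems by (intro walk_snoc) auto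
    then show ?thesis using False Suc.prems by (simp add: Suc_diff_le)
  qed (use Suc in simp)
qed simp

text \<open>A chord of a shortest walk would shorten it.\<close>

lemma geodesic:
  assumes w: "walk Y n a b" and min: "\<And>n'. n' < n \<Longrightarrow> \<not> walk Y n' a b"
  obtains p where "p 0 = a" "p (int n) = b" "\<And>i. 0 \<le> i \<Longrightarrow> i \<le> int n \<Longrightarrow> p i \<in> Y" "induced_path p 0 (int n)"
proof -
  obtain p where p: "p 0 = a" "p n = b" "\<forall>i\<le>n. p i \<in> Y" "\<forall>i<n. adj (p i) (p (Suc i))"
    using walk_fun[OF w] by blast
  have far: "j \<le> Suc i" if ij: "i < j" "j \<le> n" "adj (p i) (p j)" for i j
  proof (rule ccontr)
    assume far: "\<not> ?thesis"
    have "walk Y (i - 0) (p 0) (p i)" "walk Y (n - j) (p j) (p n)"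
      using p ij by (intro fun_walk; simp)+
    then have "walk Y (Suc i + (n - j)) (p 0) (p n)"
      using walk_trans[OF walk_snoc[of Y i "p 0" "p i" "p j"], of "n - j" "p n"] ij p by auto
    moreover have "Suc i + (n - j) < n" using ij far by auto
    ultimately show False using min p by blast
  qed
  have iff: "adj (p i) (p j) \<longleftrightarrow> j = Suc i \<or> i = Suc j" if "i \<le> n" "j \<le> n" for i j
  proof
    assume a: "adj (p i) (p j)"
    then have "i \<noteq> j" using adj_side by blast
    then show "j = Suc i \<or> i = Suc j"
      using far[of i j] far[of j i] a adj_sym[OF a] that by (cases "i < j") auto
  next
    assume "j = Suc i \<or> i = Suc j"
    then show "adj (p i) (p j)" using p that adj_sym by auto
  qed
  show thesis
  proof (rule that[of "\<lambda>i. p (nat i)"])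
    show "induced_path (\<lambda>i. p (nat i)) 0 (int n)"
      unfolding induced_path_def by (auto simp: iff nat_le_iff)
  qed (use p in auto)
qed

text \<open>The cycle is unrolled to a periodic sequence over the integers.\<close>
definition hole :: "'a set \<Rightarrow> (int \<Rightarrow> 'a) \<Rightarrow> int \<Rightarrow> bool" where
  "hole X p m \<longleftrightarrow> m \<ge> 6 \<and> (\<forall>i. p i \<in> X) \<and> (\<forall>i. p (i + m) = p i) \<and>
     (\<forall>i j. adj (p i) (p j) \<longleftrightarrow> m dvd (i - j - 1) \<or> m dvd (i - j + 1))"

lemma dvd_small: "(m::int) dvd x \<Longrightarrow> - m \<le> x \<Longrightarrow> x < m \<Longrightarrow> x = 0 \<or> x = - m"
proof -
  assume "m dvd x" "- m \<le> x" "x < m"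
  then obtain k where k: "x = m * k" by (auto elim: dvdE)
  with \<open>- m \<le> x\<close> \<open>x < m\<close> have "m * (-1) \<le> m * k" "m * k < m * 1" "0 < m" by auto
  then have "-1 \<le> k" "k < 1" by (metis mult_le_cancel_left_pos, metis mult_less_cancel_left_pos)
  then have "k = -1 \<or> k = 0" by linarith
  with k show ?thesis by auto
qed

lemma dvd_mod_diff: "(m::int) dvd (i - j - e) \<longleftrightarrow> m dvd (i mod m - j mod m - e)"
proof -
  have "i - j - e = (m * (i div m) + i mod m) - (m * (j div m) + j mod m) - e"
    by (simp only: mult_div_mod_eq)
  also have "\<dots> = (i mod m - j mod m - e) + (i div m - j div m) * m"
    by (simp add: algebra_simps)
  finally show ?thesis by (metis dvd_add_times_triv_right_iff)
qed

lemma hole_induced_path: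
  assumes "hole X p m" "u - l \<le> m - 2"
  shows "induced_path p l u"
  unfolding induced_path_def
proof (intro ballI)
  fix i j assume ij: "i \<in> {l..u}" "j \<in> {l..u}"
  have "adj (p i) (p j) \<longleftrightarrow> m dvd (i - j - 1) \<or> m dvd (i - j + 1)"
    using assms unfolding hole_def by blast
  moreover have "m dvd (i - j - 1) \<longleftrightarrow> i - j = 1"
    using dvd_small[of m "i - j - 1"] ij assms by auto
  moreover have "m dvd (i - j + 1) \<longleftrightarrow> i - j = -1"
    using dvd_small[of m "i - j + 1"] ij assms by auto
  ultimately show "adj (p i) (p j) \<longleftrightarrow> \<bar>i - j\<bar> = 1" by auto
qed

lemma hole_shift: "hole X p m \<Longrightarrow> hole X (\<lambda>i. p (k + i)) m"
  unfolding hole_def by (simp add: add.assoc[symmetric])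

lemma hole_mono: "hole X p m \<Longrightarrow> X \<subseteq> Y \<Longrightarrow> hole Y p m"
  unfolding hole_def by blast

lemma hole_adj: "hole X p m \<Longrightarrow> adj (p i) (p (i + 1))"
  unfolding hole_def by simp

lemma hole_in: "hole X p m \<Longrightarrow> p i \<in> X"
  unfolding hole_def by blast

lemma hole_walk:
  assumes "hole X p m" "i \<le> j" "\<And>k. i \<le> k \<Longrightarrow> k \<le> j \<Longrightarrow> p k \<in> Y"
  shows "walk Y (nat (j - i)) (p i) (p j)"
  using walk_path_aux[of i "nat (j - i)" p Y] assms hole_adj by auto

lemma hole_inj:
  assumes h: "hole X p m" and e: "p i = p j"
  shows "m dvd (i - j)"
proof -
  have *: "adj (p a) (p b) \<longleftrightarrow> m dvd (a - b - 1) \<or> m dvd (a - b + 1)" and m: "m \<ge> 6" for a b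
    using h unfolding hole_def by blast+
  \<comment> \<open>Equal vertices have the same neighbours. Comparing both neighbours leaves a
    shift by 2 in either direction as the only alternative, and this would mean
    \<open>m dvd 4\<close>.\<close>
  have 1: "m dvd (i - j) \<or> m dvd (i - j - 2)" using *[of i "j + 1"] *[of j "j + 1"] e by (auto simp: algebra_simps)
  have 2: "m dvd (i - j) \<or> m dvd (i - j + 2)" using *[of i "j - 1"] *[of j "j - 1"] e by (auto simp: algebra_simps)
  show ?thesis
  proof (rule ccontr)
    assume "\<not> ?thesis"
    with 1 2 have "m dvd ((i - j + 2) - (i - j - 2))" by (meson dvd_diff)
    then have "m dvd 4" by simp
    then show False using m zdvd_imp_le by fastforce
  qed
qed

lemma hole_AT:
  assumes h: "hole X p m"
  shows "AT X (p 0) (p 2) (p 4) 2 2 (nat (m - 4))"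
proof -
  have m: "m \<ge> 6" using h unfolding hole_def by blast
  have ip: "induced_path p 0 4" using hole_induced_path[OF h] m by simp
  have nz: "p a \<noteq> p b" if "0 < b - a" "b - a < m" for a b
    using hole_inj[OF h, of b a] that zdvd_imp_le by force
  have adj: "adj (p i) (p j) \<longleftrightarrow> m dvd (i - j - 1) \<or> m dvd (i - j + 1)" for i j
    using h unfolding hole_def by blast
  have nd: "\<not> m dvd x" if "0 < x \<and> x < m \<or> - m < x \<and> x < 0" for x
    using dvd_small[of m x] that by auto
  show ?thesis
  proof (rule ATI)
    have "p 0 \<noteq> p 4" by (rule nz) (use m in auto)
    then show "p 4 \<noteq> p 0" by metis
    show "p 0 \<noteq> p 2" "p 2 \<noteq> p 4" by (rule nz; use m in auto)+
    show "side (p 0) = side (p 2)" "side (p 2) = side (p 4)"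
      using induced_path_side[OF ip] by auto
    show "walk (X - nb (p 4)) 2 (p 0) (p 2)"
    proof -
      have "walk (X - nb (p 4)) (nat (2 - 0)) (p 0) (p 2)"
        using hole_in[OF h] nd m by (intro hole_walk[OF h]) (auto simp: adj)
      then show ?thesis by simp
    qed
    show "walk (X - nb (p 0)) 2 (p 2) (p 4)"
    proof -
      have "walk (X - nb (p 0)) (nat (4 - 2)) (p 2) (p 4)"
        using hole_in[OF h] nd m by (intro hole_walk[OF h]) (auto simp: adj)
      then show ?thesis by simp
    qed
    have "walk (X - nb (p 2)) (nat (m - 4)) (p 4) (p m)"
    proof (rule hole_walk[OF h])
      fix k assume "4 \<le> k" "k \<le> m"
      then show "p k \<in> X - nb (p 2)"
        using hole_in[OF h] nd[of "2 - k - 1"] nd[of "2 - k + 1"] m by (auto simp: adj)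
    qed (use m in auto)
    moreover have "p m = p 0" using h unfolding hole_def by (metis add_0)
    ultimately show "walk (X - nb (p 2)) (nat (m - 4)) (p 4) (p 0)" by simp
  qed
qed

lemma hole_has_AT: "hole X p m \<Longrightarrow> has_AT X"
  unfolding has_AT_def using hole_AT by blast

text \<open>The triple of \<open>hole_AT\<close> has no walk longer than the hole.\<close>

lemma hole_long: "good B X \<Longrightarrow> B \<ge> 2 \<Longrightarrow> hole X p m \<Longrightarrow> m > int B"
  using goodD[OF _ hole_AT, of B X p m] by (cases "m \<le> int B") (auto simp: nat_le_iff)

text \<open>A shortest walk from \<open>u\<close> to \<open>x\<close> in \<open>Y\<close> is induced
  and, by parity and \<open>\<not> adj u x\<close>, has length at least 3. As \<open>v\<close> and
  \<open>w\<close> see only its ends, they close it to an induced cycle.\<close>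

lemma hole_extract:
  assumes uv: "adj u v" and vw: "adj v w" and wx: "adj w x" and nux: "\<not> adj u x"
    and walk: "walk Y n u x" and YX: "Y \<subseteq> X" "v \<in> X" "w \<in> X"
    and Yv: "\<And>y. y \<in> Y \<Longrightarrow> adj v y \<Longrightarrow> y = u" and Yw: "\<And>y. y \<in> Y \<Longrightarrow> adj w y \<Longrightarrow> y = x"
  shows "\<exists>p m. hole X p m"
proof -
  define N where "N = (LEAST n. walk Y n u x)"
  have wN: "walk Y N u x" unfolding N_def using walk by (rule LeastI)
  have minN: "\<not> walk Y n' u x" if "n' < N" for n'
    using that not_less_Least unfolding N_def by blast
  have "side u \<noteq> side x" using adj_side[OF uv] adj_side[OF vw] adj_side[OF wx] by auto
  then have oddN: "odd N" using walk_parity[OF wN] by blast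
  have "N \<noteq> 1" using wN nux by (auto elim!: walkSE)
  with oddN have N3: "N \<ge> 3" by presburger
  obtain p where p: "p 0 = u" "p (int N) = x" "\<And>i. 0 \<le> i \<Longrightarrow> i \<le> int N \<Longrightarrow> p i \<in> Y" "induced_path p 0 (int N)"
    using geodesic[OF wN minN] by blast
  note pD = induced_pathD[OF p(4)]
  \<comment> \<open>Distinctness is not part of \<open>induced_path\<close>: the two ends of a path
    of length two may coincide. The length \<open>N \<ge> 3\<close> excludes this.\<close>
  have p0: "i = 0" if "0 \<le> i" "i \<le> int N" "p i = u" for i
  proof -
    have "adj (p i) (p 1)" using that p(1) pD[of 0 1] N3 by simp
    then have "\<bar>i - 1\<bar> = 1" using pD[of i 1] that N3 by simp
    moreover have "i \<noteq> 2"
    proof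
      assume "i = 2"
      then have "adj (p 0) (p 3)" using pD[of 2 3] that p(1) N3 by simp
      then show False using pD[of 0 3] N3 by simp
    qed
    ultimately show ?thesis by auto
  qed
  have pN: "i = int N" if "0 \<le> i" "i \<le> int N" "p i = x" for i
  proof -
    have "adj (p i) (p (int N - 1))" using that p(2) pD[of "int N" "int N - 1"] N3 by simp
    then have "\<bar>i - (int N - 1)\<bar> = 1" using pD[of i "int N - 1"] that N3 by simp
    moreover have "i \<noteq> int N - 2"
    proof
      assume "i = int N - 2"
      then have "adj (p (int N)) (p (int N - 3))" using pD[of "int N - 2" "int N - 3"] that p(2) N3 by simp
      then show False using pD[of "int N" "int N - 3"] N3 by simp
    qed
    ultimately show ?thesis using that by auto
  qed
  \<comment> \<open>The cycle consists of the \<open>N + 1\<close> vertices of the walk,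
    \<open>w\<close> and \<open>v\<close>.\<close>
  define m where "m = int N + 3"
  define q0 where "q0 i = (if i \<le> int N then p i else if i = int N + 1 then w else v)" for i
  have vY: "v \<noteq> p i" if "0 \<le> i" "i \<le> int N" for i
  proof
    assume e: "v = p i"
    have "adj w (p i)" using e vw adj_sym by blast
    then have "p i = x" using Yw p(3) that by blast
    then have "adj v w" "v = x" using vw e by auto
    then have "i = int N" using pN that e by blast
    moreover have "adj (p i) (p 0)" using e uv p(1) adj_sym by auto
    ultimately show False using pD[of "int N" 0] N3 by auto
  qed
  have iff_v: "adj v (p i) \<longleftrightarrow> i = 0" if "0 \<le> i" "i \<le> int N" for i
    using Yv[OF p(3)[OF that]] p0 that p(1) uv adj_sym by auto
  have iff_w: "adj w (p i) \<longleftrightarrow> i = int N" if "0 \<le> i" "i \<le> int N" for i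
    using Yw[OF p(3)[OF that]] pN that p(2) wx adj_sym by auto
  have nself: "\<not> adj z z" for z using adj_side by blast
  have base: "adj (q0 i) (q0 j) \<longleftrightarrow> \<bar>i - j\<bar> = 1 \<or> \<bar>i - j\<bar> = m - 1"
    if ij: "0 \<le> i" "i < m" "0 \<le> j" "j < m" for i j
  proof -
    consider "i \<le> int N" | "i = int N + 1" | "i = int N + 2" using ij unfolding m_def by linarith
    then show ?thesis
    proof cases
      case 1
      consider "j \<le> int N" | "j = int N + 1" | "j = int N + 2" using ij unfolding m_def by linarith
      then show ?thesis
      proof cases
        case a: 1
        then show ?thesis using pD[of i j] 1 ij unfolding q0_def m_def by auto
      next
        case 2
        then show ?thesis using iff_w[of i] 1 ij adj_commute unfolding q0_def m_def by auto
      next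
        case 3
        then show ?thesis using iff_v[of i] 1 ij adj_commute unfolding q0_def m_def by auto
      qed
    next
      case 2
      consider "j \<le> int N" | "j = int N + 1" | "j = int N + 2" using ij unfolding m_def by linarith
      then show ?thesis
      proof cases
        case 1
        then show ?thesis using iff_w[of j] 2 ij N3 unfolding q0_def m_def by auto
      next
        case a: 2
        then show ?thesis using 2 nself N3 unfolding q0_def m_def by auto
      next
        case 3
        then show ?thesis using 2 vw adj_commute N3 unfolding q0_def m_def by auto
      qed
    next
      case 3
      consider "j \<le> int N" | "j = int N + 1" | "j = int N + 2" using ij unfolding m_def by linarith
      then show ?thesis
      proof cases
        case 1
        then show ?thesis using iff_v[of j] 3 ij N3 unfolding q0_def m_def by auto
      next
        case 2
        then show ?thesis using 3 vw N3 unfolding q0_def m_def by auto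
      next
        case a: 3
        then show ?thesis using 3 nself N3 unfolding q0_def m_def by auto
      qed
    qed
  qed
  define q where "q i = q0 (i mod m)" for i
  have m6: "m \<ge> 6" using N3 unfolding m_def by simp
  have "hole X q m"
    unfolding hole_def
  proof (intro conjI allI)
    fix i j
    let ?i = "i mod m" and ?j = "j mod m"
    have r: "0 \<le> ?i" "?i < m" "0 \<le> ?j" "?j < m" using m6 by auto
    note d = dvd_mod_diff[of m i j]
    have 1: "m dvd (?i - ?j - 1) \<longleftrightarrow> ?i - ?j = 1 \<or> ?i - ?j = 1 - m"
      using dvd_small[of m "?i - ?j - 1"] r by auto
    have 2: "m dvd (?i - ?j + 1) \<longleftrightarrow> ?i - ?j = -1 \<or> ?i - ?j = m - 1"
    proof
      assume "m dvd (?i - ?j + 1)"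
      then have "m dvd - (?i - ?j + 1)" by (subst dvd_minus_iff)
      then show "?i - ?j = -1 \<or> ?i - ?j = m - 1" using dvd_small[of m "- (?i - ?j + 1)"] r by auto
    qed auto
    have "adj (q i) (q j) \<longleftrightarrow> \<bar>?i - ?j\<bar> = 1 \<or> \<bar>?i - ?j\<bar> = m - 1"
      using base[OF r] unfolding q_def .
    also have "\<dots> \<longleftrightarrow> (?i - ?j = 1 \<or> ?i - ?j = 1 - m) \<or> (?i - ?j = -1 \<or> ?i - ?j = m - 1)"
      using m6 by linarith
    also have "\<dots> \<longleftrightarrow> m dvd (i - j - 1) \<or> m dvd (i - j + 1)"
      unfolding 1[symmetric] 2[symmetric] using d[of 1] d[of "-1"] by simp
    finally show "adj (q i) (q j) \<longleftrightarrow> m dvd (i - j - 1) \<or> m dvd (i - j + 1)" .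
  next
    fix i show "q i \<in> X"
      using p(3)[of "i mod m"] YX m6 unfolding q_def q0_def by auto
  qed (use m6 q_def in auto)
  then show ?thesis by blast
qed

section \<open>From long asteroidal triples to holes\<close>

definition reach :: "'a set \<Rightarrow> 'a \<Rightarrow> 'a \<Rightarrow> bool" where "reach Y a b \<longleftrightarrow> (\<exists>n. walk Y n a b)"

lemma reachI: "walk Y n a b \<Longrightarrow> reach Y a b"
  unfolding reach_def by blast

lemma reach_trans: "reach Y a b \<Longrightarrow> reach Y b c \<Longrightarrow> reach Y a c"
  unfolding reach_def using walk_trans by blast

lemma reach_sym: "reach Y a b \<Longrightarrow> reach Y b a"
  unfolding reach_def using walk_rev by blast

lemma reach_in: "reach Y a b \<Longrightarrow> a \<in> Y \<and> b \<in> Y"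
  unfolding reach_def using walk_in by blast

lemma reach_refl: "a \<in> Y \<Longrightarrow> reach Y a a"
  unfolding reach_def by (intro exI[of _ 0]) simp

lemma reach_adj: "reach Y a b \<Longrightarrow> adj b c \<Longrightarrow> reach Y c d \<Longrightarrow> reach Y a d"
  using reach_trans reachI[OF walk_1] reach_in by metis

lemma reach_mono: "reach Y a b \<Longrightarrow> Y \<subseteq> Z \<Longrightarrow> reach Z a b"
  unfolding reach_def using walk_mono by blast

lemma reach_path:
  "induced_path p l u \<Longrightarrow> l \<le> i \<Longrightarrow> i \<le> j \<Longrightarrow> j \<le> u \<Longrightarrow> (\<And>k. i \<le> k \<Longrightarrow> k \<le> j \<Longrightarrow> p k \<in> Y) \<Longrightarrow> reach Y (p i) (p j)"
  by (rule reachI[OF walk_path])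

text \<open>The triple is \<open>p 0\<close>, \<open>p n\<close>, \<open>c\<close>, and by
  \<open>t\<close> a walk from \<open>c\<close> first sees the path close to \<open>p n\<close>.
  Replacing \<open>p 0\<close> by \<open>p h\<close> cuts off most of the path, and the walks from
  \<open>c\<close> can be redirected at bounded cost, unless \<open>c\<close> also reaches the part
  before \<open>p h\<close> without passing the neighbourhood \<open>Mid\<close> of the stretch
  around \<open>p h\<close>. In that case the connections of \<open>c\<close> to both sides of the
  stretch bypass it, and \<open>hole_extract\<close> closes a hole.\<close>

lemma hole_or_shorter_aux:
  fixes n :: int
  assumes g: "good B X" and B: "B \<ge> 40" and p: "induced_path p 0 n" and pX: "\<And>i. 0 \<le> i \<Longrightarrow> i \<le> n \<Longrightarrow> p i \<in> X"
    and n: "n \<ge> 200" "even n"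
    and c: "c \<in> X" "\<And>i. 0 \<le> i \<Longrightarrow> i \<le> n \<Longrightarrow> \<not> adj c (p i)" "side c = side (p 0)"
    and Q: "walk (X - nb (p n)) k1 c (p 0)" and R: "walk (X - nb (p 0)) j1 c (p n)"
    and M: "M = {v. \<exists>k\<in>{0..n}. adj v (p k)}"
    and t: "walk (X - M) i c v'" "adj v' w" "w \<in> X" "adj w (p k)" "n - 12 < k" "k \<le> n"
  shows "(\<exists>q m. hole X q m) \<or>
    (\<exists>i' j' k'. AT X (p (n - 60)) (p n) c i' j' k' \<and> i' + j' + k' < nat n + j1 + k1)"
proof -
  \<comment> \<open>The distance 60 leaves room for a stretch of radius 20 and for edge locality
    around it. The new triple has total length at most \<open>60 + (j1 + 61) + (k1 + 21)\<close>,
    which is less than before as \<open>n \<ge> 200\<close>.\<close>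
  define h where "h = n - 60"
  define Mid where "Mid = {v. \<exists>k. \<bar>k - h\<bar> \<le> 20 \<and> adj v (p k)}"
  note pD = induced_pathD[OF p]
  have EL: "\<exists>j. \<bar>j - k\<bar> \<le> 6 \<and> adj w (p j)"
    if "v \<in> X" "adj v (p k)" "12 \<le> k" "k \<le> n - 12" "w \<in> X" "adj v w" for v w k
    by (rule edge_local[OF g B, of p k v w]) (use that pX induced_path_sub[OF p] in auto)
  have MidM: "Mid \<subseteq> M" using n unfolding Mid_def M h_def by force
  have cMid: "c \<notin> Mid" using c(2) n unfolding Mid_def h_def by auto
  show ?thesis
  proof (cases "\<exists>y n' l. walk (X - Mid) n' c y \<and> adj y (p l) \<and> 0 \<le> l \<and> l < h - 20")
    case True
    then obtain y n' l where y: "walk (X - Mid) n' c y" "adj y (p l)" "0 \<le> l" "l < h - 20" by blast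
    have v': "v' \<in> X" "v' \<notin> M" using walk_in[OF t(1)] by auto
    \<comment> \<open>Otherwise the predecessor \<open>v'\<close> would see the path as well, by
      edge locality.\<close>
    have wMid: "w \<notin> Mid"
    proof
      assume "w \<in> Mid"
      then obtain k' where k': "\<bar>k' - h\<bar> \<le> 20" "adj w (p k')" unfolding Mid_def by blast
      have "12 \<le> k'" "k' \<le> n - 12" using k'(1) n unfolding h_def by linarith+
      then obtain j where j: "\<bar>j - k'\<bar> \<le> 6" "adj v' (p j)"
        using EL[of w k' v'] t k' v' adj_sym by blast
      have "j \<in> {0..n}" using j(1) k'(1) n unfolding h_def by auto
      then have "v' \<in> M" using j(2) unfolding M by blast
      then show False using v' by blast
    qed
    \<comment> \<open>As \<open>hole_extract\<close> demands, \<open>p (h - 1)\<close> and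
      \<open>p (h + 2)\<close> are the only neighbours of \<open>p h\<close> and
      \<open>p (h + 1)\<close> that \<open>Y\<close> admits.\<close>
    define Y where "Y = {y \<in> X. (adj (p h) y \<longrightarrow> y = p (h - 1)) \<and> (adj (p (h + 1)) y \<longrightarrow> y = p (h + 2))}"
    have XM: "X - Mid \<subseteq> Y"
    proof
      fix z assume z: "z \<in> X - Mid"
      have "\<not> adj z (p h)" "\<not> adj z (p (h + 1))" using z unfolding Mid_def by force+
      then show "z \<in> Y" using z adj_commute unfolding Y_def by auto
    qed
    have pY: "p i \<in> Y" if "0 \<le> i" "i \<le> n" "i \<le> h - 1 \<or> i \<ge> h + 2" for i
    proof -
      have "i = h - 1" if "adj (p h) (p i)" using that pD[of h i] \<open>0 \<le> i\<close> \<open>i \<le> n\<close> \<open>i \<le> h - 1 \<or> _\<close> n unfolding h_def by auto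
      moreover have "i = h + 2" if "adj (p (h + 1)) (p i)"
        using that pD[of "h + 1" i] \<open>0 \<le> i\<close> \<open>i \<le> n\<close> \<open>i \<le> h - 1 \<or> _\<close> n unfolding h_def by auto
      ultimately show ?thesis using pX that unfolding Y_def by auto
    qed
    have 1: "reach Y (p (h - 1)) (p l)"
      using y n by (intro reach_sym[OF reach_path[OF p]] pY) (auto simp: h_def)
    have 2: "reach Y y c" using reach_sym[OF reach_mono[OF reachI[OF y(1)] XM]] .
    have 3: "reach Y c v'" using reach_mono[OF reachI[OF t(1)]] XM MidM by blast
    have 4: "reach Y w w" using wMid t(3) XM by (intro reach_refl) blast
    have 5: "reach Y (p k) (p (h + 2))"
      using t(5,6) n by (intro reach_sym[OF reach_path[OF p]] pY) (auto simp: h_def)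
    have "reach Y (p (h - 1)) (p (h + 2))"
      using reach_adj[OF 1 adj_sym[OF y(2)] reach_trans[OF 2 reach_adj[OF 3 t(2) reach_adj[OF 4 t(4) 5]]]] .
    then obtain N where N: "walk Y N (p (h - 1)) (p (h + 2))" unfolding reach_def by blast
    have "\<exists>q m. hole X q m"
    proof (rule hole_extract[OF _ _ _ _ N])
      show "adj (p (h - 1)) (p h)" "adj (p h) (p (h + 1))" "adj (p (h + 1)) (p (h + 2))" "\<not> adj (p (h - 1)) (p (h + 2))"
        using n by (auto simp: pD h_def)
    qed (use pX n in \<open>auto simp: Y_def h_def\<close>)
    then show ?thesis ..
  next
    case no: False
    have P: "walk (X - nb c) 60 (p h) (p n)"
    proof -
      have "walk (X - nb c) (nat (n - h)) (p h) (p n)"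
        using n c pX by (intro walk_path[OF p]) (auto simp: h_def)
      then show ?thesis by (simp add: h_def)
    qed
    \<comment> \<open>Just before entering \<open>Mid\<close> the walk already sees the path within
      6 of \<open>l\<close>, but not in the stretch, and not below it in the present case. So it
      sees the path beyond \<open>h + 20\<close>, and \<open>l\<close> is near the upper end of the
      stretch.\<close>
    have entry: "l > h + 14" if e: "walk (X - Mid) i' c z" "adj z z'" "z' \<in> X" "adj z' (p l)" "\<bar>l - h\<bar> \<le> 20" for i' z z' l
    proof -
      have z: "z \<in> X" "z \<notin> Mid" using walk_in[OF e(1)] by auto
      have "12 \<le> l" "l \<le> n - 12" using e(5) n unfolding h_def by linarith+
      then obtain j where j: "\<bar>j - l\<bar> \<le> 6" "adj z (p j)"
        using EL[of z' l z] e z adj_sym by blast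
      have "0 \<le> j" using j(1) e(5) n unfolding h_def by linarith
      then have "\<not> j < h - 20" using no e(1) j(2) by blast
      moreover have "\<not> \<bar>j - h\<bar> \<le> 20" using z j unfolding Mid_def by blast
      ultimately show ?thesis using j by linarith
    qed
    \<comment> \<open>As \<open>Q\<close> ends at \<open>p 0\<close>, below the stretch, it has to
      enter \<open>Mid\<close>. From there the path leads down to \<open>p h\<close>, away from
      \<open>p n\<close>.\<close>
    have Q': "\<exists>k'. k' \<le> k1 + 21 \<and> walk (X - nb (p n)) k' c (p h)"
    proof -
      from walk_first[OF Q cMid] show ?thesis
      proof (elim disjE exE conjE)
        assume "walk (X - nb (p n) - Mid) k1 c (p 0)"
        then have "walk (X - Mid) k1 c (p 0)" by (rule walk_mono) blast
        moreover have "adj (p 0) (p 1)" using n by (simp add: pD)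
        moreover have "(0::int) \<le> 1" "1 < h - 20" using n unfolding h_def by auto
        ultimately have False using no by blast
        then show ?thesis ..
      next
        fix i' z z' assume e: "i' < k1" "walk (X - nb (p n) - Mid) i' c z" "adj z z'" "z' \<in> Mid" "z' \<in> X - nb (p n)"
        obtain l where l: "\<bar>l - h\<bar> \<le> 20" "adj z' (p l)" using e(4) unfolding Mid_def by blast
        have "l > h + 14" using entry[of i' z z' l] e l walk_mono[OF e(2), of "X - Mid"] by blast
        have "walk (X - nb (p n)) (nat (l - h)) (p h) (p l)"
          using n l \<open>l > h + 14\<close> pX by (intro walk_path[OF p]) (auto simp: pD h_def)
        then have a: "walk (X - nb (p n)) (nat (l - h)) (p l) (p h)" by (rule walk_rev)
        have "walk (X - nb (p n)) i' c z" using walk_mono[OF e(2)] by blast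
        then have "walk (X - nb (p n)) (Suc i') c z'" using walk_snoc e by blast
        then have "walk (X - nb (p n)) (Suc (Suc i')) c (p l)" using walk_snoc l walk_in[OF a] by blast
        from walk_trans[OF this a] show ?thesis using e(1) l by (intro exI conjI) auto
      qed
    qed
    have R': "\<exists>j'. j' \<le> j1 + 61 \<and> walk (X - nb (p h)) j' c (p n)"
    proof -
      from walk_first[OF R cMid] show ?thesis
      proof (elim disjE exE conjE)
        assume "walk (X - nb (p 0) - Mid) j1 c (p n)"
        moreover have "X - nb (p 0) - Mid \<subseteq> X - nb (p h)" using adj_commute unfolding Mid_def by force
        ultimately have "walk (X - nb (p h)) j1 c (p n)" by (rule walk_mono)
        then show ?thesis by (intro exI conjI) auto
      next
        fix i' z z' assume e: "i' < j1" "walk (X - nb (p 0) - Mid) i' c z" "adj z z'" "z' \<in> Mid" "z' \<in> X - nb (p 0)"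
        obtain l where l: "\<bar>l - h\<bar> \<le> 20" "adj z' (p l)" using e(4) unfolding Mid_def by blast
        have lh: "l > h + 14" using entry[of i' z z' l] e l walk_mono[OF e(2), of "X - Mid"] by blast
        \<comment> \<open>Otherwise edge locality would give \<open>p h\<close> a neighbour on the
          path within 6 of \<open>l\<close>, but those neighbours are \<open>p (h - 1)\<close> and
          \<open>p (h + 1)\<close>.\<close>
        have nh: "\<not> adj z' (p h)"
        proof
          assume "adj z' (p h)"
          moreover have "12 \<le> l" "l \<le> n - 12" "p h \<in> X" using l(1) n pX unfolding h_def by auto
          ultimately obtain j where j: "\<bar>j - l\<bar> \<le> 6" "adj (p h) (p j)"
            using EL[of z' l "p h"] e l by blast
          have "0 \<le> j" "j \<le> n" "\<bar>h - j\<bar> \<noteq> 1" using j(1) lh l(1) n unfolding h_def by linarith+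
          then show False using pD[of h j] j(2) n unfolding h_def by auto
        qed
        have a: "walk (X - nb (p h)) (nat (n - l)) (p l) (p n)"
          using n l lh pX by (intro walk_path[OF p]) (auto simp: pD h_def)
        have "X - nb (p 0) - Mid \<subseteq> X - nb (p h)" using adj_commute unfolding Mid_def by force
        then have "walk (X - nb (p h)) i' c z" using walk_mono[OF e(2)] by blast
        then have "walk (X - nb (p h)) (Suc i') c z'" using walk_snoc e nh adj_commute by auto
        then have "walk (X - nb (p h)) (Suc (Suc i')) c (p l)" using walk_snoc l walk_in[OF a] by blast
        from walk_trans[OF this a] show ?thesis using e(1) lh n unfolding h_def by (intro exI conjI) auto
      qed
    qed
    obtain j' where j': "j' \<le> j1 + 61" "walk (X - nb (p h)) j' c (p n)" using R' by blast
    obtain k' where k': "k' \<le> k1 + 21" "walk (X - nb (p n)) k' c (p h)" using Q' by blast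
    have "AT X (p h) (p n) c 60 j' k'"
    proof (rule ATI)
      show "p h \<noteq> p n" using pD[of h "h - 1"] pD[of n "h - 1"] n unfolding h_def by auto
      show "p n \<noteq> c" using c(2)[of "n - 1"] pD[of n "n - 1"] n by auto
      show "c \<noteq> p h" using c(2)[of "h - 1"] pD[of h "h - 1"] n unfolding h_def by auto
      show "side (p h) = side (p n)" using induced_path_side[OF p, of h n] n unfolding h_def by auto
      show "side (p n) = side c" using induced_path_side[OF p, of 0 n] n c(3) by auto
    qed (use P walk_rev[OF j'(2)] k' in auto)
    moreover have "60 + j' + k' < nat n + j1 + k1" using j' k' n by linarith
    ultimately show ?thesis unfolding h_def by blast
  qed
qed

text \<open>In a triple of least total length some walk is longer than \<open>B\<close>; it is
  replaced by an induced path, and the walk from the third vertex meets its neighbourhood near one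
  end. Then \<open>hole_or_shorter_aux\<close> yields a hole, since a shorter triple contradicts
  minimality.\<close>

lemma has_AT_imp_hole:
  assumes g: "good B X" and B: "B \<ge> 400" and AT: "has_AT X"
  shows "\<exists>p m. hole X p m \<and> m > int B"
proof -
  have "\<exists>q m. hole X q m"
  proof (rule ccontr)
    assume nohole: "\<not> ?thesis"
    define T where "T N \<longleftrightarrow> (\<exists>a b c i j k. AT X a b c i j k \<and> N = i + j + k)" for N
    have "\<exists>N. T N" using AT unfolding T_def has_AT_def by blast
    define N where "N = (LEAST N. T N)"
    have "T N" unfolding N_def using \<open>\<exists>N. T N\<close> by (rule LeastI_ex)
    have minN: "\<not> i + j + k < N" if "AT X a b c i j k" for a b c i j k
      using that not_less_Least[of _ T] unfolding N_def T_def by blast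
    have "\<exists>a b c i j k. AT X a b c i j k \<and> N = i + j + k \<and> i > B"
    proof -
      obtain a b c i j k where A: "AT X a b c i j k" "N = i + j + k" using \<open>T N\<close> unfolding T_def by blast
      then consider "i > B" | "j > B" | "k > B" using goodD[OF g A(1)] by force
      then show ?thesis
      proof cases
        case 2
        moreover have "N = j + k + i" using A(2) by simp
        ultimately show ?thesis using AT_rot[OF A(1)] by blast
      next
        case 3
        moreover have "N = k + i + j" using A(2) by simp
        ultimately show ?thesis using AT_rot[OF AT_rot[OF A(1)]] by blast
      qed (use A in blast)
    qed
    then obtain a b c i j k where A: "AT X a b c i j k" and N: "N = i + j + k" and iB: "i > B" by blast
    note A' = A[unfolded AT_def]
    have "\<not> walk (X - nb c) i' a b" if "i' < i" for i'
      using minN[of a b c i' j k] that N A' unfolding AT_def by auto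
    then obtain p where p: "p 0 = a" "p (int i) = b" "\<And>l. 0 \<le> l \<Longrightarrow> l \<le> int i \<Longrightarrow> p l \<in> X - nb c" "induced_path p 0 (int i)"
      using geodesic[of "X - nb c" i a b] A' by metis
    have ev: "even i" using walk_parity[of "X - nb c" i a b] A' by blast
    define M where "M = {v. \<exists>k\<in>{0..int i}. adj v (p k)}"
    have cM: "c \<notin> M" using p(3) unfolding M_def by force
    have aM: "a \<in> M"
      using induced_pathD[OF p(4), of 0 1] p(1) iB B unfolding M_def by (intro CollectI bexI[of _ 1]) auto
    have "walk (X - nb b) k c a" using A' by blast
    from walk_first[OF this cM] aM walk_in[of "X - nb b - M" k c a] obtain i' v' w where
      t: "walk (X - nb b - M) i' c v'" "adj v' w" "w \<in> M" "w \<in> X" by blast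
    have t1: "walk (X - M) i' c v'" using walk_mono[OF t(1)] by blast
    have v'X: "v' \<in> X" "v' \<notin> M" using walk_in[OF t(1)] by auto
    obtain l where l: "0 \<le> l" "l \<le> int i" "adj w (p l)" using t(3) unfolding M_def by auto
    \<comment> \<open>If the first contact were away from both ends, edge locality would make its
      predecessor \<open>v'\<close> a contact too.\<close>
    have "l < 12 \<or> l > int i - 12"
    proof (rule ccontr)
      assume "\<not> ?thesis"
      then have "\<exists>j. \<bar>j - l\<bar> \<le> 6 \<and> adj v' (p j)"
        using B p(3) induced_path_sub[OF p(4)] t l v'X adj_sym
        by (intro edge_local[OF g, of p l w v']) auto
      then obtain j where j: "\<bar>j - l\<bar> \<le> 6" "adj v' (p j)" by blast
      then have "v' \<in> M" using \<open>\<not> (l < 12 \<or> _)\<close> unfolding M_def by (intro CollectI bexI[of _ j]) auto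
      then show False using v'X by blast
    qed
    then show False
    proof
      assume l12: "l > int i - 12"
      have "(\<exists>q m. hole X q m) \<or>
        (\<exists>i' j' k'. AT X (p (int i - 60)) (p (int i)) c i' j' k' \<and> i' + j' + k' < nat (int i) + j + k)"
        by (rule hole_or_shorter_aux[OF g _ p(4) _ _ _ _ _ _ _ _ M_def t1 t(2,4) l(3) l12 l(2)])
          (use B p iB ev A' walk_rev in auto)
      then show False using nohole minN N by auto
    next
      assume l12: "l < 12"
      \<comment> \<open>Reversing the path exchanges \<open>a\<close> and \<open>b\<close>, and with
        them the other two walks.\<close>
      define q where "q x = p (int i - x)" for x
      have ipq: "induced_path q 0 (int i)" using induced_path_flip[OF p(4), of "int i"] unfolding q_def by simp
      have M2: "M = {v. \<exists>k\<in>{0..int i}. adj v (q k)}"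
        unfolding M_def q_def
      proof (intro Collect_cong iffI)
        fix v assume "\<exists>k\<in>{0..int i}. adj v (p k)"
        then obtain k where "k \<in> {0..int i}" "adj v (p k)" by blast
        then show "\<exists>k\<in>{0..int i}. adj v (p (int i - k))" by (intro bexI[of _ "int i - k"]) auto
      next
        fix v assume "\<exists>k\<in>{0..int i}. adj v (p (int i - k))"
        then obtain k where "k \<in> {0..int i}" "adj v (p (int i - k))" by blast
        then show "\<exists>k\<in>{0..int i}. adj v (p k)" by (intro bexI[of _ "int i - k"]) auto
      qed
      have "(\<exists>q m. hole X q m) \<or>
        (\<exists>i' j' k'. AT X (q (int i - 60)) (q (int i)) c i' j' k' \<and> i' + j' + k' < nat (int i) + k + j)"
        by (rule hole_or_shorter_aux[OF g _ ipq _ _ _ _ _ _ _ _ M2 t1 t(2,4), where k = "int i - l"])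
          (use B p iB ev A' walk_rev l l12 in \<open>auto simp: q_def\<close>)
      then obtain i' j' k' where "AT X (q (int i - 60)) (q (int i)) c i' j' k'" "i' + j' + k' < nat (int i) + k + j"
        using nohole by blast
      with minN[OF this(1)] N show False by simp
    qed
  qed
  then obtain q m where "hole X q m" by blast
  then show ?thesis using hole_long[OF g] B by force
qed

end

section \<open>Orders and ranks with convex neighbourhoods\<close>

lemma minimal_subset:
  assumes "finite S" "P S"
  shows "\<exists>T\<subseteq>S. P T \<and> (\<forall>T'. T' \<subset> T \<longrightarrow> \<not> P T')"
  using assms
proof (induction S rule: finite_psubset_induct)
  case (psubset S)
  show ?case
  proof (cases "\<exists>T'. T' \<subset> S \<and> P T'")
    case True
    then obtain T' where T': "T' \<subset> S" "P T'" by blast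
    from psubset.IH[OF T'] show ?thesis using T'(1) by (meson psubset_imp_subset subset_trans)
  next
    case False
    then show ?thesis using psubset.prems by (intro exI[of _ S]) auto
  qed
qed

lemma consec_convex:
  assumes "consec r cs" "i \<le> j" "j \<le> k" "k < length cs" "cs ! i \<in> r" "cs ! k \<in> r"
  shows "cs ! j \<in> r"
proof -
  obtain xs ys zs where e: "cs = xs @ ys @ zs" "set ys \<subseteq> r" "set xs \<inter> r = {}" "set zs \<inter> r = {}"
    using assms(1) unfolding consec_def by blast
  have "\<not> i < length xs"
  proof
    assume "i < length xs"
    then have "cs ! i \<in> set xs" using e(1) by (simp add: nth_append)
    then show False using assms(5) e(3) by blast
  qed
  moreover have "k < length xs + length ys"
  proof (rule ccontr)
    assume "\<not> ?thesis"
    then have "cs ! k = zs ! (k - length xs - length ys)" "k - length xs - length ys < length zs"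
      using e(1) assms(4) by (auto simp: nth_append)
    then show False using assms(6) e(4) by (metis IntI empty_iff nth_mem)
  qed
  ultimately have "cs ! j = ys ! (j - length xs)" "j - length xs < length ys"
    using assms(2,3) e(1) by (auto simp: nth_append)
  then show ?thesis using e(2) by (metis nth_mem subsetD)
qed

context bipartite begin

text \<open>A row that misses the column \<open>c\<close> is a vertex not adjacent to
  \<open>c\<close>, so \<open>joined\<close> turns into walks avoiding \<open>nb c\<close>. Tucker's
  theorem is applied to one side at a time, with the neighbourhoods of the vertices of
  \<open>W\<close> as rows.\<close>

lemma no_AT_order:
  assumes fin: "finite W" and no: "\<not> has_AT W"
  shows "\<exists>cs. distinct cs \<and> set cs = {v \<in> W. side v = \<sigma>} \<and> (\<forall>u\<in>W. consec (nb u) cs)"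
proof -
  define C where "C = {v \<in> W. side v = \<sigma>}"
  have joined: "reach (W - nb c) x y" if "joined (nb ` W) C c x y" "c \<in> C" "x \<in> C" for c x y
    using that(1)
  proof (induction rule: rtranclp_induct)
    case base
    have "\<not> adj c x" using that adj_side unfolding C_def by auto
    then show ?case using that unfolding C_def by (intro reach_refl) auto
  next
    case (step y z)
    then obtain u where u: "u \<in> W" "adj u y" "adj u z" "\<not> adj u c" "y \<in> C" "z \<in> C"
      unfolding linked_def by auto
    have "\<not> adj c z" using u(6) that(2) adj_side unfolding C_def by auto
    then have "reach (W - nb c) z z" using u unfolding C_def by (intro reach_refl) auto
    moreover have "reach (W - nb c) u u" using u adj_sym by (intro reach_refl) auto
    ultimately show ?case using reach_adj[OF step.IH adj_sym[OF u(2)] reach_adj[OF _ u(3)]] by blast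
  qed
  have "at_free (nb ` W) C"
    unfolding at_free_def
  proof (intro ballI impI notI, elim conjE)
    fix a b c assume abc: "a \<in> C" "b \<in> C" "c \<in> C" "a \<noteq> b" "b \<noteq> c" "a \<noteq> c"
      and w: "joined (nb ` W) C c a b" "joined (nb ` W) C a b c" "joined (nb ` W) C b c a"
    from joined[OF w(1) abc(3,1)] joined[OF w(2) abc(1,2)] joined[OF w(3) abc(2,3)]
    obtain i j k where "walk (W - nb c) i a b" "walk (W - nb a) j b c" "walk (W - nb b) k c a"
      unfolding reach_def by blast
    then have "AT W a b c i j k" using abc by (intro ATI) (auto simp: C_def)
    then show False using no unfolding has_AT_def by blast
  qed
  moreover have "finite C" using fin unfolding C_def by simp
  ultimately show ?thesis using at_free_imp_order[of C "nb ` W"] unfolding C_def by auto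
qed

text \<open>A numerical form of two orders, one for each side, in which all neighbourhoods are
  intervals. Ranks on different sides are never compared.\<close>

definition ranked :: "'a set \<Rightarrow> ('a \<Rightarrow> nat) \<Rightarrow> bool" where
  "ranked W rk \<longleftrightarrow> (\<forall>u\<in>W. \<forall>v\<in>W. side u = side v \<longrightarrow> rk u = rk v \<longrightarrow> u = v) \<and>
    (\<forall>u\<in>W. \<forall>x\<in>W. \<forall>y\<in>W. \<forall>z\<in>W. adj u x \<longrightarrow> adj u z \<longrightarrow> side y = side x \<longrightarrow>
       rk x \<le> rk y \<longrightarrow> rk y \<le> rk z \<longrightarrow> adj u y)"

lemma rankedD:
  assumes "ranked W rk"
  shows "u \<in> W \<Longrightarrow> v \<in> W \<Longrightarrow> side u = side v \<Longrightarrow> rk u = rk v \<Longrightarrow> u = v"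
    "u \<in> W \<Longrightarrow> x \<in> W \<Longrightarrow> y \<in> W \<Longrightarrow> z \<in> W \<Longrightarrow> adj u x \<Longrightarrow> adj u z \<Longrightarrow> side y = side x \<Longrightarrow>
       rk x \<le> rk y \<Longrightarrow> rk y \<le> rk z \<Longrightarrow> adj u y"
  using assms unfolding ranked_def by blast+

lemma orders_ranked:
  assumes "\<And>\<sigma>. \<exists>cs. distinct cs \<and> set cs = {v \<in> W. side v = \<sigma>} \<and> (\<forall>u\<in>W. consec (nb u) cs)"
  shows "\<exists>rk. ranked W rk"
proof -
  define cs where "cs \<sigma> = (SOME cs. distinct cs \<and> set cs = {v \<in> W. side v = \<sigma>} \<and> (\<forall>u\<in>W. consec (nb u) cs))" for \<sigma>
  have cs: "set (cs \<sigma>) = {v \<in> W. side v = \<sigma>}" "u \<in> W \<Longrightarrow> consec (nb u) (cs \<sigma>)" for \<sigma> u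
    using someI_ex[OF assms[of \<sigma>]] unfolding cs_def[symmetric] by simp_all
  define rk where "rk v = (SOME i. i < length (cs (side v)) \<and> cs (side v) ! i = v)" for v
  have rk: "rk v < length (cs (side v)) \<and> cs (side v) ! rk v = v" if "v \<in> W" for v
  proof -
    have "v \<in> set (cs (side v))" using that cs(1) by simp
    then have "\<exists>i. i < length (cs (side v)) \<and> cs (side v) ! i = v" by (simp add: in_set_conv_nth)
    then show ?thesis unfolding rk_def by (rule someI_ex)
  qed
  have "ranked W rk"
    unfolding ranked_def
  proof (intro conjI ballI impI)
    fix u v assume uv: "u \<in> W" "v \<in> W" "side u = side v" "rk u = rk v"
    have "u = cs (side u) ! rk u" using rk[OF uv(1)] by simp
    also have "\<dots> = v" using rk[OF uv(2)] unfolding uv(3,4) by simp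
    finally show "u = v" .
  next
    fix u x y z assume a: "u \<in> W" "x \<in> W" "y \<in> W" "z \<in> W" "adj u x" "adj u z" "side y = side x"
       "rk x \<le> rk y" "rk y \<le> rk z"
    have "side z = side x" using a(5,6) adj_side by blast
    note rz = rk[OF a(4), unfolded this] and rx = rk[OF a(2)] and ry = rk[OF a(3), unfolded a(7)]
    have "cs (side x) ! rk y \<in> nb u"
      by (rule consec_convex[OF cs(2)[OF a(1)] a(8,9)]) (use rx rz a(5,6) in simp_all)
    then show "adj u y" using ry by simp
  qed
  then show ?thesis by blast
qed

text \<open>A walk that avoids \<open>nb b\<close> cannot jump over \<open>b\<close>: a vertex with
  neighbours below and above \<open>b\<close> is adjacent to \<open>b\<close> by convexity.\<close>

lemma rank_avoid:
  assumes r: "ranked W rk" and w: "walk (W - nb b) n a c" and b: "b \<in> W" and ab: "rk a < rk b" "side a = side b"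
    and bc: "side c = side b"
  shows "rk c < rk b"
proof -
  \<comment> \<open>The invariant for the other side only asks for one neighbour below
    \<open>b\<close>; convexity then keeps all neighbours there.\<close>
  define P where "P u \<longleftrightarrow> (if side u = side b then rk u < rk b else (\<exists>x\<in>W. adj u x \<and> rk x < rk b))" for u
  have "walk (W - nb b) n u v \<Longrightarrow> P u \<Longrightarrow> P v" for n u v
  proof (induction rule: walk.induct)
    case (walkS u w n v)
    have uw: "u \<in> W" "w \<in> W" "\<not> adj u b" using walkS(1) walk_in[OF walkS(3)] adj_sym by auto
    have "P w"
    proof (cases "side u = side b")
      case True
      then have "side w \<noteq> side b" using adj_side[OF walkS(2)] by auto
      then show ?thesis using True walkS(2,5) uw adj_sym unfolding P_def by auto
    next
      case False
      then obtain x where x: "x \<in> W" "adj u x" "rk x < rk b" using walkS(5) unfolding P_def by auto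
      have s: "side w = side b" "side x = side b" using adj_side[OF walkS(2)] adj_side[OF x(2)] False by auto
      have "\<not> rk b \<le> rk w" using rankedD(2)[OF r uw(1) x(1) b uw(2) x(2) walkS(2)] s uw(3) x(3) by auto
      then show ?thesis using s unfolding P_def by simp
    qed
    with walkS.IH show ?case by blast
  qed simp
  from this[OF w] show ?thesis using ab bc unfolding P_def by simp
qed

text \<open>Of three vertices on one side, the one with the middle rank separates the other
  two.\<close>

lemma ranked_no_AT:
  assumes r: "ranked W rk"
  shows "\<not> has_AT W"
proof
  assume "has_AT W"
  then obtain a b c i j k where A: "AT W a b c i j k" unfolding has_AT_def by blast
  have no: False if "AT W a b c i j k" "rk a < rk b" "rk b < rk c" for a b c i j k
  proof -
    have "walk (W - nb b) k a c" "b \<in> W" "side a = side b" "side c = side b" using that(1) walk_rev unfolding AT_def by auto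
    from rank_avoid[OF r this(1,2) that(2) this(3,4)] show False using that(3) by simp
  qed
  have ne: "rk a \<noteq> rk b" "rk b \<noteq> rk c" "rk c \<noteq> rk a"
    using A rankedD(1)[OF r] unfolding AT_def by metis+
  note A1 = AT_rot[OF A]
  note A2 = AT_rot[OF A1]
  consider "rk a < rk b \<and> rk b < rk c" | "rk b < rk c \<and> rk c < rk a" | "rk c < rk a \<and> rk a < rk b"
    | "rk b < rk a \<and> rk a < rk c" | "rk c < rk b \<and> rk b < rk a" | "rk a < rk c \<and> rk c < rk b"
    using ne by linarith
  then show False
    by cases (use no[OF A] no[OF A1] no[OF A2] no[OF AT_refl[OF A]] no[OF AT_refl[OF A1]] no[OF AT_refl[OF A2]] in blast)+
qed

definition between :: "('a \<Rightarrow> nat) \<Rightarrow> 'a \<Rightarrow> 'a \<Rightarrow> 'a \<Rightarrow> bool" where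
  "between rk a x b \<longleftrightarrow> rk a \<le> rk x \<and> rk x \<le> rk b \<or> rk b \<le> rk x \<and> rk x \<le> rk a"

lemma between_adj:
  assumes "ranked W rk" "u \<in> W" "a \<in> W" "b \<in> W" "x \<in> W" "adj u a" "adj u b" "side x = side a" "between rk a x b"
  shows "adj u x"
proof -
  have "side b = side a" using adj_side[OF assms(6)] adj_side[OF assms(7)] by auto
  with assms show ?thesis unfolding between_def using rankedD(2)[OF assms(1)] by metis
qed

text \<open>As \<open>A\<close> is connected and avoids the neighbours of \<open>B\<close>, and
  conversely, \<open>rank_avoid\<close> puts all of \<open>A\<close> on the same side of all of
  \<open>B\<close>. The vertices that face each other across the gap lie between every
  \<open>a\<close> and every \<open>b\<close>. By convexity, whatever is adjacent to some
  \<open>a\<close> and some \<open>b\<close> is then adjacent to both of them.\<close>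

lemma facing:
  assumes r: "ranked W rk" and fin: "finite W" and AW: "A \<subseteq> W" "B \<subseteq> W" and dis: "A \<inter> B = {}"
    and cA: "\<And>u v. u \<in> A \<Longrightarrow> v \<in> A \<Longrightarrow> reach A u v" and cB: "\<And>u v. u \<in> B \<Longrightarrow> v \<in> B \<Longrightarrow> reach B u v"
    and no: "\<And>u v. u \<in> A \<Longrightarrow> v \<in> B \<Longrightarrow> \<not> adj u v"
    and ne: "a0 \<in> A" "side a0 = \<sigma>" "b0 \<in> B" "side b0 = \<sigma>"
  shows "\<exists>x\<in>A. \<exists>x'\<in>B. side x = \<sigma> \<and> side x' = \<sigma> \<and>
    (\<forall>a\<in>A. \<forall>b\<in>B. side a = \<sigma> \<longrightarrow> side b = \<sigma> \<longrightarrow> between rk a x b \<and> between rk a x' b)"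
proof -
  define A' where "A' = {v \<in> A. side v = \<sigma>}"
  define B' where "B' = {v \<in> B. side v = \<sigma>}"
  have fn: "finite A'" "finite B'" "A' \<noteq> {}" "B' \<noteq> {}"
    using ne finite_subset[OF AW(1) fin] finite_subset[OF AW(2) fin] unfolding A'_def B'_def by auto
  have Aav: "reach (W - nb b) u v" if "u \<in> A" "v \<in> A" "b \<in> B" for u v b
  proof (rule reach_mono[OF cA[OF that(1,2)]])
    show "A \<subseteq> W - nb b"
    proof
      fix x assume "x \<in> A"
      with no[OF this that(3)] AW show "x \<in> W - nb b" using adj_sym[of b x] by auto
    qed
  qed
  have Bav: "reach (W - nb a) u v" if "u \<in> B" "v \<in> B" "a \<in> A" for u v a
  proof (rule reach_mono[OF cB[OF that(1,2)]])
    show "B \<subseteq> W - nb a" using AW no[OF that(3)] by auto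
  qed
  \<comment> \<open>The position relative to each other does not change when first \<open>a\<close>
    and then \<open>b\<close> is moved within its connected set.\<close>
  have lt: "rk a < rk b \<longleftrightarrow> rk a0 < rk b0" if "a \<in> A'" "b \<in> B'" for a b
  proof -
    have s: "side a = \<sigma>" "side b = \<sigma>" "a \<in> A" "b \<in> B" using that unfolding A'_def B'_def by auto
    have W: "a \<in> W" "b \<in> W" "a0 \<in> W" "b0 \<in> W" using s ne AW by auto
    have A1: "rk u < rk b' \<Longrightarrow> rk v < rk b'" if "u \<in> A" "v \<in> A" "side u = \<sigma>" "side v = \<sigma>" "b' \<in> B" "side b' = \<sigma>" for u v b'
      using Aav[OF that(1,2,5)] rank_avoid[OF r, of b' _ u v] that AW unfolding reach_def by auto
    have B1: "rk u < rk a' \<Longrightarrow> rk v < rk a'" if "u \<in> B" "v \<in> B" "side u = \<sigma>" "side v = \<sigma>" "a' \<in> A" "side a' = \<sigma>" for u v a'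
      using Bav[OF that(1,2,5)] rank_avoid[OF r, of a' _ u v] that AW unfolding reach_def by auto
    have n: "rk u \<noteq> rk v" if "u \<in> A" "v \<in> B" "side u = \<sigma>" "side v = \<sigma>" for u v
      using rankedD(1)[OF r, of u v] that dis AW by auto
    have "rk a < rk b \<longleftrightarrow> rk a0 < rk b" using A1[of a a0 b] A1[of a0 a b] s ne by blast
    also have "\<dots> \<longleftrightarrow> \<not> rk b < rk a0" using n[of a0 b] s ne by linarith
    also have "\<dots> \<longleftrightarrow> \<not> rk b0 < rk a0" using B1[of b b0 a0] B1[of b0 b a0] s ne by blast
    also have "\<dots> \<longleftrightarrow> rk a0 < rk b0" using n[of a0 b0] ne by linarith
    finally show ?thesis .
  qed
  show ?thesis
  proof (cases "rk a0 < rk b0")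
    case True
    have "Max (rk ` A') \<in> rk ` A'" using fn by (intro Max_in) auto
    then obtain x where x: "x \<in> A'" "rk x = Max (rk ` A')" by auto
    have "Min (rk ` B') \<in> rk ` B'" using fn by (intro Min_in) auto
    then obtain y where y: "y \<in> B'" "rk y = Min (rk ` B')" by auto
    have 1: "rk a \<le> rk x" if "a \<in> A'" for a using that x fn by auto
    have 2: "rk y \<le> rk b" if "b \<in> B'" for b using that y fn by auto
    show ?thesis
    proof (rule bexI[of _ x], rule bexI[of _ y], intro conjI ballI impI)
      fix a b assume "a \<in> A" "b \<in> B" "side a = \<sigma>" "side b = \<sigma>"
      then have ab: "a \<in> A'" "b \<in> B'" unfolding A'_def B'_def by auto
      show "between rk a x b" using 1[OF ab(1)] lt[OF x(1) ab(2)] True unfolding between_def by auto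
      show "between rk a y b" using 2[OF ab(2)] lt[OF ab(1) y(1)] True unfolding between_def by auto
    qed (use x y in \<open>auto simp: A'_def B'_def\<close>)
  next
    case False
    have "Min (rk ` A') \<in> rk ` A'" using fn by (intro Min_in) auto
    then obtain x where x: "x \<in> A'" "rk x = Min (rk ` A')" by auto
    have "Max (rk ` B') \<in> rk ` B'" using fn by (intro Max_in) auto
    then obtain y where y: "y \<in> B'" "rk y = Max (rk ` B')" by auto
    have 1: "rk x \<le> rk a" if "a \<in> A'" for a using that x fn by auto
    have 2: "rk b \<le> rk y" if "b \<in> B'" for b using that y fn by auto
    show ?thesis
    proof (rule bexI[of _ x], rule bexI[of _ y], intro conjI ballI impI)
      fix a b assume "a \<in> A" "b \<in> B" "side a = \<sigma>" "side b = \<sigma>"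
      then have ab: "a \<in> A'" "b \<in> B'" unfolding A'_def B'_def by auto
      show "between rk a x b" using 1[OF ab(1)] lt[OF x(1) ab(2)] False unfolding between_def by auto
      show "between rk a y b" using 2[OF ab(2)] lt[OF ab(1) y(1)] False unfolding between_def by auto
    qed (use x y in \<open>auto simp: A'_def B'_def\<close>)
  qed
qed

section \<open>Domination by holes and the small cut\<close>

lemma hole_near:
  assumes g: "good B X" and B: "B \<ge> 40" and h: "hole X p m" and w: "walk X n v w" and v: "adj v (p i)"
  shows "\<exists>j. \<bar>j - i\<bar> \<le> 6 * int n \<and> adj w (p j)"
  using w v
proof (induction arbitrary: i rule: walk.induct)
  case (walk0 u)
  then show ?case by (intro exI[of _ i]) simp
next
  case (walkS u w n v)
  have m: "m > int B" using hole_long[OF g _ h] B by simp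
  \<comment> \<open>Edge locality: one step of the walk moves the contact with the hole by at most
    6.\<close>
  have "\<exists>j. \<bar>j - i\<bar> \<le> 6 \<and> adj w (p j)"
    using walkS walk_in[OF walkS(3)] m B hole_in[OF h]
    by (intro edge_local[OF g B hole_induced_path[OF h], of i u]) auto
  then obtain j where j: "\<bar>j - i\<bar> \<le> 6" "adj w (p j)" by blast
  from walkS.IH[OF j(2)] obtain k where "\<bar>k - j\<bar> \<le> 6 * int n" "adj v (p k)" by blast
  with j show ?case by (intro exI[of _ k]) auto
qed

lemma hole_dominates:
  assumes "good B K" "B \<ge> 40" "hole K p m" "\<And>u v. u \<in> K \<Longrightarrow> v \<in> K \<Longrightarrow> reach K u v" "v \<in> K"
  shows "\<exists>i. adj v (p i)"
proof -
  have "adj (p 0) (p 1)" using hole_adj[OF assms(3), of 0] by simp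
  moreover obtain n where "walk K n (p 0) v" using assms(4)[OF hole_in[OF assms(3)] assms(5), of 0] unfolding reach_def by blast
  ultimately show ?thesis using hole_near[OF assms(1,2,3)] by blast
qed

text \<open>Four vertices, one facing pair for each side, name a cut of unbounded size. This makes
  the candidates enumerable.\<close>

definition shared :: "'a set \<Rightarrow> 'a \<Rightarrow> 'a \<Rightarrow> 'a \<Rightarrow> 'a \<Rightarrow> 'a set" where
  "shared K x x' y y' = {z \<in> K. adj z x \<and> adj z x' \<or> adj z y \<and> adj z y'}"

lemma hole_reach:
  assumes "hole X p m" "i \<le> j" "\<And>k. i \<le> k \<Longrightarrow> k \<le> j \<Longrightarrow> p k \<in> Y"
  shows "reach Y (p i) (p j)"
  using reachI[OF hole_walk[OF assms]] .

text \<open>For a minimal separator \<open>T\<close>: if putting \<open>s\<close> back reconnects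
  \<open>u\<close> and \<open>v\<close>, the connection passes \<open>s\<close>, and its part before
  \<open>s\<close> avoids \<open>T\<close>.\<close>

lemma walk_first_reach:
  assumes w: "walk (W - (T - {s})) n u v" and u: "u \<noteq> s" and no: "\<not> reach (W - T) u v"
  shows "\<exists>v'. reach (W - T) u v' \<and> adj s v'"
proof -
  have u': "u \<notin> {s}" using u by simp
  have sub: "W - (T - {s}) - {s} \<subseteq> W - T" by blast
  from walk_first[OF w u'] show ?thesis
  proof (elim disjE exE conjE)
    assume "walk (W - (T - {s}) - {s}) n u v"
    then show ?thesis using no reach_mono[OF reachI sub] by blast
  next
    fix i v' w assume "walk (W - (T - {s}) - {s}) i u v'" "adj v' w" "w \<in> {s}"
    then show ?thesis using reach_mono[OF reachI sub] adj_sym by blast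
  qed
qed

text \<open>
  The element \<open>p 0\<close> of a minimal solution lies on a hole \<open>p\<close>. Away from \<open>p 100\<close> the graph has the consecutive
  ones property, and there a minimal separator of \<open>p (-1)\<close> and \<open>p 1\<close> is the cut: a hole avoiding
  it would have to pass the neighbourhood of \<open>p 100\<close> on both arcs between neighbours of \<open>p (-1)\<close> and \<open>p 1\<close>.
\<close>
lemma small_cut:
  assumes fin: "finite K" and g: "good B K" and B: "B \<ge> 1000"
    and conn: "\<And>u v. u \<in> K \<Longrightarrow> v \<in> K \<Longrightarrow> reach K u v"
    and AT: "has_AT K" and SK: "S \<subseteq> K" and sol: "\<not> has_AT (K - S)"
  shows "\<exists>x\<in>K. \<exists>x'\<in>K. \<exists>y\<in>K. \<exists>y'\<in>K. shared K x x' y y' \<subseteq> S \<and> \<not> has_AT (K - shared K x x' y y')"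
proof -
  have B4: "B \<ge> 40" "B \<ge> 400" using B by auto
  \<comment> \<open>Minimality gives, for a chosen \<open>s0\<close>, a hole that meets
    \<open>S0\<close> in \<open>s0\<close> only.\<close>
  obtain S0 where S0: "S0 \<subseteq> S" "\<not> has_AT (K - S0)" and minS0: "\<And>T. T \<subset> S0 \<Longrightarrow> has_AT (K - T)"
  proof -
    obtain T where T: "T \<subseteq> S" "\<not> has_AT (K - T)" "\<forall>T'. T' \<subset> T \<longrightarrow> \<not> \<not> has_AT (K - T')"
      using minimal_subset[of S "\<lambda>T. \<not> has_AT (K - T)"] finite_subset[OF SK fin] sol by meson
    show thesis using that[OF T(1,2)] T(3) by blast
  qed
  have "S0 \<noteq> {}" using AT S0 by auto
  then obtain s0 where s0: "s0 \<in> S0" by blast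
  have s0K: "s0 \<in> K" using s0 S0 SK by blast
  have "has_AT (K - (S0 - {s0}))" using minS0 s0 by blast
  then obtain p0 m where p0: "hole (K - (S0 - {s0})) p0 m"
    using has_AT_imp_hole[OF good_mono[OF g] B4(2)] by blast
  have "\<exists>k. p0 k = s0"
  proof (rule ccontr)
    assume "\<not> ?thesis"
    then have "hole (K - S0) p0 m" using p0 unfolding hole_def by auto
    then show False using hole_has_AT S0 by blast
  qed
  then obtain k where k: "p0 k = s0" by blast
  define p where "p i = p0 (k + i)" for i
  have p: "hole (K - (S0 - {s0})) p m" using hole_shift[OF p0] unfolding p_def .
  have pK: "hole K p m" using hole_mono[OF p] by blast
  have pin: "p i \<in> K" for i using hole_in[OF pK] .
  have ps0: "p 0 = s0" using k unfolding p_def by simp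
  have m: "m > 1000" using hole_long[OF g _ pK] B by simp
  have padj: "adj (p i) (p j) \<longleftrightarrow> \<bar>i - j\<bar> = 1" if "\<bar>i - j\<bar> \<le> m - 2" for i j
    using that by (intro induced_pathD[OF hole_induced_path[OF pK, of "max i j" "min i j"]]) auto
  have ndvd: "\<not> m dvd x" if "0 < x \<and> x < m \<or> - m < x \<and> x < 0" for x
    using dvd_small[of m x] that by auto
  have pS0: "p i \<notin> S0" if "0 < i \<and> i < m \<or> - m < i \<and> i < 0" for i
  proof
    assume "p i \<in> S0"
    then have "p i = p 0" using hole_in[OF p, of i] ps0 by auto
    then show False using hole_inj[OF pK, of i 0] ndvd[of i] that by auto
  qed
  \<comment> \<open>Ten steps move the contact \<open>p 1\<close> by at most 60, which is too little
    to reach a neighbour of \<open>p 100\<close>. The longest walk considered below has length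
    10.\<close>
  have far: False if w: "walk K n (p 0) (p 100)" "n \<le> 10" for n
  proof -
    have "adj (p 0) (p 1)" using hole_adj[OF pK, of 0] by simp
    then obtain j where j: "\<bar>j - 1\<bar> \<le> 6 * int n" "adj (p 100) (p j)"
      using hole_near[OF g B4(1) pK w(1)] by blast
    then have "\<bar>j\<bar> \<le> 61" using w(2) by linarith
    then show False using j(2) padj[of 100 j] m by auto
  qed
  define W where "W = K - nb (p 100)"
  have WK: "W \<subseteq> K" unfolding W_def by blast
  have finW: "finite W" using finite_subset[OF WK fin] .
  have pW: "p i \<in> W" if "\<bar>i\<bar> \<le> 30" for i
    using that pin padj[of 100 i] m unfolding W_def by auto
  \<comment> \<open>A hole in \<open>W\<close> would dominate all of \<open>K\<close>, hence also
    \<open>p 100\<close>, but \<open>W\<close> omits the neighbours of \<open>p 100\<close>.\<close>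
  have noW: "\<not> has_AT W"
  proof
    assume "has_AT W"
    then obtain q m' where q: "hole W q m'" using has_AT_imp_hole[OF good_mono[OF g WK] B4(2)] by blast
    obtain i where "adj (p 100) (q i)"
      using hole_dominates[OF g B4(1) hole_mono[OF q WK] conn pin] by blast
    then show False using hole_in[OF q, of i] unfolding W_def by simp
  qed
  \<comment> \<open>A walk from \<open>p (-1)\<close> to \<open>p 1\<close> in \<open>W - S0\<close>
    would replace \<open>p 0\<close> and avoid the neighbours of \<open>p 100\<close>. Then
    \<open>p 100\<close>, \<open>p 104\<close>, \<open>p 96\<close> would be asteroidal in
    \<open>K - S0\<close>.\<close>
  have sepS0: "\<not> reach (W - S0) (p (-1)) (p 1)"
  proof
    assume r: "reach (W - S0) (p (-1)) (p 1)"
    have avoid: "p i \<in> K - S0 - nb (p j)" if "0 < i" "i < m" "2 \<le> \<bar>i - j\<bar>" "\<bar>i - j\<bar> \<le> m - 2" for i j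
      using that pin pS0[of i] padj[of j i] by auto
    have 1: "reach (K - S0 - nb (p 96)) (p 100) (p 104)"
      using m by (intro hole_reach[OF pK] avoid) auto
    have 2: "reach (K - S0 - nb (p 104)) (p 96) (p 100)"
      using m by (intro hole_reach[OF pK] avoid) auto
    have 3: "reach (K - S0 - nb (p 100)) (p 104) (p 96)"
    proof -
      have a: "reach (K - S0 - nb (p 100)) (p 104) (p (m - 1))"
        using m by (intro hole_reach[OF pK] avoid) auto
      have b: "reach (K - S0 - nb (p 100)) (p 1) (p 96)"
        using m by (intro hole_reach[OF pK] avoid) auto
      have "p (-1 + m) = p (-1)" using pK unfolding hole_def by blast
      then have c: "p (m - 1) = p (-1)" by simp
      have "reach (K - S0 - nb (p 100)) (p (-1)) (p 1)"
        using r by (rule reach_mono) (auto simp: W_def)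
      from reach_trans[OF a[unfolded c] reach_trans[OF this b]] show ?thesis .
    qed
    obtain i j l where w: "walk (K - S0 - nb (p 96)) i (p 100) (p 104)" "walk (K - S0 - nb (p 100)) j (p 104) (p 96)"
      "walk (K - S0 - nb (p 104)) l (p 96) (p 100)" using 1 2 3 unfolding reach_def by blast
    have ip: "induced_path p 96 104" using hole_induced_path[OF pK] m by simp
    have "AT (K - S0) (p 100) (p 104) (p 96) i j l"
    proof (rule ATI)
      show "p 100 \<noteq> p 104" "p 104 \<noteq> p 96" "p 96 \<noteq> p 100"
        using hole_inj[OF pK, of 100 104] hole_inj[OF pK, of 104 96] hole_inj[OF pK, of 96 100]
          ndvd[of 8] ndvd[of "-4"] m by auto
      show "side (p 100) = side (p 104)" "side (p 104) = side (p 96)" using induced_path_side[OF ip] by auto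
    qed (use w in auto)
    then show False using S0(2) unfolding has_AT_def by blast
  qed
  obtain T where T: "T \<subseteq> S0 \<inter> W" "\<not> reach (W - T) (p (-1)) (p 1)"
    and minT: "\<And>T'. T' \<subset> T \<Longrightarrow> reach (W - T') (p (-1)) (p 1)"
  proof -
    have "finite (S0 \<inter> W)" "W - S0 \<inter> W = W - S0" using finW by auto
    then obtain T where T: "T \<subseteq> S0 \<inter> W" "\<not> reach (W - T) (p (-1)) (p 1)"
      "\<forall>T'. T' \<subset> T \<longrightarrow> \<not> \<not> reach (W - T') (p (-1)) (p 1)"
      using minimal_subset[of "S0 \<inter> W" "\<lambda>T. \<not> reach (W - T) (p (-1)) (p 1)"] sepS0 by metis
    show thesis using that[OF T(1,2)] T(3) by blast
  qed
  define A where "A = {v. reach (W - T) (p (-1)) v}"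
  define A' where "A' = {v. reach (W - T) (p 1) v}"
  have pWT: "p i \<in> W - T" if "0 < \<bar>i\<bar>" "\<bar>i\<bar> \<le> 30" for i
  proof -
    have "0 < i \<and> i < m \<or> - m < i \<and> i < 0" using that m by linarith
    then show ?thesis using pW[of i] pS0[of i] that T(1) by blast
  qed
  have AW: "A \<subseteq> W - T" "A' \<subseteq> W - T" unfolding A_def A'_def using reach_in by blast+
  have Astep: "v \<in> A" if "u \<in> A" "adj u v" "v \<in> W - T" for u v
    using that reach_adj[OF _ that(2) reach_refl[OF that(3)]] unfolding A_def by blast
  have A'step: "v \<in> A'" if "u \<in> A'" "adj u v" "v \<in> W - T" for u v
    using that reach_adj[OF _ that(2) reach_refl[OF that(3)]] unfolding A'_def by blast
  have disj: "A \<inter> A' = {}" using T(2) reach_trans reach_sym unfolding A_def A'_def by blast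
  have noedge: "\<not> adj u v" if "u \<in> A" "v \<in> A'" for u v
    using Astep[OF that(1), of v] that(2) AW disj by blast
  have pA: "p (-1) \<in> A" "p (-2) \<in> A"
  proof -
    show 1: "p (-1) \<in> A" unfolding A_def using reach_refl[OF pWT[of "-1"]] by simp
    show "p (-2) \<in> A" using Astep[OF 1 _ pWT[of "-2"]] adj_sym[OF hole_adj[OF pK, of "-2"]] by simp
  qed
  have pA': "p 1 \<in> A'" "p 2 \<in> A'"
  proof -
    show 1: "p 1 \<in> A'" unfolding A'_def using reach_refl[OF pWT[of 1]] by simp
    show "p 2 \<in> A'" using A'step[OF 1 _ pWT[of 2]] hole_adj[OF pK, of 1] by simp
  qed
  have cA: "reach A u v" if "u \<in> A" "v \<in> A" for u v
  proof -
    have "reach (W - T) u v" using that reach_trans reach_sym unfolding A_def by blast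
    then obtain n where "walk (W - T) n u v" unfolding reach_def by blast
    then have "walk ((W - T) \<inter> A) n u v" using walk_closed[of "W - T" n u v A] that Astep by blast
    then show ?thesis using reachI walk_mono by (metis inf_le2)
  qed
  have cA': "reach A' u v" if "u \<in> A'" "v \<in> A'" for u v
  proof -
    have "reach (W - T) u v" using that reach_trans reach_sym unfolding A'_def by blast
    then obtain n where "walk (W - T) n u v" unfolding reach_def by blast
    then have "walk ((W - T) \<inter> A') n u v" using walk_closed[of "W - T" n u v A'] that A'step by blast
    then show ?thesis using reachI walk_mono by (metis inf_le2)
  qed
  have "\<exists>rk. ranked W rk" using orders_ranked no_AT_order[OF finW noW] by blast
  then obtain rk where rk: "ranked W rk" by blast
  have ip: "induced_path p (-5) 5" using hole_induced_path[OF pK] m by simp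
  have AWW: "A \<subseteq> W" "A' \<subseteq> W" using AW by auto
  \<comment> \<open>Both components contain vertices of either side, namely two consecutive vertices
    of the hole.\<close>
  have F: "\<exists>x\<in>A. \<exists>x'\<in>A'. side x = \<sigma> \<and> side x' = \<sigma> \<and>
    (\<forall>a\<in>A. \<forall>b\<in>A'. side a = \<sigma> \<longrightarrow> side b = \<sigma> \<longrightarrow> between rk a x b \<and> between rk a x' b)" for \<sigma>
  proof (cases "side (p 1) = \<sigma>")
    case True
    then have "side (p (-1)) = \<sigma>" using induced_path_side[OF ip, of "-1" 1] by simp
    with True show ?thesis
      using facing[OF rk finW AWW disj cA cA' noedge pA(1) _ pA'(1)] by blast
  next
    case False
    then have "side (p 2) = \<sigma>" using induced_path_side[OF ip, of 1 2] by auto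
    moreover then have "side (p (-2)) = \<sigma>" using induced_path_side[OF ip, of "-2" 2] by simp
    ultimately show ?thesis
      using facing[OF rk finW AWW disj cA cA' noedge pA(2) _ pA'(2)] by blast
  qed
  obtain x x' where x: "x \<in> A" "x' \<in> A'" "side x = True" "side x' = True"
    "\<And>a b. a \<in> A \<Longrightarrow> b \<in> A' \<Longrightarrow> side a = True \<Longrightarrow> side b = True \<Longrightarrow> between rk a x b \<and> between rk a x' b"
    using F[of True] by blast
  obtain y y' where y: "y \<in> A" "y' \<in> A'" "side y = False" "side y' = False"
    "\<And>a b. a \<in> A \<Longrightarrow> b \<in> A' \<Longrightarrow> side a = False \<Longrightarrow> side b = False \<Longrightarrow> between rk a y b \<and> between rk a y' b"
    using F[of False] by blast
  define Q where "Q = shared K x x' y y'"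
  \<comment> \<open>By minimality of \<open>T\<close>, each of its vertices has a neighbour in both
    components, hence is adjacent to a facing pair.\<close>
  have TQ: "T \<subseteq> Q"
  proof
    fix s assume s: "s \<in> T"
    have sW: "s \<in> W" using s T by blast
    have r: "reach (W - (T - {s})) (p (-1)) (p 1)" using minT[of "T - {s}"] s by blast
    have ne: "p (-1) \<noteq> s" "p 1 \<noteq> s" using pWT[of 1] pWT[of "-1"] s by auto
    obtain a where a: "a \<in> A" "adj s a"
      using walk_first_reach[of W T s _ "p (-1)" "p 1"] r ne T(2) unfolding A_def reach_def by blast
    have nr: "\<not> reach (W - T) (p 1) (p (-1))" using T(2) reach_sym by blast
    obtain b where b: "b \<in> A'" "adj s b"
      using walk_first_reach[of W T s _ "p 1" "p (-1)"] reach_sym[OF r] ne nr unfolding A'_def reach_def by blast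
    have sab: "side a = side b" using adj_side[OF a(2)] adj_side[OF b(2)] by auto
    show "s \<in> Q"
    proof (cases "side a")
      case True
      have "adj s x" "adj s x'"
        using between_adj[OF rk sW, of a b x] between_adj[OF rk sW, of a b x'] x(5)[OF a(1) b(1)] True sab a b x AWW by auto
      then show ?thesis using sW WK unfolding Q_def shared_def by blast
    next
      case False
      have "adj s y" "adj s y'"
        using between_adj[OF rk sW, of a b y] between_adj[OF rk sW, of a b y'] y(5)[OF a(1) b(1)] False sab a b y AWW by auto
      then show ?thesis using sW WK unfolding Q_def shared_def by blast
    qed
  qed
  have e: "adj (p 0) (p (-1))" "adj (p 0) (p 1)" "adj (p 1) (p 0)" "adj (p (-1)) (p 0)"
    "adj (p 1) (p 2)" "adj (p (-1)) (p (-2))"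
    using m by (simp_all add: padj)
  \<comment> \<open>A vertex between the two components in rank lies between \<open>p (-1)\<close>
    and \<open>p 1\<close>, which are adjacent to \<open>p 0\<close>, or, on the other side, between
    \<open>p (-2)\<close> and \<open>p 2\<close>; in the latter case it is adjacent to
    \<open>p (-1)\<close> or \<open>p 1\<close>.\<close>
  have near: "\<exists>n\<le>2. walk K n (p 0) z" if zW: "z \<in> W"
    and z: "\<And>a b. a \<in> A \<Longrightarrow> b \<in> A' \<Longrightarrow> side a = side z \<Longrightarrow> side b = side z \<Longrightarrow> between rk a z b" for z
  proof (cases "side z = side (p 1)")
    case True
    have s: "side (p (-1)) = side z" using induced_path_side[OF ip, of "-1" 1] True by simp
    have "between rk (p (-1)) z (p 1)" by (rule z[OF pA(1) pA'(1) s True[symmetric]])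
    then have "adj (p 0) z"
      by (intro between_adj[OF rk pW[of 0] pW[of "-1"] pW[of 1] zW e(1,2) s[symmetric]]) simp_all
    then have "walk K 1 (p 0) z" using zW WK pin by (intro walk_1) auto
    then show ?thesis by (intro exI[of _ 1]) simp
  next
    case False
    have "side (p (-2)) = side (p 2)" "side (p 0) = side (p 2)" "side (p 1) \<noteq> side (p 2)"
      using induced_path_side[OF ip, of "-2" 2] induced_path_side[OF ip, of 0 2] induced_path_side[OF ip, of 1 2] by simp_all
    then have s: "side (p (-2)) = side z" "side (p 2) = side z" "side (p 0) = side z" using False by auto
    have "between rk (p (-2)) z (p 2)" by (rule z[OF pA(2) pA'(2) s(1,2)])
    then have "between rk (p (-2)) z (p 0) \<or> between rk (p 0) z (p 2)" unfolding between_def by linarith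
    then have "adj (p (-1)) z \<or> adj (p 1) z"
    proof
      assume "between rk (p (-2)) z (p 0)"
      then show ?thesis
        by (intro disjI1 between_adj[OF rk pW[of "-1"] pW[of "-2"] pW[of 0] zW e(6,4) s(1)[symmetric]]) simp_all
    next
      assume "between rk (p 0) z (p 2)"
      then show ?thesis
        by (intro disjI2 between_adj[OF rk pW[of 1] pW[of 0] pW[of 2] zW e(3,5) s(3)[symmetric]]) simp_all
    qed
    then obtain i where i: "adj (p i) z" "adj (p 0) (p i)" using e(1,2) by blast
    have "z \<in> K" using zW WK by blast
    then have "walk K (Suc 1) (p 0) z" using walk_snoc[OF walk_1[OF pin pin i(2)] i(1)] by blast
    then show ?thesis by (intro exI[of _ 2]) (simp add: numeral_2_eq_2)
  qed
  have QT: "Q \<subseteq> T"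
  proof
    fix z assume z: "z \<in> Q"
    have "\<exists>n\<le>2. walk K n (p 0) x" by (rule near) (use x AWW in auto)
    moreover have "\<exists>n\<le>2. walk K n (p 0) y" by (rule near) (use y AWW in auto)
    ultimately obtain u u' where u: "u \<in> A" "u' \<in> A'" "adj z u" "adj z u'" "z \<in> K"
      and nu: "\<exists>n\<le>2. walk K n (p 0) u"
      using z x(1,2) y(1,2) unfolding Q_def shared_def by blast
    \<comment> \<open>A shared neighbour outside \<open>W\<close> would connect \<open>p 0\<close>
      to \<open>p 100\<close> in four steps.\<close>
    have "z \<in> W"
    proof (rule ccontr)
      assume "z \<notin> W"
      then have a: "adj z (p 100)" using u adj_sym unfolding W_def by auto
      obtain n where n: "n \<le> 2" "walk K n (p 0) u" using nu by blast
      have "walk K (Suc (Suc n)) (p 0) (p 100)"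
        using walk_snoc[OF walk_snoc[OF n(2) adj_sym[OF u(3)] u(5)] a pin] .
      then show False using far n by fastforce
    qed
    show "z \<in> T"
    proof (rule ccontr)
      assume "z \<notin> T"
      then have "z \<in> A" using Astep[OF u(1) adj_sym[OF u(3)]] \<open>z \<in> W\<close> by blast
      then show False using noedge u by blast
    qed
  qed
  have QTeq: "Q = T" using QT TQ by blast
  have "\<not> has_AT (K - Q)"
  proof
    assume "has_AT (K - Q)"
    then obtain q0 m' where q0: "hole (K - Q) q0 m'" using has_AT_imp_hole[OF good_mono[OF g] B4(2)] by blast
    have q0K: "hole K q0 m'" using hole_mono[OF q0] by blast
    obtain i0 where i0: "adj (p 1) (q0 i0)" using hole_dominates[OF g B4(1) q0K conn pin] by blast
    define q where "q i = q0 (i0 + i)" for i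
    have q: "hole (K - Q) q m'" using hole_shift[OF q0] unfolding q_def .
    have qK: "hole K q m'" using hole_mono[OF q] by blast
    have q0: "adj (p 1) (q 0)" using i0 unfolding q_def by simp
    have m': "m' > 1000" using hole_long[OF g _ qK] B by simp
    have per: "q (i + m' * t) = q i" for i t
    proof -
      have "q (i + m' * int k) = q i" for i k
      proof (induction k)
        case (Suc k)
        have "q (i + m' * int k + m') = q (i + m' * int k)" using q unfolding hole_def by blast
        then show ?case using Suc by (simp add: algebra_simps)
      qed simp
      from this[of i "nat t"] this[of "i + m' * t" "nat (- t)"] show ?thesis
        by (cases "t \<ge> 0") (auto simp: algebra_simps)
    qed
    obtain j0 where j0: "adj (p (-1)) (q j0)" using hole_dominates[OF g B4(1) qK conn pin] by blast
    define j where "j = j0 mod m'"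
    have j: "0 \<le> j" "j < m'" "adj (p (-1)) (q j)"
      using j0 per[of j "j0 div m'"] m' unfolding j_def by auto
    \<comment> \<open>An arc between neighbours of \<open>p 1\<close> and \<open>p (-1)\<close> that
      avoids \<open>nb (p 100)\<close> would lie in \<open>W - T\<close> and connect the two
      components.\<close>
    have arc: False if h: "\<And>k. a \<le> k \<Longrightarrow> k \<le> b \<Longrightarrow> \<not> adj (p 100) (q k)" "a \<le> b"
      "adj (p u) (q a)" "adj (p v) (q b)" "u = 1 \<and> v = -1 \<or> u = -1 \<and> v = 1" for a b u v
    proof -
      have "q k \<in> W - T" if "a \<le> k" "k \<le> b" for k
        using hole_in[OF q, of k] h(1)[OF that] QTeq unfolding W_def by simp
      then have r: "reach (W - T) (q a) (q b)" by (rule hole_reach[OF q h(2)])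
      have pv: "p u \<in> W - T" "p v \<in> W - T" using h(5) pWT[of 1] pWT[of "-1"] by auto
      have uv: "reach (W - T) (p u) (p v)"
        using reach_adj[OF reach_adj[OF reach_refl[OF pv(1)] h(3) r] adj_sym[OF h(4)] reach_refl[OF pv(2)]] .
      from h(5) show False
      proof
        assume "u = 1 \<and> v = -1"
        with uv reach_sym[OF uv] T(2) show False by simp
      next
        assume "u = -1 \<and> v = 1"
        with uv T(2) show False by simp
      qed
    qed
    obtain e1 where e1: "0 \<le> e1" "e1 \<le> j" "adj (p 100) (q e1)"
      using arc[of 0 j 1 "-1"] q0 j by blast
    have qm: "q m' = q 0" using per[of 0 1] by simp
    obtain e2 where e2: "j \<le> e2" "e2 \<le> m'" "adj (p 100) (q e2)"
      using arc[of j m' "-1" 1] q0 j qm by auto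
    \<comment> \<open>Both arcs meet \<open>nb (p 100)\<close>, and neighbours of
      \<open>p 100\<close> on the hole \<open>q\<close> are at cyclic distance at most 7. So
      \<open>q e1\<close> is within 7 of \<open>q 0\<close> or of \<open>q j\<close>, and with three
      more edges \<open>p 100\<close> is within 10 of \<open>p 0\<close>.\<close>
    obtain d where d: "\<bar>d - e1\<bar> \<le> 6 * int 1" "adj (q e2) (q d)"
      using hole_near[OF g B4(1) qK walk_1[OF pin _ e2(3)] e1(3)] hole_in[OF qK] by blast
    have dv: "m' dvd (e2 - d - 1) \<or> m' dvd (e2 - d + 1)" using d(2) qK unfolding hole_def by blast
    have "e2 - d - 1 \<in> {0, m', - m'} \<or> e2 - d + 1 \<in> {0, m', - m'}"
    proof -
      have h: "x \<in> {0, m', - m'}" if x: "m' dvd x" "\<bar>x\<bar> < 2 * m'" for x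
      proof -
        obtain t where t: "x = m' * t" using x(1) by (auto elim: dvdE)
        have "\<bar>m' * t\<bar> < 2 * m'" using x t by simp
        then have "m' * \<bar>t\<bar> < m' * 2" using m' by (simp add: abs_mult)
        then have "\<bar>t\<bar> < 2" using m' by (simp add: mult_less_cancel_left_pos)
        then have "t = 0 \<or> t = 1 \<or> t = -1" by linarith
        then show ?thesis using t by auto
      qed
      have "\<bar>e2 - d - 1\<bar> < 2 * m'" "\<bar>e2 - d + 1\<bar> < 2 * m'" using d e1 e2 j m' by auto
      then show ?thesis using h[of "e2 - d - 1"] h[of "e2 - d + 1"] dv by blast
    qed
    then have "e2 - e1 \<le> 7 \<or> e2 - e1 \<ge> m' - 7" using d(1) e1 e2 m' by auto
    then have "(j - e1 \<le> 7) \<or> (e1 \<le> 7)" using e1 e2 by linarith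
    then show False
    proof
      assume a: "j - e1 \<le> 7"
      have w: "walk K (nat (j - e1)) (q e1) (q j)" using hole_walk[OF qK e1(2)] hole_in[OF qK] by blast
      have "walk K (Suc (nat (j - e1))) (p 100) (q j)" using walkS[OF pin e1(3) w] .
      then have "walk K (Suc (Suc (nat (j - e1)))) (p 100) (p (-1))"
        using walk_snoc adj_sym[OF j(3)] pin by blast
      then have "walk K (Suc (Suc (Suc (nat (j - e1))))) (p 100) (p 0)"
        using walk_snoc hole_adj[OF pK, of "-1"] pin by auto
      from far[OF walk_rev[OF this]] show False using a by linarith
    next
      assume a: "e1 \<le> 7"
      have w: "walk K (nat (e1 - 0)) (q 0) (q e1)" using hole_walk[OF qK e1(1)] hole_in[OF qK] by blast
      have "walk K (Suc (nat (e1 - 0))) (p 1) (q e1)" using walkS[OF pin q0 w] .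
      then have "walk K (Suc (Suc (nat (e1 - 0)))) (p 1) (p 100)"
        using walk_snoc adj_sym[OF e1(3)] pin by blast
      then have "walk K (Suc (Suc (Suc (nat (e1 - 0))))) (p 0) (p 100)"
        using walkS[OF pin] hole_adj[OF pK, of 0] by auto
      from far[OF this] show False using a by linarith
    qed
  qed
  moreover have "Q \<subseteq> S" using QTeq T(1) S0(1) by blast
  ultimately show ?thesis
    using x(1,2) y(1,2) AWW WK unfolding Q_def by blast
qed

end

section \<open>Polynomial-time functions\<close>

definition evalb :: "prog \<Rightarrow> val list \<Rightarrow> expr \<Rightarrow> val \<Rightarrow> nat \<Rightarrow> bool" where
  "evalb P env e v T \<longleftrightarrow> (\<exists>t\<le>T. eval P env e v t)"

lemma evalb_mono: "evalb P env e v T \<Longrightarrow> T \<le> T' \<Longrightarrow> evalb P env e v T'"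
  unfolding evalb_def by (meson order_trans)

lemma evalb_Var: "i < length env \<Longrightarrow> env ! i = v \<Longrightarrow> evalb P env (EVar i) v 1"
  unfolding evalb_def using eval.Var by blast

lemma evalb_Var': "i < length env \<Longrightarrow> env ! i = v \<Longrightarrow> 1 \<le> T \<Longrightarrow> evalb P env (EVar i) v T"
  using evalb_mono[OF evalb_Var] by blast

lemma evalb_Leaf: "evalb P env ELeaf Leaf 1"
  unfolding evalb_def using eval.ELeaf by blast

lemma evalb_Node: "evalb P env e1 v1 t1 \<Longrightarrow> evalb P env e2 v2 t2 \<Longrightarrow> evalb P env (ENode e1 e2) (Node v1 v2) (t1 + t2 + 1)"
  unfolding evalb_def by (meson add_le_mono eval.ENode order_refl)

lemma evalb_Left: "evalb P env e v t \<Longrightarrow> left v = w \<Longrightarrow> evalb P env (ELeft e) w (t + 1)"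
  unfolding evalb_def by (metis add_le_mono eval.ELeft order_refl)

lemma evalb_Right: "evalb P env e v t \<Longrightarrow> right v = w \<Longrightarrow> evalb P env (ERight e) w (t + 1)"
  unfolding evalb_def by (metis add_le_mono eval.ERight order_refl)

lemma evalb_IfT: "evalb P env e0 v0 t0 \<Longrightarrow> v0 \<noteq> Leaf \<Longrightarrow> evalb P env e1 v t1 \<Longrightarrow> evalb P env (EIf e0 e1 e2) v (t0 + t1 + 1)"
  unfolding evalb_def by (meson add_le_mono eval.IfTrue order_refl)

lemma evalb_IfF: "evalb P env e0 Leaf t0 \<Longrightarrow> evalb P env e2 v t2 \<Longrightarrow> evalb P env (EIf e0 e1 e2) v (t0 + t2 + 1)"
  unfolding evalb_def by (metis add_le_mono eval.IfFalse order_refl)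

lemma evalb_Let: "evalb P env e1 v1 t1 \<Longrightarrow> evalb P (v1 # env) e2 v t2 \<Longrightarrow> evalb P env (ELet e1 e2) v (t1 + t2 + 1)"
  unfolding evalb_def by (meson add_le_mono eval.Let order_refl)

lemma evalb_Call: "evalb P env e u t1 \<Longrightarrow> f < length P \<Longrightarrow> evalb P [u] (P ! f) v t2 \<Longrightarrow> evalb P env (ECall f e) v (t1 + t2 + 1)"
  unfolding evalb_def by (meson add_le_mono eval.Call order_refl)

text \<open>Relocates the function calls of a program, so that programs can be concatenated.\<close>
fun shift :: "nat \<Rightarrow> expr \<Rightarrow> expr" where
  "shift k (EVar i) = EVar i"
| "shift k ELeaf = ELeaf"
| "shift k (ENode a b) = ENode (shift k a) (shift k b)"
| "shift k (ELeft a) = ELeft (shift k a)"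
| "shift k (ERight a) = ERight (shift k a)"
| "shift k (EIf a b c) = EIf (shift k a) (shift k b) (shift k c)"
| "shift k (ELet a b) = ELet (shift k a) (shift k b)"
| "shift k (ECall f a) = ECall (k + f) (shift k a)"

lemma eval_link:
  "eval P env e v t \<Longrightarrow> eval (A @ map (shift (length A)) P @ B) env (shift (length A) e) v t"
proof (induction rule: eval.induct)
  case (Call env e u t1 f v t2)
  let ?Z = "A @ map (shift (length A)) P @ B"
  have "?Z ! (length A + f) = shift (length A) (P ! f)"
    using Call.hyps by (simp add: nth_append)
  with Call show ?case using eval.Call[of ?Z env "shift (length A) e" u t1 "length A + f" v t2] by simp
qed (auto simp only: shift.simps intro: eval.intros)

text \<open>
  The algorithm computes with unary numbers, so that a loop counter bounds the number of iterations polynomially.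
  Numbers of the input are therefore lists of bits.
\<close>
class encodable =
  fixes venc :: "'a \<Rightarrow> val"

instantiation bool :: encodable
begin
definition venc_bool :: "bool \<Rightarrow> val" where "venc_bool = enc_bool"
instance ..
end

instantiation unit :: encodable
begin
definition venc_unit :: "unit \<Rightarrow> val" where "venc_unit _ = Leaf"
instance ..
end

instantiation nat :: encodable
begin
primrec venc_nat :: "nat \<Rightarrow> val" where
  "venc_nat 0 = Leaf"
| "venc_nat (Suc n) = Node Leaf (venc_nat n)"
instance ..
end

instantiation prod :: (encodable, encodable) encodable
begin
definition venc_prod :: "'a \<times> 'b \<Rightarrow> val" where "venc_prod z = Node (venc (fst z)) (venc (snd z))"
instance ..
end

instantiation list :: (encodable) encodable
begin
definition venc_list :: "'a list \<Rightarrow> val" where "venc_list = enc_list venc"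
instance ..
end

lemma venc_list_simps [simp]: "venc [] = Leaf" "venc (x # xs) = Node (venc x) (venc xs)"
  unfolding venc_list_def by simp_all

lemma venc_prod_simp [simp]: "venc (a, b) = Node (venc a) (venc b)"
  unfolding venc_prod_def by simp

lemma venc_bool_simps [simp]: "venc True = Node Leaf Leaf" "venc False = Leaf"
  unfolding venc_bool_def by simp_all

lemma venc_unit_simp [simp]: "venc () = Leaf"
  unfolding venc_unit_def by simp

section \<open>Sizes of encodings and polynomial bounds\<close>

definition sz :: "'a::encodable \<Rightarrow> nat" where "sz x = val_size (venc x)"

lemma val_size_pos: "val_size v \<ge> 1"
  by (cases v) auto

lemma sz_pos: "sz x \<ge> 1"
  unfolding sz_def by (rule val_size_pos)

lemma sz_simps [simp]: "sz (a, b) = sz a + sz b + 1" "sz ([]::'a::encodable list) = 1"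
  "sz ((x::'a) # xs) = sz x + sz xs + 1" "sz (0::nat) = 1" "sz (Suc n) = sz n + 2" "sz () = 1"
  "sz True = 3" "sz False = 1"
  unfolding sz_def by simp_all

lemma sz_prod: "sz z = sz (fst z) + sz (snd z) + 1"
  by (cases z) simp

lemma sz_nat: "sz (n::nat) = 2 * n + 1"
  by (induction n) auto

lemma sz_elem: "x \<in> set xs \<Longrightarrow> sz x \<le> sz xs"
  by (induction xs) auto

lemma length_sz: "length xs \<le> sz xs"
  by (induction xs) auto

lemma sz_list_le: "(\<And>y. y \<in> set l \<Longrightarrow> sz y \<le> C) \<Longrightarrow> sz l \<le> length l * (C + 1) + 1"
proof (induction l)
  case (Cons a l)
  then have "sz a \<le> C" "sz l \<le> length l * (C + 1) + 1" by auto
  then show ?case by simp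
qed simp

lemma sz_append: "sz (xs @ ys) + 1 = sz xs + sz ys"
  by (induction xs) auto

lemma sz_rev: "sz (rev xs) = sz xs"
proof (induction xs)
  case (Cons a xs)
  then show ?case using sz_append[of "rev xs" "[a]"] by simp
qed simp

lemma sz_take: "sz (take i xs) \<le> sz xs"
proof (induction xs arbitrary: i)
  case (Cons a xs)
  then show ?case by (cases i) auto
qed simp

text \<open>The base is at least 2, so constants and sums are absorbed by a larger exponent.\<close>

definition poly_bounded :: "('a::encodable \<Rightarrow> nat) \<Rightarrow> bool" where
  "poly_bounded T \<longleftrightarrow> (\<exists>k. \<forall>x. T x \<le> (sz x + 1) ^ k)"

lemma poly_bounded_mono: "poly_bounded T' \<Longrightarrow> (\<And>x. T x \<le> T' x) \<Longrightarrow> poly_bounded T"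
  unfolding poly_bounded_def by (meson order_trans)

lemma poly_bounded_const: "poly_bounded (\<lambda>_. c)"
proof -
  have "c \<le> (sz (x::'a) + 1) ^ c" for x
  proof -
    have "c \<le> 2 ^ c" by simp
    also have "\<dots> \<le> (sz x + 1) ^ c" using sz_pos[of x] by (intro power_mono) auto
    finally show ?thesis .
  qed
  then show ?thesis unfolding poly_bounded_def by blast
qed

lemma poly_bounded_sz: "poly_bounded sz"
  unfolding poly_bounded_def by (intro exI[of _ 1]) simp

lemma pow_le_pow: "i \<le> j \<Longrightarrow> (sz x + 1) ^ i \<le> (sz x + 1) ^ j"
  by (rule power_increasing) auto

lemma poly_bounded_add: "poly_bounded S \<Longrightarrow> poly_bounded T \<Longrightarrow> poly_bounded (\<lambda>x. S x + T x)"
proof -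
  assume "poly_bounded S" "poly_bounded T"
  then obtain i j where ij: "\<And>x. S x \<le> (sz x + 1) ^ i" "\<And>x. T x \<le> (sz x + 1) ^ j" unfolding poly_bounded_def by blast
  have "S x + T x \<le> (sz x + 1) ^ Suc (max i j)" for x
  proof -
    have "S x + T x \<le> 2 * (sz x + 1) ^ max i j"
      using ij[of x] pow_le_pow[of i "max i j" x] pow_le_pow[of j "max i j" x] by simp
    also have "\<dots> \<le> (sz x + 1) * (sz x + 1) ^ max i j" using sz_pos[of x] by (intro mult_right_mono) auto
    finally show ?thesis by simp
  qed
  then show ?thesis unfolding poly_bounded_def by blast
qed

lemma poly_bounded_mult: "poly_bounded S \<Longrightarrow> poly_bounded T \<Longrightarrow> poly_bounded (\<lambda>x. S x * T x)"
proof -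
  assume "poly_bounded S" "poly_bounded T"
  then obtain i j where ij: "\<And>x. S x \<le> (sz x + 1) ^ i" "\<And>x. T x \<le> (sz x + 1) ^ j" unfolding poly_bounded_def by blast
  have "S x * T x \<le> (sz x + 1) ^ (i + j)" for x
    unfolding power_add using ij[of x] by (intro mult_mono) auto
  then show ?thesis unfolding poly_bounded_def by blast
qed

lemma poly_bounded_power: "poly_bounded S \<Longrightarrow> poly_bounded (\<lambda>x. S x ^ k)"
  by (induction k) (auto intro: poly_bounded_const poly_bounded_mult)

lemma poly_bounded_comp:
  assumes "poly_bounded T" "poly_bounded (\<lambda>x. sz (f x))"
  shows "poly_bounded (\<lambda>x. T (f x))"
proof -
  obtain k where "\<And>x. T x \<le> (sz x + 1) ^ k" using assms(1) unfolding poly_bounded_def by blast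
  then show ?thesis
    using assms(2) by (intro poly_bounded_mono[of "\<lambda>x. (sz (f x) + 1) ^ k" "\<lambda>x. T (f x)"] poly_bounded_power poly_bounded_add poly_bounded_const) auto
qed

lemmas poly_bounded_intros = poly_bounded_const poly_bounded_sz poly_bounded_add poly_bounded_mult poly_bounded_power

text \<open>The output size has its own bound: trees are shared, so a value can be exponentially
  larger than the time spent on it, and a time bound alone would not survive composition.\<close>

definition fp :: "('a::encodable \<Rightarrow> 'b::encodable) \<Rightarrow> bool" where
  "fp f \<longleftrightarrow> (\<exists>P T. P \<noteq> [] \<and> poly_bounded T \<and> poly_bounded (\<lambda>x. sz (f x)) \<and> (\<forall>x. evalb P [venc x] (P ! 0) (venc (f x)) (T x)))"

definition computes :: "prog \<Rightarrow> nat \<Rightarrow> ('a::encodable \<Rightarrow> 'b::encodable) \<Rightarrow> ('a \<Rightarrow> nat) \<Rightarrow> bool" where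
  "computes Z i f T \<longleftrightarrow> i < length Z \<and> (\<forall>x. evalb Z [venc x] (Z ! i) (venc (f x)) (T x))"

lemma computes_link:
  assumes "P \<noteq> []" "\<forall>x. evalb P [venc x] (P ! 0) (venc (f x)) (T x)"
    and "Z = A @ map (shift k) P @ B" "k = length A"
  shows "computes Z k f T"
proof -
  have "Z ! k = shift k (P ! 0)" using assms by (simp add: nth_append)
  moreover have "evalb Z [venc x] (shift k (P ! 0)) (venc (f x)) (T x)" for x
    using assms(2) eval_link[of P "[venc x]" "P ! 0" _ _ A B] unfolding assms(3,4) evalb_def by blast
  ultimately show ?thesis using assms unfolding computes_def by simp
qed

lemma computes_call:
  "computes Z i f T \<Longrightarrow> evalb Z env e v t \<Longrightarrow> v = venc x \<Longrightarrow> evalb Z env (ECall i e) (venc (f x)) (t + T x + 1)"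
  unfolding computes_def using evalb_Call by blast

lemma fp_size: "fp f \<Longrightarrow> poly_bounded (\<lambda>x. sz (f x))"
  unfolding fp_def by blast

lemma fpE:
  assumes "fp f"
  obtains P T where "P \<noteq> []" "poly_bounded T" "poly_bounded (\<lambda>x. sz (f x))" "\<forall>x. evalb P [venc x] (P ! 0) (venc (f x)) (T x)"
  using assms unfolding fp_def by blast

lemma fpI:
  assumes "Z \<noteq> []" "poly_bounded T" "poly_bounded (\<lambda>x. sz (f x))" "\<And>x. evalb Z [venc x] (Z ! 0) (venc (f x)) (T x)"
  shows "fp f"
  using assms unfolding fp_def by blast

text \<open>Functions with the same effect on encodings share a program. For instance,
  \<open>Suc n\<close> is encoded like the pair of \<open>()\<close> and \<open>n\<close>.\<close>

lemma fp_recode: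
  assumes "fp f" "\<And>x. venc (g x) = venc (f x)"
  shows "fp g"
proof -
  have "sz (g x) = sz (f x)" for x using assms(2) unfolding sz_def by simp
  then show ?thesis using assms unfolding fp_def by simp
qed

section \<open>Closure properties of polynomial-time functions\<close>

lemma fp_id: "fp (\<lambda>x. x)"
  by (rule fpI[of "[EVar 0]" "\<lambda>_. 1"]) (auto intro!: poly_bounded_intros evalb_Var')

lemma fp_const: "fp (\<lambda>_. c)"
proof -
  have "\<exists>e. \<forall>P env. evalb P env e v (val_size v)" for v
  proof (induction v)
    case Leaf
    show ?case using evalb_Leaf by (intro exI[of _ ELeaf]) simp
  next
    case (Node u v)
    then obtain e1 e2 where "\<forall>P env. evalb P env e1 u (val_size u)" "\<forall>P env. evalb P env e2 v (val_size v)" by blast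
    then show ?case using evalb_Node by (intro exI[of _ "ENode e1 e2"]) simp
  qed
  then obtain e where "\<forall>P env. evalb P env e (venc c) (val_size (venc c))" by blast
  then show ?thesis by (intro fpI[of "[e]" "\<lambda>_. val_size (venc c)"]) (auto intro!: poly_bounded_intros)
qed

text \<open>The pattern of all combinators: a new main function is followed by the relocated
  programs of the arguments, whose entry points are \<open>1\<close>, \<open>1 + length P\<close>,
  and so on.\<close>

lemma fp_comp:
  assumes "fp g" "fp f"
  shows "fp (\<lambda>x. g (f x))"
proof -
  obtain P T where P: "P \<noteq> []" "poly_bounded T" "poly_bounded (\<lambda>x. sz (f x))" "\<forall>x. evalb P [venc x] (P ! 0) (venc (f x)) (T x)"
    by (rule fpE[OF assms(2)])
  obtain Q S where Q: "Q \<noteq> []" "poly_bounded S" "poly_bounded (\<lambda>x. sz (g x))" "\<forall>x. evalb Q [venc x] (Q ! 0) (venc (g x)) (S x)"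
    by (rule fpE[OF assms(1)])
  define Z where "Z = [ECall (1 + length P) (ECall 1 (EVar 0))] @ map (shift 1) P @ map (shift (1 + length P)) Q"
  have 1: "computes Z 1 f T"
    by (rule computes_link[OF P(1,4), of _ "[ECall (1 + length P) (ECall 1 (EVar 0))]"]) (auto simp: Z_def)
  have 2: "computes Z (1 + length P) g S"
    by (rule computes_link[OF Q(1,4), of _ "[ECall (1 + length P) (ECall 1 (EVar 0))] @ map (shift 1) P" _ "[]"]) (auto simp: Z_def)
  have "evalb Z [venc x] (Z ! 0) (venc (g (f x))) (1 + T x + 1 + S (f x) + 1)" for x
  proof -
    have "evalb Z [venc x] (EVar 0) (venc x) 1" by (rule evalb_Var) auto
    from computes_call[OF 2 computes_call[OF 1 this refl] refl] show ?thesis by (simp add: Z_def)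
  qed
  then show ?thesis
    by (intro fpI[of Z "\<lambda>x. 1 + T x + 1 + S (f x) + 1"] poly_bounded_intros P(2) poly_bounded_comp[OF Q(2) P(3)] poly_bounded_comp[OF Q(3) P(3)])
      (auto simp: Z_def)
qed

lemma fp_pair:
  assumes "fp f" "fp g"
  shows "fp (\<lambda>x. (f x, g x))"
proof -
  obtain P T where P: "P \<noteq> []" "poly_bounded T" "poly_bounded (\<lambda>x. sz (f x))" "\<forall>x. evalb P [venc x] (P ! 0) (venc (f x)) (T x)"
    by (rule fpE[OF assms(1)])
  obtain Q S where Q: "Q \<noteq> []" "poly_bounded S" "poly_bounded (\<lambda>x. sz (g x))" "\<forall>x. evalb Q [venc x] (Q ! 0) (venc (g x)) (S x)"
    by (rule fpE[OF assms(2)])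
  define e where "e = ENode (ECall 1 (EVar 0)) (ECall (1 + length P) (EVar 0))"
  define Z where "Z = [e] @ map (shift 1) P @ map (shift (1 + length P)) Q"
  have 1: "computes Z 1 f T" by (rule computes_link[OF P(1,4), of _ "[e]"]) (auto simp: Z_def)
  have 2: "computes Z (1 + length P) g S"
    by (rule computes_link[OF Q(1,4), of _ "[e] @ map (shift 1) P" _ "[]"]) (auto simp: Z_def)
  have ev: "evalb Z [venc x] (Z ! 0) (venc (f x, g x)) ((1 + T x + 1) + (1 + S x + 1) + 1)" for x
  proof -
    have "evalb Z [venc x] (EVar 0) (venc x) 1" by (rule evalb_Var) auto
    from evalb_Node[OF computes_call[OF 1 this refl] computes_call[OF 2 this refl]]
    show ?thesis by (simp add: Z_def e_def)
  qed
  have pb1: "poly_bounded (\<lambda>x. (1 + T x + 1) + (1 + S x + 1) + 1)" by (intro poly_bounded_intros P(2) Q(2))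
  have pb2: "poly_bounded (\<lambda>x. sz (f x, g x))" unfolding sz_simps by (intro poly_bounded_intros P(3) Q(3))
  have ne: "Z \<noteq> []" by (simp add: Z_def)
  show ?thesis by (rule fpI[OF ne pb1 pb2 ev])
qed

lemma fp_if:
  assumes "fp c" "fp f" "fp g"
  shows "fp (\<lambda>x. if c x then f x else g x)"
proof -
  obtain P T where P: "P \<noteq> []" "poly_bounded T" "poly_bounded (\<lambda>x. sz (c x))" "\<forall>x. evalb P [venc x] (P ! 0) (venc (c x)) (T x)"
    by (rule fpE[OF assms(1)])
  obtain Q S where Q: "Q \<noteq> []" "poly_bounded S" "poly_bounded (\<lambda>x. sz (f x))" "\<forall>x. evalb Q [venc x] (Q ! 0) (venc (f x)) (S x)"
    by (rule fpE[OF assms(2)])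
  obtain R U where R: "R \<noteq> []" "poly_bounded U" "poly_bounded (\<lambda>x. sz (g x))" "\<forall>x. evalb R [venc x] (R ! 0) (venc (g x)) (U x)"
    by (rule fpE[OF assms(3)])
  define e where "e = EIf (ECall 1 (EVar 0)) (ECall (1 + length P) (EVar 0)) (ECall (1 + length P + length Q) (EVar 0))"
  define Z where "Z = [e] @ map (shift 1) P @ map (shift (1 + length P)) Q @ map (shift (1 + length P + length Q)) R"
  have 1: "computes Z 1 c T" by (rule computes_link[OF P(1,4), of _ "[e]"]) (auto simp: Z_def)
  have 2: "computes Z (1 + length P) f S"
    by (rule computes_link[OF Q(1,4), of _ "[e] @ map (shift 1) P"]) (auto simp: Z_def)
  have 3: "computes Z (1 + length P + length Q) g U"
    by (rule computes_link[OF R(1,4), of _ "[e] @ map (shift 1) P @ map (shift (1 + length P)) Q" _ "[]"]) (auto simp: Z_def)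
  have ev: "evalb Z [venc x] (Z ! 0) (venc (if c x then f x else g x)) ((1 + T x + 1) + (1 + S x + 1 + (1 + U x + 1)) + 1)" for x
  proof -
    have v: "evalb Z [venc x] (EVar 0) (venc x) 1" by (rule evalb_Var) auto
    note c = computes_call[OF 1 v refl]
    show ?thesis
    proof (cases "c x")
      case True
      then have "venc (c x) \<noteq> Leaf" by simp
      from evalb_mono[OF evalb_IfT[OF c this computes_call[OF 2 v refl]]]
      show ?thesis using True by (simp add: Z_def e_def)
    next
      case False
      then have "venc (c x) = Leaf" by simp
      from evalb_mono[OF evalb_IfF[OF c[unfolded this] computes_call[OF 3 v refl]]]
      show ?thesis using False by (simp add: Z_def e_def)
    qed
  qed
  have pb2: "poly_bounded (\<lambda>x. sz (if c x then f x else g x))"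
    by (rule poly_bounded_mono[of "\<lambda>x. sz (f x) + sz (g x)"]) (auto intro!: poly_bounded_intros P(2,3) Q(2,3) R(2,3))
  have pb1: "poly_bounded (\<lambda>x. (1 + T x + 1) + (1 + S x + 1 + (1 + U x + 1)) + 1)" by (intro poly_bounded_intros P(2) Q(2) R(2))
  have ne: "Z \<noteq> []" by (simp add: Z_def)
  show ?thesis by (rule fpI[OF ne pb1 pb2 ev])
qed

lemma fp_fst0: "fp fst"
proof (rule fpI[of "[ELeft (EVar 0)]" "\<lambda>_. 1 + 1"])
  fix x :: "'a \<times> 'b"
  show "evalb [ELeft (EVar 0)] [venc x] ([ELeft (EVar 0)] ! 0) (venc (fst x)) (1 + 1)"
    by (simp only: nth_Cons_0, rule evalb_Left[OF evalb_Var[OF _ refl]]) (auto simp: venc_prod_def)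
next
  show "poly_bounded (\<lambda>x::'a \<times> 'b. sz (fst x))" by (rule poly_bounded_mono[OF poly_bounded_sz]) (simp add: sz_prod[of "_ :: 'a \<times> 'b"])
qed (auto intro!: poly_bounded_const)

lemma fp_snd0: "fp snd"
proof (rule fpI[of "[ERight (EVar 0)]" "\<lambda>_. 1 + 1"])
  fix x :: "'a \<times> 'b"
  show "evalb [ERight (EVar 0)] [venc x] ([ERight (EVar 0)] ! 0) (venc (snd x)) (1 + 1)"
    by (simp only: nth_Cons_0, rule evalb_Right[OF evalb_Var[OF _ refl]]) (auto simp: venc_prod_def)
next
  show "poly_bounded (\<lambda>x::'a \<times> 'b. sz (snd x))" by (rule poly_bounded_mono[OF poly_bounded_sz]) (simp add: sz_prod[of "_ :: 'a \<times> 'b"])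
qed (auto intro!: poly_bounded_const)

lemmas fp_fst = fp_comp[OF fp_fst0] and fp_snd = fp_comp[OF fp_snd0]

lemma fp_tl0: "fp tl"
proof (rule fpI[of "[ERight (EVar 0)]" "\<lambda>_. 1 + 1"])
  fix x :: "'a list"
  show "evalb [ERight (EVar 0)] [venc x] ([ERight (EVar 0)] ! 0) (venc (tl x)) (1 + 1)"
    by (simp only: nth_Cons_0, rule evalb_Right[OF evalb_Var[OF _ refl]]) (cases x; simp; fail)+
next
  show "poly_bounded (\<lambda>x::'a list. sz (tl x))"
  proof (rule poly_bounded_mono[OF poly_bounded_sz])
    fix x :: "'a list" show "sz (tl x) \<le> sz x" by (cases x) auto
  qed
qed (auto intro!: poly_bounded_const)

lemmas fp_tl = fp_comp[OF fp_tl0]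

lemma fp_Cons: "fp f \<Longrightarrow> fp g \<Longrightarrow> fp (\<lambda>x. f x # g x)"
  by (rule fp_recode[OF fp_pair]) auto

lemma fp_Suc: "fp f \<Longrightarrow> fp (\<lambda>x. Suc (f x))"
  by (rule fp_recode[OF fp_pair[OF fp_const[of "()"]]]) auto

lemma fp_null0: "fp (\<lambda>x::'a::encodable list. x = [])"
proof (rule fpI[of "[EIf (EVar 0) ELeaf (ENode ELeaf ELeaf)]" "\<lambda>_. 1 + (1 + 1 + 1) + 1"])
  fix x :: "'a list"
  show "evalb [EIf (EVar 0) ELeaf (ENode ELeaf ELeaf)] [venc x] ([EIf (EVar 0) ELeaf (ENode ELeaf ELeaf)] ! 0)
    (venc (x = [])) (1 + (1 + 1 + 1) + 1)"
  proof (cases x)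
    case Nil
    have "evalb [EIf (EVar 0) ELeaf (ENode ELeaf ELeaf)] [venc x] (EVar 0) Leaf 1"
      using Nil by (intro evalb_Var) auto
    from evalb_IfF[OF this evalb_Node[OF evalb_Leaf evalb_Leaf]] show ?thesis using Nil by simp
  next
    case (Cons y ys)
    have "evalb [EIf (EVar 0) ELeaf (ENode ELeaf ELeaf)] [venc x] (EVar 0) (venc x) 1"
      by (intro evalb_Var) auto
    from evalb_mono[OF evalb_IfT[OF this _ evalb_Leaf]] show ?thesis using Cons by simp
  qed
next
  show "poly_bounded (\<lambda>x::'a list. sz (x = []))"
  proof (rule poly_bounded_mono[OF poly_bounded_const[of 3]])
    fix x :: "'a list" show "sz (x = []) \<le> 3" by (cases "x = []") auto
  qed
qed (auto intro!: poly_bounded_const)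

lemmas fp_null = fp_comp[OF fp_null0]

text \<open>The branch is a function of a triple that includes \<open>x\<close>, because a function
  body sees nothing but its argument. The same form recurs in \<open>fp_fold\<close> and
  \<open>fp_map\<close>.\<close>

lemma fp_case_list:
  assumes "fp xs" "fp a" "fp (\<lambda>z. b (fst z) (fst (snd z)) (snd (snd z)))"
  shows "fp (\<lambda>x. case xs x of [] \<Rightarrow> a x | y # ys \<Rightarrow> b x y ys)"
proof -
  obtain P T where P: "P \<noteq> []" "poly_bounded T" "poly_bounded (\<lambda>x. sz (xs x))" "\<forall>x. evalb P [venc x] (P ! 0) (venc (xs x)) (T x)"
    by (rule fpE[OF assms(1)])
  obtain Q S where Q: "Q \<noteq> []" "poly_bounded S" "poly_bounded (\<lambda>x. sz (a x))" "\<forall>x. evalb Q [venc x] (Q ! 0) (venc (a x)) (S x)"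
    by (rule fpE[OF assms(2)])
  let ?b = "\<lambda>z. b (fst z) (fst (snd z)) (snd (snd z))"
  obtain R U where R: "R \<noteq> []" "poly_bounded U" "poly_bounded (\<lambda>x. sz (?b x))" "\<forall>x. evalb R [venc x] (R ! 0) (venc (?b x)) (U x)"
    by (rule fpE[OF assms(3)])
  define e where "e = ELet (ECall 1 (EVar 0)) (EIf (EVar 0) (ECall (1 + length P + length Q) (ENode (EVar 1) (EVar 0)))
    (ECall (1 + length P) (EVar 1)))"
  define Z where "Z = [e] @ map (shift 1) P @ map (shift (1 + length P)) Q @ map (shift (1 + length P + length Q)) R"
  have 1: "computes Z 1 xs T" by (rule computes_link[OF P(1,4), of _ "[e]"]) (auto simp: Z_def)
  have 2: "computes Z (1 + length P) a S"
    by (rule computes_link[OF Q(1,4), of _ "[e] @ map (shift 1) P"]) (auto simp: Z_def)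
  have 3: "computes Z (1 + length P + length Q) ?b U"
    by (rule computes_link[OF R(1,4), of _ "[e] @ map (shift 1) P @ map (shift (1 + length P)) Q" _ "[]"]) (auto simp: Z_def)
  define g where "g x = (x, hd (xs x), tl (xs x))" for x
  \<comment> \<open>For an empty list \<open>g x\<close> contains the unspecified head, whose size
    is unknown; hence the default 0.\<close>
  define h where "h x = (if xs x = [] then 0 else U (g x))" for x
  define h' where "h' x = (if xs x = [] then 0 else sz (?b (g x)))" for x
  have szg: "sz (g x) \<le> sz x + sz (xs x) + 1" if "xs x \<noteq> []" for x
    using that unfolding g_def by (cases "xs x") auto
  have bnd: "poly_bounded (\<lambda>x. if xs x = [] then 0 else V (g x))" if V: "poly_bounded V" for V :: "_ \<Rightarrow> nat"
  proof -
    obtain k where k: "\<And>z. V z \<le> (sz z + 1) ^ k" using V unfolding poly_bounded_def by blast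
    show ?thesis
    proof (rule poly_bounded_mono)
      show "poly_bounded (\<lambda>x. (sz x + sz (xs x) + 2) ^ k)" by (intro poly_bounded_intros P(2,3))
      fix x
      show "(if xs x = [] then 0 else V (g x)) \<le> (sz x + sz (xs x) + 2) ^ k"
      proof (cases "xs x = []")
        case False
        have "V (g x) \<le> (sz (g x) + 1) ^ k" by (rule k)
        also have "\<dots> \<le> (sz x + sz (xs x) + 2) ^ k" using szg[OF False] by (intro power_mono) auto
        finally show ?thesis using False by simp
      qed simp
    qed
  qed
  have ev: "evalb Z [venc x] (Z ! 0) (venc (case xs x of [] \<Rightarrow> a x | y # ys \<Rightarrow> b x y ys)) (T x + S x + h x + 10)" for x
  proof -
    have v: "evalb Z [venc x] (EVar 0) (venc x) 1" by (rule evalb_Var) auto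
    note c = computes_call[OF 1 v refl]
    show ?thesis
    proof (cases "xs x")
      case Nil
      have w: "evalb Z [Leaf, venc x] (EVar 1) (venc x) 1" "evalb Z [Leaf, venc x] (EVar 0) Leaf 1" by (rule evalb_Var; simp)+
      have n: "venc (xs x) = Leaf" using Nil by simp
      from evalb_mono[OF evalb_Let[OF c[unfolded n] evalb_IfF[OF w(2) computes_call[OF 2 w(1) refl]]]]
      show ?thesis using Nil by (simp add: Z_def e_def)
    next
      case (Cons y ys)
      have w: "evalb Z [venc (xs x), venc x] (EVar 1) (venc x) 1" "evalb Z [venc (xs x), venc x] (EVar 0) (venc (xs x)) 1"
        by (rule evalb_Var; simp)+
      have n: "venc (xs x) \<noteq> Leaf" using Cons by simp
      have g: "Node (venc x) (venc (xs x)) = venc (g x)" using Cons by (simp add: g_def)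
      from evalb_mono[OF evalb_Let[OF c evalb_IfT[OF w(2) n computes_call[OF 3 evalb_Node[OF w] g]]]]
      show ?thesis using Cons by (simp add: Z_def e_def h_def g_def)
    qed
  qed
  have "poly_bounded (\<lambda>x. sz (case xs x of [] \<Rightarrow> a x | y # ys \<Rightarrow> b x y ys))"
  proof (rule poly_bounded_mono)
    show "poly_bounded (\<lambda>x. sz (a x) + h' x)" unfolding h'_def using bnd[OF R(3)] by (intro poly_bounded_intros Q(2,3)) auto
    show "sz (case xs x of [] \<Rightarrow> a x | y # ys \<Rightarrow> b x y ys) \<le> sz (a x) + h' x" for x
      by (cases "xs x") (auto simp: h'_def g_def)
  qed
  then show ?thesis
    using ev bnd[OF R(2)] by (intro fpI[of Z "\<lambda>x. T x + S x + h x + 10"] poly_bounded_intros P(2,3) Q(2,3)) (auto simp: Z_def h_def)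
qed

text \<open>A polynomial-time step can square the size of the accumulator each time, so a bound
  \<open>U\<close> on all intermediate accumulators is assumed.\<close>

lemma fp_fold:
  assumes s: "fp (\<lambda>z. s (fst z) (fst (snd z)) (snd (snd z)))" and xs: "fp xs" and a: "fp a"
    and U: "poly_bounded U" "\<And>x i. sz (fold (s x) (take i (xs x)) (a x)) \<le> U x"
  shows "fp (\<lambda>x. fold (s x) (xs x) (a x))"
proof -
  obtain P T where P: "P \<noteq> []" "poly_bounded T" "poly_bounded (\<lambda>x. sz (xs x))" "\<forall>x. evalb P [venc x] (P ! 0) (venc (xs x)) (T x)"
    by (rule fpE[OF xs])
  obtain Q S where Q: "Q \<noteq> []" "poly_bounded S" "poly_bounded (\<lambda>x. sz (a x))" "\<forall>x. evalb Q [venc x] (Q ! 0) (venc (a x)) (S x)"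
    by (rule fpE[OF a])
  let ?s = "\<lambda>z. s (fst z) (fst (snd z)) (snd (snd z))"
  obtain R V where R: "R \<noteq> []" "poly_bounded V" "poly_bounded (\<lambda>x. sz (?s x))" "\<forall>x. evalb R [venc x] (R ! 0) (venc (?s x)) (V x)"
    by (rule fpE[OF s])
  define e where "e = ECall 1 (ENode (EVar 0) (ENode (ECall 2 (EVar 0)) (ECall (2 + length P) (EVar 0))))"
  define l where "l = ELet (ELeft (ERight (EVar 0))) (EIf (EVar 0)
      (ECall 1 (ENode (ELeft (EVar 1)) (ENode (ERight (EVar 0))
         (ECall (2 + length P + length Q) (ENode (ELeft (EVar 1)) (ENode (ELeft (EVar 0)) (ERight (ERight (EVar 1)))))))))
      (ERight (ERight (EVar 1))))"
  define Z where "Z = [e, l] @ map (shift 2) P @ map (shift (2 + length P)) Q @ map (shift (2 + length P + length Q)) R"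
  have 1: "computes Z 2 xs T" by (rule computes_link[OF P(1,4), of _ "[e, l]"]) (auto simp: Z_def)
  have 2: "computes Z (2 + length P) a S"
    by (rule computes_link[OF Q(1,4), of _ "[e, l] @ map (shift 2) P"]) (auto simp: Z_def)
  have 3: "computes Z (2 + length P + length Q) ?s V"
    by (rule computes_link[OF R(1,4), of _ "[e, l] @ map (shift 2) P @ map (shift (2 + length P)) Q" _ "[]"]) (auto simp: Z_def)
  have Z1: "1 < length Z" "Z ! 1 = l" "Z ! 0 = e" unfolding Z_def by auto
  have loop: "evalb Z [Node (venc x) (Node (venc ys) (venc acc))] l (venc (fold (s x) ys acc)) (length ys * (C + 30) + 30)"
    if "\<forall>i<length ys. V (x, ys ! i, fold (s x) (take i ys) acc) \<le> C" for x ys acc C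
    using that
  proof (induction ys arbitrary: acc)
    case Nil
    let ?v = "Node (venc x) (Node (venc ([]::'b list)) (venc acc))"
    have v: "evalb Z [Leaf, ?v] (EVar 0) Leaf 1" "evalb Z [Leaf, ?v] (EVar 1) ?v 1" "evalb Z [?v] (EVar 0) ?v 1"
      by (rule evalb_Var; simp)+
    have "evalb Z [?v] (ELeft (ERight (EVar 0))) Leaf (1 + 1 + 1)"
      by (rule evalb_Left[OF evalb_Right[OF v(3) refl]]) simp
    from evalb_Let[OF this evalb_IfF[OF v(1) evalb_Right[OF evalb_Right[OF v(2) refl] refl]]]
    have "evalb Z [?v] l (venc acc) (1 + 1 + 1 + (1 + (1 + 1 + 1) + 1) + 1)" unfolding l_def by simp
    from evalb_mono[OF this] show ?case by simp
  next
    case (Cons y ys)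
    let ?v = "Node (venc x) (Node (venc (y # ys)) (venc acc))"
    let ?l = "venc (y # ys)"
    have v: "evalb Z [?l, ?v] (EVar 0) ?l 1" "evalb Z [?l, ?v] (EVar 1) ?v 1" "evalb Z [?v] (EVar 0) ?v 1"
      by (rule evalb_Var; simp)+
    have h: "evalb Z [?v] (ELeft (ERight (EVar 0))) ?l (1 + 1 + 1)"
      by (rule evalb_Left[OF evalb_Right[OF v(3) refl]]) simp
    have x: "evalb Z [?l, ?v] (ELeft (EVar 1)) (venc x) (1 + 1)" by (rule evalb_Left[OF v(2)]) simp
    have acc: "evalb Z [?l, ?v] (ERight (ERight (EVar 1))) (venc acc) (1 + 1 + 1)"
      by (rule evalb_Right[OF evalb_Right[OF v(2) refl]]) simp
    have y: "evalb Z [?l, ?v] (ELeft (EVar 0)) (venc y) (1 + 1)" by (rule evalb_Left[OF v(1)]) simp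
    have ys: "evalb Z [?l, ?v] (ERight (EVar 0)) (venc ys) (1 + 1)" by (rule evalb_Right[OF v(1)]) simp
    have call: "evalb Z [?l, ?v] (ECall (2 + length P + length Q) (ENode (ELeft (EVar 1)) (ENode (ELeft (EVar 0)) (ERight (ERight (EVar 1))))))
      (venc (?s (x, y, acc))) ((1 + 1) + ((1 + 1) + (1 + 1 + 1) + 1) + 1 + V (x, y, acc) + 1)"
      by (rule computes_call[OF 3 evalb_Node[OF x evalb_Node[OF y acc]]]) simp
    have "V (x, ys ! i, fold (s x) (take i ys) (s x y acc)) \<le> C" if "i < length ys" for i
      using Cons.prems[rule_format, of "Suc i"] that by simp
    then have "evalb Z [Node (venc x) (Node (venc ys) (venc (s x y acc)))] l (venc (fold (s x) ys (s x y acc))) (length ys * (C + 30) + 30)"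
      using Cons.IH by blast
    then have IH: "evalb Z [Node (venc x) (Node (venc ys) (venc (?s (x, y, acc))))] (Z ! 1) (venc (fold (s x) (y # ys) acc)) (length ys * (C + 30) + 30)"
      using Z1 by simp
    have V0: "V (x, y, acc) \<le> C" using Cons.prems[rule_format, of 0] by simp
    from evalb_Let[OF h evalb_IfT[OF v(1) _ evalb_Call[OF evalb_Node[OF x evalb_Node[OF ys call]] Z1(1) IH]]]
    have "evalb Z [?v] l (venc (fold (s x) (y # ys) acc)) (1 + 1 + 1 + (1 + ((1 + 1) + ((1 + 1) + ((1 + 1) + ((1 + 1) + (1 + 1 + 1) + 1) + 1 + V (x, y, acc) + 1) + 1) + 1 + (length ys * (C + 30) + 30) + 1) + 1) + 1)"
      unfolding l_def by simp
    from evalb_mono[OF this] show ?case using V0 by simp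
  qed
  obtain k where k: "\<And>z. V z \<le> (sz z + 1) ^ k" using R(2) unfolding poly_bounded_def by blast
  define C where "C x = (sz x + sz (xs x) + U x + 3) ^ k" for x
  have VC: "V (x, xs x ! i, fold (s x) (take i (xs x)) (a x)) \<le> C x" if "i < length (xs x)" for x i
  proof -
    have "sz (xs x ! i) \<le> sz (xs x)" using that by (intro sz_elem) simp
    then have "(sz (x, xs x ! i, fold (s x) (take i (xs x)) (a x)) + 1) ^ k \<le> C x"
      unfolding C_def using U(2)[of x i] by (intro power_mono) auto
    then show ?thesis using k order_trans by blast
  qed
  have pbC: "poly_bounded C" unfolding C_def[abs_def] by (intro poly_bounded_intros P(2,3) U(1))
  define W where "W x = T x + S x + sz (xs x) * (C x + 30) + 50" for x
  have "evalb Z [venc x] (Z ! 0) (venc (fold (s x) (xs x) (a x))) (W x)" for x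
  proof -
    have v: "evalb Z [venc x] (EVar 0) (venc x) 1" by (rule evalb_Var) auto
    have "evalb Z [Node (venc x) (Node (venc (xs x)) (venc (a x)))] (Z ! 1) (venc (fold (s x) (xs x) (a x))) (length (xs x) * (C x + 30) + 30)"
      using loop VC Z1 by simp
    from evalb_Call[OF evalb_Node[OF v evalb_Node[OF computes_call[OF 1 v refl] computes_call[OF 2 v refl]]] Z1(1) this]
    have "evalb Z [venc x] (Z ! 0) (venc (fold (s x) (xs x) (a x)))
      (1 + ((1 + T x + 1) + (1 + S x + 1) + 1) + 1 + (length (xs x) * (C x + 30) + 30) + 1)"
      unfolding Z1(3) e_def by simp
    then show ?thesis
    proof (rule evalb_mono)
      have "length (xs x) * (C x + 30) \<le> sz (xs x) * (C x + 30)" by (intro mult_right_mono length_sz) simp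
      then show "1 + ((1 + T x + 1) + (1 + S x + 1) + 1) + 1 + (length (xs x) * (C x + 30) + 30) + 1 \<le> W x"
        unfolding W_def by linarith
    qed
  qed
  moreover have "poly_bounded W" unfolding W_def[abs_def] by (intro poly_bounded_intros P(2,3) Q(2,3) pbC)
  moreover have "poly_bounded (\<lambda>x. sz (fold (s x) (xs x) (a x)))"
  proof (rule poly_bounded_mono[OF U(1)])
    show "sz (fold (s x) (xs x) (a x)) \<le> U x" for x using U(2)[of x "length (xs x)"] by simp
  qed
  ultimately show ?thesis by (intro fpI[of Z W]) (auto simp: Z_def)
qed

lemmas fp_basic = fp_id fp_const fp_pair fp_fst fp_snd fp_if fp_tl fp_Cons fp_Suc fp_null

lemma fp_rev: assumes "fp xs" shows "fp (\<lambda>x. rev (xs x))"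
proof -
  have "fp (\<lambda>x. fold (\<lambda>y acc. y # acc) (xs x) [])"
  proof (rule fp_fold)
    show "poly_bounded (\<lambda>x. sz (xs x))" by (rule fp_size[OF assms])
    fix x i
    have "fold (\<lambda>y acc. y # acc) (take i (xs x)) [] = rev (take i (xs x))" by (simp add: fold_Cons_rev)
    then show "sz (fold (\<lambda>y acc. y # acc) (take i (xs x)) []) \<le> sz (xs x)"
      using sz_take[of i "xs x"] by (simp add: sz_rev)
  qed (intro fp_basic assms)+
  then show ?thesis by (simp add: fold_Cons_rev)
qed

lemma fp_append: assumes "fp xs" "fp ys" shows "fp (\<lambda>x. xs x @ ys x)"
proof -
  have "fp (\<lambda>x. fold (\<lambda>y acc. y # acc) (rev (xs x)) (ys x))"
  proof (rule fp_fold)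
    show "poly_bounded (\<lambda>x. sz (xs x) + sz (ys x))" by (intro poly_bounded_add fp_size assms)
    fix x i
    have "fold (\<lambda>y acc. y # acc) (take i (rev (xs x))) (ys x) = rev (take i (rev (xs x))) @ ys x" by (simp add: fold_Cons_rev)
    then show "sz (fold (\<lambda>y acc. y # acc) (take i (rev (xs x))) (ys x)) \<le> sz (xs x) + sz (ys x)"
      using sz_take[of i "rev (xs x)"] sz_append[of "rev (take i (rev (xs x)))" "ys x"] by (simp add: sz_rev)
  qed (intro fp_basic fp_rev assms)+
  then show ?thesis by (simp add: fold_Cons_rev)
qed

lemma fp_map:
  assumes f: "fp (\<lambda>z. f (fst z) (snd z))" and xs: "fp xs"
  shows "fp (\<lambda>x. map (f x) (xs x))"
proof -
  have fold: "fold (\<lambda>y acc. f x y # acc) l [] = rev (map (f x) l)" for x l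
  proof -
    have "fold (\<lambda>y acc. f x y # acc) l a = rev (map (f x) l) @ a" for a
      by (induction l arbitrary: a) auto
    then show ?thesis by simp
  qed
  obtain k where k: "\<forall>z. sz (f (fst z) (snd z)) \<le> (sz z + 1) ^ k"
    using fp_size[OF f] unfolding poly_bounded_def by (rule exE)
  have "fp (\<lambda>x. fold (\<lambda>y acc. f x y # acc) (xs x) [])"
  proof (rule fp_fold)
    show "fp (\<lambda>z. f (fst z) (fst (snd z)) # snd (snd z))"
    proof -
      have "fp (\<lambda>z. (\<lambda>z. f (fst z) (snd z)) (fst z, fst (snd z)))"
        by (rule fp_comp[OF f]) (intro fp_basic)
      then show ?thesis by (intro fp_basic) simp
    qed
    show "poly_bounded (\<lambda>x. sz (xs x) * ((sz x + sz (xs x) + 2) ^ k + 1) + 1)"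
      by (intro poly_bounded_intros fp_size[OF xs])
    fix x i
    have "sz y \<le> (sz x + sz (xs x) + 2) ^ k" if y: "y \<in> set (rev (map (f x) (take i (xs x))))" for y
    proof -
      obtain w where w: "w \<in> set (take i (xs x))" "y = f x w" using y by auto
      then have "sz w \<le> sz (xs x)" using sz_elem in_set_takeD by metis
      then have "(sz (x, w) + 1) ^ k \<le> (sz x + sz (xs x) + 2) ^ k" by (intro power_mono) auto
      then show ?thesis using spec[OF k, of "(x, w)"] w by simp
    qed
    then have "sz (rev (map (f x) (take i (xs x)))) \<le> length (rev (map (f x) (take i (xs x)))) * ((sz x + sz (xs x) + 2) ^ k + 1) + 1"
      by (rule sz_list_le)
    also have "\<dots> \<le> sz (xs x) * ((sz x + sz (xs x) + 2) ^ k + 1) + 1"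
      using length_sz[of "xs x"] by (intro add_mono mult_right_mono) auto
    finally show "sz (fold (\<lambda>y acc. f x y # acc) (take i (xs x)) []) \<le> sz (xs x) * ((sz x + sz (xs x) + 2) ^ k + 1) + 1"
      unfolding fold .
  qed (intro fp_basic xs)+
  from fp_rev[OF this] show ?thesis unfolding fold by simp
qed

lemma sz_concat: "sz (concat l) \<le> sz l"
proof (induction l)
  case (Cons a l)
  then show ?case using sz_append[of a "concat l"] by simp
qed simp

lemma fp_concat: assumes "fp xs" shows "fp (\<lambda>x. concat (xs x))"
proof -
  have fold: "fold (\<lambda>y acc. acc @ y) l [] = concat l" for l :: "'c list list"
  proof -
    have "fold (\<lambda>y acc. acc @ y) l a = a @ concat l" for a
      by (induction l arbitrary: a) auto
    then show ?thesis by simp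
  qed
  have "fp (\<lambda>x. fold (\<lambda>y acc. acc @ y) (xs x) [])"
  proof (rule fp_fold)
    show "poly_bounded (\<lambda>x. sz (xs x))" by (rule fp_size[OF assms])
    show "sz (fold (\<lambda>y acc. acc @ y) (take i (xs x)) []) \<le> sz (xs x)" for x i
      unfolding fold using sz_concat[of "take i (xs x)"] sz_take[of i "xs x"] by simp
  qed (intro fp_basic fp_append assms)+
  then show ?thesis unfolding fold .
qed

lemma fp_filter:
  assumes "fp (\<lambda>z. P (fst z) (snd z))" "fp xs"
  shows "fp (\<lambda>x. filter (P x) (xs x))"
proof -
  have "fp (\<lambda>x. concat (map (\<lambda>y. if P x y then [y] else []) (xs x)))"
    by (intro fp_concat fp_map fp_basic assms)
  moreover have "concat (map (\<lambda>y. if P x y then [y] else []) l) = filter (P x) l" for x l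
    by (induction l) auto
  ultimately show ?thesis by simp
qed

lemma fp_not: "fp p \<Longrightarrow> fp (\<lambda>x. \<not> p x)"
  by (rule fp_recode[OF fp_if[OF _ fp_const[of False] fp_const[of True]]]) auto

lemma fp_conj: assumes "fp p" "fp q" shows "fp (\<lambda>x. p x \<and> q x)"
proof -
  have e: "(\<lambda>x. p x \<and> q x) = (\<lambda>x. if p x then q x else False)" by auto
  show ?thesis unfolding e by (intro fp_if fp_const assms)
qed

lemma fp_disj: assumes "fp p" "fp q" shows "fp (\<lambda>x. p x \<or> q x)"
proof -
  have e: "(\<lambda>x. p x \<or> q x) = (\<lambda>x. if p x then True else q x)" by auto
  show ?thesis unfolding e by (intro fp_if fp_const assms)
qed

lemma fp_bool_eq: assumes "fp p" "fp q" shows "fp (\<lambda>x. p x = (q x::bool))"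
proof -
  have e: "(\<lambda>x. p x = q x) = (\<lambda>x. if p x then q x else \<not> q x)" by auto
  show ?thesis unfolding e by (intro fp_if fp_not assms)
qed

lemma fp_bex:
  assumes "fp (\<lambda>z. P (fst z) (snd z))" "fp xs"
  shows "fp (\<lambda>x. \<exists>y\<in>set (xs x). P x y)"
proof -
  have "fp (\<lambda>x. \<not> (filter (P x) (xs x) = []))"
    by (intro fp_not fp_null fp_filter assms)
  moreover have "(\<not> (filter (P x) l = [])) = (\<exists>y\<in>set l. P x y)" for x l
    by (auto simp: filter_empty_conv)
  ultimately show ?thesis by simp
qed

lemma fp_length: assumes "fp xs" shows "fp (\<lambda>x. length (xs x))"
proof -
  have fold: "fold (\<lambda>y n. Suc n) l 0 = length l" for l :: "'c list"
  proof -
    have "fold (\<lambda>y n. Suc n) l a = a + length l" for a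
      by (induction l arbitrary: a) auto
    then show ?thesis by simp
  qed
  have "fp (\<lambda>x. fold (\<lambda>y n. Suc n) (xs x) 0)"
  proof (rule fp_fold)
    show "poly_bounded (\<lambda>x. 2 * sz (xs x) + 1)" by (intro poly_bounded_intros fp_size[OF assms])
    show "sz (fold (\<lambda>y n. Suc n) (take i (xs x)) 0) \<le> 2 * sz (xs x) + 1" for x i
      unfolding fold using length_sz[of "xs x"] by (simp add: sz_nat)
  qed (intro fp_basic assms)+
  then show ?thesis unfolding fold .
qed

lemma venc_replicate: "venc (replicate n ()) = venc n"
  by (induction n) auto

lemma fp_replicate: "fp n \<Longrightarrow> fp (\<lambda>x. replicate (n x) ())"
  by (rule fp_recode) (auto simp: venc_replicate)

text \<open>Iteration is a fold over a list of units, which has the same encoding as the unary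
  counter.\<close>

lemma fp_funpow:
  fixes s :: "'a::encodable \<Rightarrow> 'b::encodable \<Rightarrow> 'b"
  assumes s: "fp (\<lambda>z. s (fst z) (snd z))" and n: "fp n" and a: "fp a"
    and U: "poly_bounded U" "\<And>x i. i \<le> n x \<Longrightarrow> sz ((s x ^^ i) (a x)) \<le> U x"
  shows "fp (\<lambda>x. (s x ^^ n x) (a x))"
proof -
  have fold: "fold (\<lambda>_. g) (replicate n ()) b = (g ^^ n) b" for g :: "'b \<Rightarrow> 'b" and n b
    by (induction n arbitrary: b) (auto simp: funpow_swap1)
  have "fp (\<lambda>x. fold (\<lambda>_. s x) (replicate (n x) ()) (a x))"
  proof (rule fp_fold[OF _ _ _ U(1)])
    show "sz (fold (\<lambda>_. s x) (take i (replicate (n x) ())) (a x)) \<le> U x" for x i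
      using U(2)[of "min i (n x)" x] by (simp add: fold)
    have "fp (\<lambda>z. (\<lambda>z. s (fst z) (snd z)) (fst z, snd (snd z)))"
      by (rule fp_comp[OF s]) (intro fp_basic)
    then show "fp (\<lambda>z. s (fst z) (snd (snd z)))" by simp
  qed (intro fp_replicate n a)+
  then show ?thesis unfolding fold .
qed

lemma fp_pred0: "fp (\<lambda>n::nat. n - 1)"
proof (rule fpI[of "[ERight (EVar 0)]" "\<lambda>_. 1 + 1"])
  fix x :: nat
  show "evalb [ERight (EVar 0)] [venc x] ([ERight (EVar 0)] ! 0) (venc (x - 1)) (1 + 1)"
    by (simp only: nth_Cons_0, rule evalb_Right[OF evalb_Var[OF _ refl]]) (cases x; simp; fail)+
next
  show "poly_bounded (\<lambda>x::nat. sz (x - 1))"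
    by (rule poly_bounded_mono[OF poly_bounded_sz]) (simp add: sz_nat)
qed (auto intro!: poly_bounded_const)

lemmas fp_pred = fp_comp[OF fp_pred0]

lemma fp_minus: assumes "fp m" "fp n" shows "fp (\<lambda>x. m x - (n x::nat))"
proof -
  have e: "((\<lambda>k. k - 1) ^^ i) j = j - i" for i j :: nat
    by (induction i) auto
  have "fp (\<lambda>x. ((\<lambda>k. k - 1) ^^ n x) (m x))"
  proof (rule fp_funpow)
    show "poly_bounded (\<lambda>x. sz (m x))" by (rule fp_size[OF assms(1)])
    show "sz (((\<lambda>k. k - 1) ^^ i) (m x)) \<le> sz (m x)" for x i unfolding e by (simp add: sz_nat)
  qed (intro fp_basic fp_pred assms)+
  then show ?thesis unfolding e .
qed

lemma fp_add: assumes "fp m" "fp n" shows "fp (\<lambda>x. m x + (n x::nat))"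
proof -
  have e: "(Suc ^^ i) j = j + i" for i j :: nat
    by (induction i) auto
  have "fp (\<lambda>x. (Suc ^^ n x) (m x))"
  proof (rule fp_funpow)
    show "poly_bounded (\<lambda>x. sz (m x) + sz (n x))" by (intro poly_bounded_add fp_size assms)
    show "sz ((Suc ^^ i) (m x)) \<le> sz (m x) + sz (n x)" if "i \<le> n x" for x i
      unfolding e using that by (simp add: sz_nat)
  qed (intro fp_basic assms)+
  then show ?thesis unfolding e .
qed

lemma fp_zero: "fp n \<Longrightarrow> fp (\<lambda>x. n x = (0::nat))"
proof -
  assume "fp n"
  then have "fp (\<lambda>x. replicate (n x) () = [])" by (intro fp_null fp_replicate)
  then show ?thesis by simp
qed

lemma fp_le: "fp m \<Longrightarrow> fp n \<Longrightarrow> fp (\<lambda>x. m x \<le> (n x::nat))"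
proof -
  assume "fp m" "fp n"
  then have "fp (\<lambda>x. m x - n x = 0)" by (intro fp_zero fp_minus)
  then show ?thesis by simp
qed

lemma fp_nat_eq: "fp m \<Longrightarrow> fp n \<Longrightarrow> fp (\<lambda>x. m x = (n x::nat))"
proof -
  assume "fp m" "fp n"
  then have "fp (\<lambda>x. m x \<le> n x \<and> n x \<le> m x)" by (intro fp_conj fp_le)
  then show ?thesis by (simp add: eq_iff)
qed

lemma fp_drop: assumes "fp n" "fp xs" shows "fp (\<lambda>x. drop (n x) (xs x))"
proof -
  have e: "(tl ^^ i) l = drop i l" for i and l :: "'c::encodable list"
    by (induction i) (auto simp: drop_Suc tl_drop)
  have "sz (drop i l) \<le> sz l" for i and l :: "'c::encodable list"
    using sz_append[of "take i l" "drop i l"] sz_pos[of "take i l"] by simp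
  then have "fp (\<lambda>x. (tl ^^ n x) (xs x))"
    by (intro fp_funpow[OF _ _ _ fp_size[OF assms(2)]]) (intro fp_basic assms | simp add: e)+
  then show ?thesis unfolding e .
qed

text \<open>Total list access with a default, composed of operations that already have
  programs.\<close>

definition lookup :: "'a \<Rightarrow> 'a list \<Rightarrow> nat \<Rightarrow> 'a" where
  "lookup a xs n = (case drop n xs of [] \<Rightarrow> a | y # ys \<Rightarrow> y)"

lemma lookup_nth: "lookup a xs n = (if n < length xs then xs ! n else a)"
  unfolding lookup_def by (auto simp: Cons_nth_drop_Suc[symmetric])

lemma fp_lookup: "fp a \<Longrightarrow> fp xs \<Longrightarrow> fp n \<Longrightarrow> fp (\<lambda>x. lookup (a x) (xs x) (n x))"
  unfolding lookup_def by (intro fp_case_list fp_drop fp_basic)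

lemma fp_upt: assumes "fp n" shows "fp (\<lambda>x. [0..<n x])"
proof -
  have e: "((\<lambda>l. length l # l) ^^ i) [] = rev [0..<i]" for i
    by (induction i) auto
  have "fp (\<lambda>x. ((\<lambda>l. length l # l) ^^ n x) [])"
  proof (rule fp_funpow)
    show "poly_bounded (\<lambda>x. sz (n x) * (sz (n x) + 1) + 1)" by (intro poly_bounded_intros fp_size assms)
    fix x i assume i: "i \<le> n x"
    have "sz (rev [0..<i]) \<le> length (rev [0..<i]) * (sz (n x) + 1) + 1"
      by (rule sz_list_le) (use i in \<open>auto simp: sz_nat\<close>)
    also have "\<dots> \<le> sz (n x) * (sz (n x) + 1) + 1" using i by (intro add_mono mult_right_mono) (auto simp: sz_nat)
    finally show "sz (((\<lambda>l. length l # l) ^^ i) []) \<le> sz (n x) * (sz (n x) + 1) + 1" unfolding e .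
  qed (intro fp_basic fp_length assms)+
  from fp_rev[OF this] show ?thesis unfolding e by simp
qed

section \<open>Bounded search trees\<close>

primrec search :: "('s \<Rightarrow> bool) \<Rightarrow> ('s \<Rightarrow> 's list) \<Rightarrow> nat \<Rightarrow> 's \<Rightarrow> bool" where
  "search D M 0 s = D s"
| "search D M (Suc n) s = (D s \<or> (\<exists>s'\<in>set (M s). search D M n s'))"

text \<open>States never grow, so the work per node is polynomial in the size of the root;
  \<open>(c + 2) ^ n\<close> bounds the number of nodes of a tree of degree \<open>c\<close> and
  depth \<open>n\<close>.\<close>

lemma search_program:
  fixes D :: "'s::encodable \<Rightarrow> bool" and M :: "'s \<Rightarrow> 's list" and pre :: "'a::encodable \<Rightarrow> nat \<times> 's"
  assumes D: "fp D" and M: "fp M" and pre: "fp pre" and len: "\<And>s. length (M s) \<le> c"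
    and small: "\<And>s s'. s' \<in> set (M s) \<Longrightarrow> sz s' \<le> sz s"
  shows "\<exists>Z V. Z \<noteq> [] \<and> poly_bounded V \<and> (\<forall>x. evalb Z [venc x] (Z ! 0)
    (venc (search D M (fst (pre x)) (snd (pre x)))) ((c + 2) ^ fst (pre x) * V x))"
proof -
  obtain P T where P: "P \<noteq> []" "poly_bounded T" "poly_bounded (\<lambda>x. sz (D x))" "\<forall>x. evalb P [venc x] (P ! 0) (venc (D x)) (T x)"
    by (rule fpE[OF D])
  obtain Q S where Q: "Q \<noteq> []" "poly_bounded S" "poly_bounded (\<lambda>x. sz (M x))" "\<forall>x. evalb Q [venc x] (Q ! 0) (venc (M x)) (S x)"
    by (rule fpE[OF M])
  obtain R U where R: "R \<noteq> []" "poly_bounded U" "poly_bounded (\<lambda>x. sz (pre x))" "\<forall>x. evalb R [venc x] (R ! 0) (venc (pre x)) (U x)"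
    by (rule fpE[OF pre])
  let ?T = "ENode ELeaf ELeaf"
  \<comment> \<open>\<open>m\<close> prepares the input, \<open>e\<close> searches from one state,
    and \<open>l\<close> tries a list of successors; \<open>e\<close> and \<open>l\<close> call each
    other.\<close>
  define m where "m = ECall 1 (ECall (3 + length P + length Q) (EVar 0))"
  define e where "e = EIf (ECall 3 (ERight (EVar 0))) ?T
    (EIf (ELeft (EVar 0)) (ECall 2 (ENode (ERight (ELeft (EVar 0))) (ECall (3 + length P) (ERight (EVar 0))))) ELeaf)"
  define l where "l = ELet (ERight (EVar 0)) (EIf (EVar 0)
     (EIf (ECall 1 (ENode (ELeft (EVar 1)) (ELeft (EVar 0)))) ?T (ECall 2 (ENode (ELeft (EVar 1)) (ERight (EVar 0))))) ELeaf)"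
  define Z where "Z = [m, e, l] @ map (shift 3) P @ map (shift (3 + length P)) Q @ map (shift (3 + length P + length Q)) R"
  have 1: "computes Z 3 D T" by (rule computes_link[OF P(1,4), of _ "[m, e, l]"]) (auto simp: Z_def)
  have 2: "computes Z (3 + length P) M S"
    by (rule computes_link[OF Q(1,4), of _ "[m, e, l] @ map (shift 3) P"]) (auto simp: Z_def)
  have 3: "computes Z (3 + length P + length Q) pre U"
    by (rule computes_link[OF R(1,4), of _ "[m, e, l] @ map (shift 3) P @ map (shift (3 + length P)) Q" _ "[]"]) (auto simp: Z_def)
  have Z: "0 < length Z" "1 < length Z" "2 < length Z" "Z ! 0 = m" "Z ! 1 = e" "Z ! 2 = l" unfolding Z_def by auto
  have tru: "evalb Z env ?T (venc True) 3" for env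
    unfolding venc_bool_simps by (rule evalb_mono[OF evalb_Node[OF evalb_Leaf evalb_Leaf]]) simp
  have fls: "evalb Z env ELeaf (venc False) 1" for env
    using evalb_Leaf by simp
  have loop: "evalb Z [Node (venc n) (venc ss)] l (venc (\<exists>s\<in>set ss. search D M n s)) (length ss * (X + 20) + 10)"
    if "\<forall>s\<in>set ss. evalb Z [Node (venc n) (venc s)] e (venc (search D M n s)) X" for n ss X
    using that
  proof (induction ss)
    case Nil
    let ?v = "Node (venc n) (venc ([]::'s list))"
    have v: "evalb Z [?v] (EVar 0) ?v 1" "evalb Z [Leaf, ?v] (EVar 0) Leaf 1" by (rule evalb_Var; simp)+
    have "evalb Z [?v] (ERight (EVar 0)) Leaf (1 + 1)" by (rule evalb_Right[OF v(1)]) simp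
    from evalb_mono[OF evalb_Let[OF this evalb_IfF[OF v(2) fls]]] show ?case unfolding l_def by simp
  next
    case (Cons s ss)
    let ?v = "Node (venc n) (venc (s # ss))"
    let ?w = "venc (s # ss)"
    have v: "evalb Z [?v] (EVar 0) ?v 1" "evalb Z [?w, ?v] (EVar 0) ?w 1" "evalb Z [?w, ?v] (EVar 1) ?v 1"
      by (rule evalb_Var; simp)+
    have r: "evalb Z [?v] (ERight (EVar 0)) ?w (1 + 1)" by (rule evalb_Right[OF v(1)]) simp
    have n: "evalb Z [?w, ?v] (ELeft (EVar 1)) (venc n) (1 + 1)" by (rule evalb_Left[OF v(3)]) simp
    have s: "evalb Z [?w, ?v] (ELeft (EVar 0)) (venc s) (1 + 1)" by (rule evalb_Left[OF v(2)]) simp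
    have ss: "evalb Z [?w, ?v] (ERight (EVar 0)) (venc ss) (1 + 1)" by (rule evalb_Right[OF v(2)]) simp
    have "evalb Z [Node (venc n) (venc s)] (Z ! 1) (venc (search D M n s)) X" using Cons.prems Z by simp
    note call = evalb_Call[OF evalb_Node[OF n s] Z(2) this]
    have "evalb Z [Node (venc n) (venc ss)] (Z ! 2) (venc (\<exists>s\<in>set ss. search D M n s)) (length ss * (X + 20) + 10)"
      using Cons Z by simp
    note rest = evalb_Call[OF evalb_Node[OF n ss] Z(3) this]
    have "evalb Z [?w, ?v] (EIf (ECall 1 (ENode (ELeft (EVar 1)) (ELeft (EVar 0)))) ?T (ECall 2 (ENode (ELeft (EVar 1)) (ERight (EVar 0)))))
       (venc (\<exists>s\<in>set (s # ss). search D M n s)) (length ss * (X + 20) + 10 + X + 15)"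
    proof (cases "search D M n s")
      case True
      then have "venc (search D M n s) \<noteq> Leaf" by simp
      from evalb_mono[OF evalb_IfT[OF call this tru]] show ?thesis using True by simp
    next
      case False
      then have f: "venc (search D M n s) = Leaf" by simp
      from evalb_mono[OF evalb_IfF[OF call[unfolded f] rest]] show ?thesis using False by simp
    qed
    from evalb_mono[OF evalb_Let[OF r evalb_IfT[OF v(2) _ this]]] show ?case unfolding l_def by simp
  qed
  have main: "evalb Z [venc (n, s)] e (venc (search D M n s)) ((c + 2) ^ n * (a + 20 * c + 60))"
    if "\<forall>s. sz s \<le> N \<longrightarrow> T s + S s \<le> a" "sz s \<le> N" for n s N a
    using that(2)
  proof (induction n arbitrary: s)
    case 0
    let ?v = "venc (0::nat, s)"
    have v: "evalb Z [?v] (EVar 0) ?v 1" by (rule evalb_Var; simp)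
    have s: "evalb Z [?v] (ERight (EVar 0)) (venc s) (1 + 1)" by (rule evalb_Right[OF v]) simp
    have n: "evalb Z [?v] (ELeft (EVar 0)) Leaf (1 + 1)" by (rule evalb_Left[OF v]) simp
    note d = computes_call[OF 1 s refl]
    have "T s \<le> a" using that(1) 0 by fastforce
    show ?case
    proof (cases "D s")
      case True
      then have "venc (D s) \<noteq> Leaf" by simp
      from evalb_mono[OF evalb_IfT[OF d this tru]] show ?thesis using True \<open>T s \<le> a\<close> unfolding e_def by simp
    next
      case False
      then have f: "venc (D s) = Leaf" by simp
      from evalb_mono[OF evalb_IfF[OF d[unfolded f] evalb_IfF[OF n fls]]]
      show ?thesis using False \<open>T s \<le> a\<close> unfolding e_def by simp
    qed
  next
    case (Suc n)
    let ?v = "venc (Suc n, s)"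
    let ?X = "(c + 2) ^ n * (a + 20 * c + 60)"
    have v: "evalb Z [?v] (EVar 0) ?v 1" by (rule evalb_Var; simp)
    have s: "evalb Z [?v] (ERight (EVar 0)) (venc s) (1 + 1)" by (rule evalb_Right[OF v]) simp
    have n: "evalb Z [?v] (ELeft (EVar 0)) (venc (Suc n)) (1 + 1)" by (rule evalb_Left[OF v]) simp
    have n': "evalb Z [?v] (ERight (ELeft (EVar 0))) (venc n) (1 + 1 + 1)" by (rule evalb_Right[OF n]) simp
    note d = computes_call[OF 1 s refl] and mv = computes_call[OF 2 s refl]
    have Ta: "T s + S s \<le> a" using that(1) Suc.prems by fastforce
    have "\<forall>s'\<in>set (M s). evalb Z [Node (venc n) (venc s')] e (venc (search D M n s')) ?X"
      using Suc.IH small[of _ s] Suc.prems by fastforce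
    from loop[OF this] have "evalb Z [Node (venc n) (venc (M s))] (Z ! 2) (venc (\<exists>s\<in>set (M s). search D M n s)) (length (M s) * (?X + 20) + 10)"
      using Z by simp
    note rest = evalb_Call[OF evalb_Node[OF n' mv] Z(3) this]
    \<comment> \<open>One copy of \<open>?X\<close> beyond the at most \<open>c\<close> recursive
      calls pays for \<open>T s + S s\<close>, the overhead of 20 per successor and the
      constants.\<close>
    have "length (M s) * (?X + 20) \<le> c * (?X + 20)" using len[of s] by (intro mult_right_mono) auto
    moreover have "a + 20 * c + 60 \<le> ?X" by simp
    ultimately have bnd: "T s + S s + length (M s) * (?X + 20) + 50 \<le> (c + 1) * ?X"
      using Ta by (simp add: algebra_simps)
    also have "\<dots> \<le> (c + 2) * ?X" by (intro mult_right_mono) auto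
    also have "\<dots> = (c + 2) ^ Suc n * (a + 20 * c + 60)" unfolding power_Suc by (simp only: mult.assoc)
    finally have bnd: "T s + S s + length (M s) * (?X + 20) + 50 \<le> (c + 2) ^ Suc n * (a + 20 * c + 60)" .
    show ?case
    proof (cases "D s")
      case True
      then have "venc (D s) \<noteq> Leaf" by simp
      have "1 + 1 + T s + 1 + 3 + 1 \<le> (c + 2) ^ Suc n * (a + 20 * c + 60)" using bnd by linarith
      from evalb_mono[OF evalb_IfT[OF d \<open>venc (D s) \<noteq> Leaf\<close> tru] this]
      show ?thesis using True unfolding e_def by simp
    next
      case False
      then have f: "venc (D s) = Leaf" by simp
      have nl: "venc (Suc n) \<noteq> Leaf" by simp
      have "1 + 1 + T s + 1 + (1 + 1 + (1 + 1 + 1 + (1 + 1 + S s + 1) + 1 + (length (M s) * (?X + 20) + 10) + 1) + 1) + 1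
         \<le> (c + 2) ^ Suc n * (a + 20 * c + 60)" using bnd by linarith
      from evalb_mono[OF evalb_IfF[OF d[unfolded f] evalb_IfT[OF n nl rest]] this]
      have "evalb Z [?v] e (venc (\<exists>s\<in>set (M s). search D M n s)) ((c + 2) ^ Suc n * (a + 20 * c + 60))"
        unfolding e_def .
      then show ?thesis using False by simp
    qed
  qed
  have "poly_bounded (\<lambda>s. T s + S s)" by (intro poly_bounded_add P(2) Q(2))
  then obtain k where k: "\<forall>s. T s + S s \<le> (sz s + 1) ^ k" unfolding poly_bounded_def by (rule exE)
  define V where "V x = U x + ((sz (pre x) + 1) ^ k + 20 * c + 60) + 10" for x
  have "evalb Z [venc x] (Z ! 0) (venc (search D M (fst (pre x)) (snd (pre x)))) ((c + 2) ^ fst (pre x) * V x)" for x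
  proof -
    have v: "evalb Z [venc x] (EVar 0) (venc x) 1" by (rule evalb_Var) auto
    have "T s + S s \<le> (sz (pre x) + 1) ^ k" if "sz s \<le> sz (snd (pre x))" for s
    proof -
      have "(sz s + 1) ^ k \<le> (sz (pre x) + 1) ^ k" using that sz_prod[of "pre x"] by (intro power_mono) auto
      then show ?thesis using k order_trans by blast
    qed
    then have "evalb Z [venc (fst (pre x), snd (pre x))] e (venc (search D M (fst (pre x)) (snd (pre x))))
      ((c + 2) ^ fst (pre x) * ((sz (pre x) + 1) ^ k + 20 * c + 60))"
      by (intro main[of "sz (snd (pre x))"]) auto
    then have "evalb Z [venc (pre x)] (Z ! 1) (venc (search D M (fst (pre x)) (snd (pre x))))
      ((c + 2) ^ fst (pre x) * ((sz (pre x) + 1) ^ k + 20 * c + 60))" using Z by simp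
    from evalb_Call[OF computes_call[OF 3 v refl] Z(2) this]
    have "evalb Z [venc x] (Z ! 0) (venc (search D M (fst (pre x)) (snd (pre x))))
      (1 + U x + 1 + (c + 2) ^ fst (pre x) * ((sz (pre x) + 1) ^ k + 20 * c + 60) + 1)"
      unfolding Z(4) m_def .
    moreover have "1 * (U x + 10) \<le> (c + 2) ^ fst (pre x) * (U x + 10)" by (intro mult_right_mono) auto
    ultimately show ?thesis
      unfolding V_def by (elim evalb_mono) (simp add: algebra_simps)
  qed
  moreover have "poly_bounded V" unfolding V_def[abs_def] by (intro poly_bounded_intros R(2,3))
  ultimately show ?thesis using Z(1) by (intro exI[of _ Z] exI[of _ V]) auto
qed

section \<open>Reading the parameter\<close>

fun bits :: "nat \<Rightarrow> bool list" where
  "bits n = (if n = 0 then [] else odd n # bits (n div 2))"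

declare bits.simps [simp del]

lemma venc_bits: "venc (bits n) = enc_nat n"
proof (induction n rule: bits.induct)
  case (1 n)
  then show ?case by (subst bits.simps, subst enc_nat.simps) (simp add: venc_bool_def)
qed

text \<open>
  The parameter is given in binary and may be exponential in the input size; it is cut off at the number of vertices
  before it is converted to unary.
\<close>
definition capped :: "nat \<Rightarrow> bool list \<Rightarrow> nat" where
  "capped m bs = fold (\<lambda>b k. if m \<le> k + k + (if b then 1 else 0) then m else k + k + (if b then 1 else 0)) (rev bs) 0"

lemma capped_le: "capped m bs \<le> m"
  unfolding capped_def by (induction bs) auto

text \<open>Once the cap is reached, doubling does not leave it, so cutting off after each step of
  Horner's rule equals cutting off at the end.\<close>

lemma capped_bits: "capped m (bits n) = min m n"
proof (induction n rule: bits.induct)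
  case (1 n)
  show ?case
  proof (cases "n = 0")
    case True
    then show ?thesis by (simp add: bits.simps capped_def)
  next
    case False
    have "capped m (bits n) = (let k = capped m (bits (n div 2)) in
      if m \<le> k + k + (if odd n then 1 else 0) then m else k + k + (if odd n then 1 else 0))"
      using False unfolding capped_def by (subst bits.simps) (simp add: Let_def)
    then show ?thesis using 1 False by (auto simp: Let_def min_def elim!: oddE)
  qed
qed

lemma fp_capped: assumes "fp m" "fp bs" shows "fp (\<lambda>x. capped (m x) (bs x))"
  unfolding capped_def
proof (rule fp_fold)
  show "poly_bounded (\<lambda>x. sz (m x))" by (rule fp_size[OF assms(1)])
  show "sz (fold (\<lambda>b k. if m x \<le> k + k + (if b then 1 else 0) then m x else k + k + (if b then 1 else 0))
           (take i (rev (bs x))) 0) \<le> sz (m x)" for x i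
    using capped_le[of "m x" "rev (take i (rev (bs x)))"] unfolding capped_def by (simp add: sz_nat)
  show "fp (\<lambda>z. if m (fst z) \<le> snd (snd z) + snd (snd z) + (if fst (snd z) then 1 else 0) then m (fst z)
     else snd (snd z) + snd (snd z) + (if fst (snd z) then 1 else 0))"
    by (intro fp_if fp_le fp_add fp_basic fp_comp[OF assms(1)])
qed (intro fp_rev fp_basic assms)+

section \<open>The branching algorithm\<close>

context bipartite begin

section \<open>Solutions, components and safe moves\<close>

definition solvable :: "'a set \<Rightarrow> nat \<Rightarrow> bool" where
  "solvable X d \<longleftrightarrow> (\<exists>S\<subseteq>X. card S \<le> d \<and> \<not> has_AT (X - S))"

definition component :: "'a set \<Rightarrow> 'a \<Rightarrow> 'a set" where "component X v = {u. reach X v u}"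

text \<open>Every component that still has an asteroidal triple contributes candidates, so a
  smallest one may be taken over all of them.\<close>

definition component_cut :: "'a set \<Rightarrow> 'a set \<Rightarrow> bool" where
  "component_cut X Q \<longleftrightarrow> (\<exists>v\<in>X. has_AT (component X v) \<and> \<not> has_AT (component X v - Q) \<and>
     (\<exists>x\<in>component X v. \<exists>x'\<in>component X v. \<exists>y\<in>component X v. \<exists>y'\<in>component X v. Q = shared (component X v) x x' y y'))"

lemma solvable_0: "finite X \<Longrightarrow> solvable X 0 \<longleftrightarrow> \<not> has_AT X"
  unfolding solvable_def by (auto dest: finite_subset)

lemma solvable_trivial: "\<not> has_AT X \<Longrightarrow> solvable X d"
  unfolding solvable_def by (intro exI[of _ "{}"]) auto

lemma solvable_delete:
  assumes "finite X" "Q \<subseteq> X" "card Q \<le> d" "solvable (X - Q) (d - card Q)"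
  shows "solvable X d"
proof -
  obtain S where S: "S \<subseteq> X - Q" "card S \<le> d - card Q" "\<not> has_AT (X - Q - S)"
    using assms(4) unfolding solvable_def by blast
  have "card (Q \<union> S) \<le> card Q + card S" by (rule card_Un_le)
  then have "card (Q \<union> S) \<le> d" using S(2) assms(3) by linarith
  moreover have "X - (Q \<union> S) = X - Q - S" by blast
  ultimately show ?thesis using S assms(2) unfolding solvable_def by (intro exI[of _ "Q \<union> S"]) auto
qed

text \<open>Every solution has to delete a vertex of \<open>W\<close>.\<close>

lemma branch_small:
  assumes X: "finite X" and W: "W \<subseteq> X" "has_AT W"
  shows "solvable X d \<longleftrightarrow> (\<exists>w\<in>W. 1 \<le> d \<and> solvable (X - {w}) (d - 1))"
proof
  assume "solvable X d"
  then obtain S where S: "S \<subseteq> X" "card S \<le> d" "\<not> has_AT (X - S)" unfolding solvable_def by blast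
  have finS: "finite S" using S X finite_subset by blast
  obtain w where w: "w \<in> W" "w \<in> S" using W S(3) has_AT_mono[OF W(2), of "X - S"] by blast
  have "card (S - {w}) = card S - 1" "card S \<ge> 1" using w finS card_gt_0_iff[of S] by auto
  moreover have "X - {w} - (S - {w}) = X - S" using w by blast
  ultimately have "solvable (X - {w}) (d - 1)" "1 \<le> d"
    using S unfolding solvable_def by (auto intro!: exI[of _ "S - {w}"])
  then show "\<exists>w\<in>W. 1 \<le> d \<and> solvable (X - {w}) (d - 1)" using w by blast
next
  assume "\<exists>w\<in>W. 1 \<le> d \<and> solvable (X - {w}) (d - 1)"
  then show "solvable X d" using solvable_delete[OF X, of "{_}"] W by fastforce
qed

lemma component_sub: "component X v \<subseteq> X"
  unfolding component_def using reach_in by blast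

lemma component_step: "a \<in> component X v \<Longrightarrow> b \<in> X \<Longrightarrow> adj a b \<Longrightarrow> b \<in> component X v"
  unfolding component_def using reach_adj reach_refl by blast

lemma component_conn:
  assumes "a \<in> component X v" "b \<in> component X v"
  shows "reach (component X v) a b"
proof -
  have "reach X a b" using assms reach_trans reach_sym unfolding component_def by blast
  then obtain n where "walk X n a b" unfolding reach_def by blast
  then have "walk (X \<inter> component X v) n a b" by (rule walk_closed[OF _ assms(1) component_step])
  then show ?thesis using reachI walk_mono inf_le2 by metis
qed

text \<open>Walks cannot leave a set that is closed under adjacency, so the whole triple lies where
  \<open>a\<close> lies.\<close>

lemma AT_closed:
  assumes A: "AT X a b c i j k" and aK: "a \<in> K" and cl: "\<And>u v. u \<in> K \<Longrightarrow> v \<in> X \<Longrightarrow> adj u v \<Longrightarrow> v \<in> K"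
  shows "has_AT (X \<inter> K)"
proof -
  note A' = A[unfolded AT_def]
  have st: "walk (Y \<inter> K) n u v" if "walk Y n u v" "u \<in> K" "Y \<subseteq> X" for Y n u v
    using walk_closed[OF that(1,2)] cl that(3) by blast
  have 1: "walk ((X - nb c) \<inter> K) i a b" using st[of "X - nb c" i a b] A' aK by blast
  then have bK: "b \<in> K" using walk_in by blast
  have 2: "walk ((X - nb a) \<inter> K) j b c" using st[of "X - nb a" j b c] A' bK by blast
  then have cK: "c \<in> K" using walk_in by blast
  have 3: "walk ((X - nb b) \<inter> K) k c a" using st[of "X - nb b" k c a] A' cK by blast
  have e: "(X - nb z) \<inter> K = X \<inter> K - nb z" for z by blast
  have "AT (X \<inter> K) a b c i j k" using 1 2 3 A' unfolding e by (intro ATI) auto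
  then show ?thesis unfolding has_AT_def by blast
qed

lemma has_AT_component:
  assumes "has_AT X"
  shows "\<exists>v\<in>X. has_AT (component X v)"
proof -
  obtain a b c i j k where A: "AT X a b c i j k" using assms unfolding has_AT_def by blast
  then have aX: "a \<in> X" unfolding AT_def by blast
  have "a \<in> component X a" unfolding component_def using reach_refl[OF aX] by simp
  have "has_AT (X \<inter> component X a)"
    by (rule AT_closed[OF A \<open>a \<in> component X a\<close>]) (rule component_step)
  then show ?thesis using aX has_AT_mono[of "X \<inter> component X a" "component X a"] by blast
qed

lemma component_cut_sub: "component_cut X Q \<Longrightarrow> Q \<subseteq> X"
  unfolding component_cut_def shared_def using component_sub by blast

lemma component_cut_nonempty: "component_cut X Q \<Longrightarrow> Q \<noteq> {}"
  unfolding component_cut_def by auto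

text \<open>The form of \<open>small_cut\<close> for the exchange argument: whatever resolves a
  component contains a candidate of that component.\<close>

lemma comp_cut:
  assumes X: "finite X" and g: "good B X" and B: "B \<ge> 1000" and v: "v \<in> X" "has_AT (component X v)"
    and S: "\<not> has_AT (component X v - S)"
  shows "\<exists>Q. component_cut X Q \<and> Q \<subseteq> S \<inter> component X v"
proof -
  have "component X v - S \<inter> component X v = component X v - S" by blast
  with small_cut[OF finite_subset[OF component_sub X] good_mono[OF g component_sub] B component_conn v(2), of "S \<inter> component X v"] S
  obtain x x' y y' where "x \<in> component X v" "x' \<in> component X v" "y \<in> component X v" "y' \<in> component X v"
    "shared (component X v) x x' y y' \<subseteq> S \<inter> component X v" "\<not> has_AT (component X v - shared (component X v) x x' y y')"
    by auto
  then show ?thesis using v unfolding component_cut_def by blast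
qed

lemma component_cut_exists:
  assumes X: "finite X" and g: "good B X" and B: "B \<ge> 1000" and AT: "has_AT X"
  shows "\<exists>Q. component_cut X Q"
proof -
  obtain v where v: "v \<in> X" "has_AT (component X v)" using has_AT_component[OF AT] by blast
  \<comment> \<open>Deleting the whole component resolves it, so it contains a candidate.\<close>
  have "\<not> has_AT (component X v - component X v)" unfolding has_AT_def AT_def by simp
  from comp_cut[OF X g B v this] show ?thesis by blast
qed

text \<open>An exchange argument: in the component of \<open>Q\<close> a solution contains a
  candidate, so it spends at least \<open>card Q\<close> there. Exchanging that part for
  \<open>Q\<close> costs no more and has no effect on other components.\<close>

lemma branch_cut:
  assumes X: "finite X" and g: "good B X" and B: "B \<ge> 1000" and Q: "component_cut X Q"
    and min: "\<And>Q'. component_cut X Q' \<Longrightarrow> card Q \<le> card Q'"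
  shows "solvable X d \<longleftrightarrow> card Q \<le> d \<and> solvable (X - Q) (d - card Q)"
proof
  assume "solvable X d"
  then obtain S where S: "S \<subseteq> X" "card S \<le> d" "\<not> has_AT (X - S)" unfolding solvable_def by blast
  have finS: "finite S" using S X finite_subset by blast
  obtain v where v: "v \<in> X" "has_AT (component X v)" "\<not> has_AT (component X v - Q)" and QK: "Q \<subseteq> component X v"
    using Q unfolding component_cut_def shared_def by blast
  let ?K = "component X v"
  have "\<not> has_AT (?K - S)" using S(3) has_AT_mono[of "?K - S" "X - S"] component_sub[of X v] by blast
  from comp_cut[OF X g B v(1,2) this] obtain Q' where Q': "component_cut X Q'" "Q' \<subseteq> S \<inter> ?K" by blast
  have "card Q \<le> card Q'" by (rule min[OF Q'(1)])
  also have "\<dots> \<le> card (S \<inter> ?K)" using Q'(2) finS by (intro card_mono) auto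
  finally have c: "card Q \<le> card (S \<inter> ?K)" .
  have cS: "card S = card (S \<inter> ?K) + card (S - ?K)"
    using card_Int_Diff[OF finS] by simp
  \<comment> \<open>A triple lies inside the component, where \<open>Q\<close> destroys it, or
    outside, where \<open>S - ?K\<close> deletes the same as \<open>S\<close>.\<close>
  have "\<not> has_AT (X - Q - (S - ?K))"
  proof
    assume "has_AT (X - Q - (S - ?K))"
    then obtain a b c i j k where A: "AT (X - Q - (S - ?K)) a b c i j k" unfolding has_AT_def by blast
    show False
    proof (cases "a \<in> ?K")
      case True
      have "has_AT ((X - Q - (S - ?K)) \<inter> ?K)"
        by (rule AT_closed[OF A True]) (use component_step in blast)
      then show False using v(3) has_AT_mono[of _ "?K - Q"] by blast
    next
      case False
      have "has_AT ((X - Q - (S - ?K)) \<inter> (X - ?K))"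
      proof (rule AT_closed[OF A])
        show "a \<in> X - ?K" using False A unfolding AT_def by blast
        show "w \<in> X - ?K" if "u \<in> X - ?K" "w \<in> X - Q - (S - ?K)" "adj u w" for u w
          using that component_step[of w X v u] adj_sym by blast
      qed
      then show False using S(3) has_AT_mono[of "(X - Q - (S - ?K)) \<inter> (X - ?K)" "X - S"] by blast
    qed
  qed
  moreover have "card (S - ?K) \<le> d - card Q" using c cS S(2) by linarith
  moreover have "S - ?K \<subseteq> X - Q" using S(1) QK by blast
  ultimately have "solvable (X - Q) (d - card Q)" unfolding solvable_def by blast
  moreover have "card Q \<le> d" using c cS S(2) by linarith
  ultimately show "card Q \<le> d \<and> solvable (X - Q) (d - card Q)" by blast
next
  assume "card Q \<le> d \<and> solvable (X - Q) (d - card Q)"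
  then show "solvable X d" using solvable_delete[OF X component_cut_sub[OF Q]] by blast
qed

lemma walk_list: "walk Y n a b \<Longrightarrow> \<exists>l. length l = Suc n \<and> set l \<subseteq> Y \<and> walk (set l) n a b"
proof (induction rule: walk.induct)
  case (walk0 u)
  then show ?case by (intro exI[of _ "[u]"]) auto
next
  case (walkS u w n v)
  then obtain l where l: "length l = Suc n" "set l \<subseteq> Y" "walk (set l) n w v" by blast
  have "walk (set (u # l)) (Suc n) u v"
    using l(3) walkS(2) by (intro walk.walkS[of u _ w]) (auto intro: walk_mono)
  then show ?case using l walkS(1) by (intro exI[of _ "u # l"]) auto
qed

text \<open>The vertices of the three short walks carry the triple on their own.\<close>

lemma not_good_small:
  assumes "\<not> good B X"
  shows "\<exists>W. length W \<le> 3 * (B + 1) \<and> set W \<subseteq> X \<and> has_AT (set W)"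
proof -
  obtain a b c i j k where A: "AT X a b c i j k" and B: "i \<le> B" "j \<le> B" "k \<le> B"
    using assms unfolding good_def by blast
  note A' = A[unfolded AT_def]
  obtain l1 where l1: "length l1 = Suc i" "set l1 \<subseteq> X - nb c" "walk (set l1) i a b" using walk_list A' by metis
  obtain l2 where l2: "length l2 = Suc j" "set l2 \<subseteq> X - nb a" "walk (set l2) j b c" using walk_list A' by metis
  obtain l3 where l3: "length l3 = Suc k" "set l3 \<subseteq> X - nb b" "walk (set l3) k c a" using walk_list A' by metis
  let ?W = "l1 @ l2 @ l3"
  have "AT (set ?W) a b c i j k"
  proof (rule ATI)
    show "walk (set ?W - nb c) i a b" by (rule walk_mono[OF l1(3)]) (use l1(2) in auto)
    show "walk (set ?W - nb a) j b c" by (rule walk_mono[OF l2(3)]) (use l2(2) in auto)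
    show "walk (set ?W - nb b) k c a" by (rule walk_mono[OF l3(3)]) (use l3(2) in auto)
  qed (use A' in auto)
  then have "has_AT (set ?W)" unfolding has_AT_def by blast
  moreover have "length ?W \<le> 3 * (B + 1)" using l1(1) l2(1) l3(1) B by simp
  moreover have "set ?W \<subseteq> X" using l1(2) l2(2) l3(2) by auto
  ultimately show ?thesis by blast
qed

text \<open>A shortest walk does not repeat a vertex. This bounds the rounds of the search in
  \<open>reached\<close>.\<close>

lemma walk_short:
  assumes fin: "finite Y" and r: "reach Y a b"
  shows "\<exists>n < card Y. walk Y n a b"
proof -
  define n where "n = (LEAST n. walk Y n a b)"
  have w: "walk Y n a b" using r unfolding reach_def n_def by (rule LeastI_ex)
  have min: "\<not> walk Y m a b" if "m < n" for m using not_less_Least that unfolding n_def by blast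
  obtain p where p: "p 0 = a" "p n = b" "\<forall>i\<le>n. p i \<in> Y" "\<forall>i<n. adj (p i) (p (Suc i))"
    using walk_fun[OF w] by blast
  have "inj_on p {..n}"
  proof (rule linorder_inj_onI)
    fix i j assume ij: "i < j" "i \<in> {..n}" "j \<in> {..n}"
    show "p i \<noteq> p j"
    proof
      assume e: "p i = p j"
      have 1: "walk Y (i - 0) (p 0) (p i)" by (rule fun_walk) (use p ij in auto)
      have 2: "walk Y (n - j) (p j) (p n)" by (rule fun_walk) (use p ij in auto)
      have "walk Y (i - 0 + (n - j)) (p 0) (p n)" by (rule walk_trans[OF 1]) (use 2 e in simp)
      moreover have "i - 0 + (n - j) < n" using ij by auto
      ultimately show False using min p by blast
    qed
  qed auto
  then have "card (p ` {..n}) = Suc n" by (simp add: card_image)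
  moreover have "card (p ` {..n}) \<le> card Y" using p(3) fin by (intro card_mono) auto
  ultimately show ?thesis using w by (intro exI[of _ n]) auto
qed

end

text \<open>\<open>(False, i)\<close> is row \<open>i\<close> and \<open>(True, j)\<close> is column \<open>j\<close>.\<close>
type_synonym vertex = "bool \<times> nat"

section \<open>The algorithm on lists\<close>

definition entry :: "bool list list \<Rightarrow> nat \<Rightarrow> nat \<Rightarrow> bool" where
  "entry M i j = lookup False (lookup [] M i) j"

definition edge :: "bool list list \<Rightarrow> vertex \<Rightarrow> vertex \<Rightarrow> bool" where
  "edge M u v = (\<not> (fst u = fst v) \<and> (if fst u then entry M (snd v) (snd u) else entry M (snd u) (snd v)))"

global_interpretation G: bipartite "edge M" fst for M :: "bool list list"
  by unfold_locales (auto simp: edge_def)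

text \<open>Equality of vertices is split into tests on bits and unary numbers, for which programs
  exist.\<close>

definition mem :: "vertex \<Rightarrow> vertex list \<Rightarrow> bool" where
  "mem v X = (\<exists>u\<in>set X. fst u = fst v \<and> snd u = snd v)"

lemma mem_iff [simp]: "mem v X \<longleftrightarrow> v \<in> set X"
  unfolding mem_def prod_eq_iff[symmetric] by blast

definition without :: "vertex list \<Rightarrow> vertex list \<Rightarrow> vertex list" where
  "without X Q = filter (\<lambda>v. \<not> mem v Q) X"

definition expand :: "bool list list \<Rightarrow> vertex list \<Rightarrow> vertex list \<Rightarrow> vertex list" where
  "expand M Y A = filter (\<lambda>v. mem v A \<or> (\<exists>u\<in>set A. edge M u v)) Y"

text \<open>Breadth-first search. A shortest walk has fewer than \<open>length Y\<close> edges, so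
  this number of rounds is enough.\<close>

definition reached :: "bool list list \<Rightarrow> vertex list \<Rightarrow> vertex \<Rightarrow> vertex list" where
  "reached M Y a = (expand M Y ^^ length Y) (filter (\<lambda>v. mem v [a]) Y)"

definition avoid :: "bool list list \<Rightarrow> vertex list \<Rightarrow> vertex \<Rightarrow> vertex list" where
  "avoid M X c = filter (\<lambda>v. \<not> edge M c v) X"

definition asteroid :: "bool list list \<Rightarrow> vertex list \<Rightarrow> vertex \<Rightarrow> vertex \<Rightarrow> vertex \<Rightarrow> bool" where
  "asteroid M X a b c = (\<not> mem a [b, c] \<and> \<not> mem b [c] \<and> fst a = fst b \<and> fst b = fst c \<and>
     mem b (reached M (avoid M X c) a) \<and> mem c (reached M (avoid M X a) b) \<and> mem a (reached M (avoid M X b) c))"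

definition bad :: "bool list list \<Rightarrow> vertex list \<Rightarrow> bool" where
  "bad M X = (\<exists>a\<in>set X. \<exists>b\<in>set X. \<exists>c\<in>set X. asteroid M X a b c)"

definition shared_list :: "bool list list \<Rightarrow> vertex list \<Rightarrow> vertex \<Rightarrow> vertex \<Rightarrow> vertex \<Rightarrow> vertex \<Rightarrow> vertex list" where
  "shared_list M K x x' y y' = filter (\<lambda>z. edge M z x \<and> edge M z x' \<or> edge M z y \<and> edge M z y') K"

definition shared_lists :: "bool list list \<Rightarrow> vertex list \<Rightarrow> vertex list list" where
  "shared_lists M K = concat (map (\<lambda>x. concat (map (\<lambda>x'. concat (map (\<lambda>y. map (\<lambda>y'.
     shared_list M K x x' y y') K) K)) K)) K)"

definition component_cuts :: "bool list list \<Rightarrow> vertex list \<Rightarrow> vertex list list" where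
  "component_cuts M K = (if bad M K then filter (\<lambda>Q. \<not> bad M (without K Q)) (shared_lists M K) else [])"

definition cuts :: "bool list list \<Rightarrow> vertex list \<Rightarrow> vertex list list" where
  "cuts M X = concat (map (\<lambda>v. component_cuts M (reached M X v)) X)"

text \<open>At most one result: a smallest cut is a safe choice, so nothing is branched on in this
  case.\<close>

definition shortest :: "vertex list list \<Rightarrow> vertex list list" where
  "shortest Qs = (case Qs of [] \<Rightarrow> [] | Q # Qs' \<Rightarrow>
     [fold (\<lambda>Q best. if length Q \<le> length best then Q else best) Qs' Q])"

text \<open>All lists of length at most \<open>k\<close>; for constant \<open>k\<close> their number
  is polynomial.\<close>

primrec words :: "nat \<Rightarrow> vertex list \<Rightarrow> vertex list list" where
  "words 0 X = [[]]"
| "words (Suc k) X = [] # concat (map (\<lambda>x. map (\<lambda>w. x # w) (words k X)) X)"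

text \<open>The number of vertices of three walks of length 1000.\<close>
definition width :: nat where "width = 3 * (1000 + 1)"

text \<open>Each entry is what one child in the search tree deletes: a single vertex of a short
  triple, or an entire cut.\<close>

definition deletions :: "bool list list \<Rightarrow> vertex list \<Rightarrow> vertex list list" where
  "deletions M X = (case filter (\<lambda>W. bad M W) (words width X) of
     [] \<Rightarrow> shortest (cuts M X) | W # Ws \<Rightarrow> map (\<lambda>w. [w]) W)"

type_synonym state = "bool list list \<times> vertex list \<times> nat"

definition finished :: "state \<Rightarrow> bool" where
  "finished s = (\<not> bad (fst s) (fst (snd s)))"

definition moves :: "state \<Rightarrow> state list" where
  "moves s = map (\<lambda>D. (fst s, without (fst (snd s)) D, snd (snd s) - length D))
     (filter (\<lambda>D. length D \<le> snd (snd s)) (deletions (fst s) (fst (snd s))))"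

section \<open>The single steps of the algorithm take polynomial time\<close>

lemma sz_filter: "sz (filter P xs) \<le> sz xs"
  by (induction xs) auto

lemma fp_entry: "fp M \<Longrightarrow> fp i \<Longrightarrow> fp j \<Longrightarrow> fp (\<lambda>x. entry (M x) (i x) (j x))"
  unfolding entry_def by (intro fp_lookup fp_basic)

lemma fp_edge: "fp M \<Longrightarrow> fp u \<Longrightarrow> fp v \<Longrightarrow> fp (\<lambda>x. edge (M x) (u x) (v x))"
  unfolding edge_def by (intro fp_conj fp_not fp_bool_eq fp_entry fp_basic)

lemmas fp_logic = fp_conj fp_disj fp_not fp_bool_eq fp_nat_eq fp_le

lemma fp_mem: assumes "fp v" "fp X" shows "fp (\<lambda>x. mem (v x) (X x))"
  unfolding mem_def by (intro fp_bex fp_logic fp_basic fp_comp[OF assms(1)] assms(2))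

lemma fp_without: assumes "fp X" "fp Q" shows "fp (\<lambda>x. without (X x) (Q x))"
  unfolding without_def by (intro fp_filter fp_logic fp_mem fp_basic fp_comp[OF assms(2)] assms(1))

lemma fp_expand: assumes "fp M" "fp Y" "fp A" shows "fp (\<lambda>x. expand (M x) (Y x) (A x))"
  unfolding expand_def
  by (intro fp_filter fp_bex fp_logic fp_mem fp_edge fp_basic fp_comp[OF fp_comp[OF assms(1)]]
      fp_comp[OF assms(3)] assms(2))

lemma fp_reached: assumes "fp M" "fp Y" "fp a" shows "fp (\<lambda>x. reached (M x) (Y x) (a x))"
  unfolding reached_def
proof (rule fp_funpow)
  show "fp (\<lambda>z. expand (M (fst z)) (Y (fst z)) (snd z))"
    by (intro fp_expand fp_comp[OF assms(1)] fp_comp[OF assms(2)] fp_basic)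
  show "fp (\<lambda>x. filter (\<lambda>v. mem v [a x]) (Y x))"
    by (intro fp_filter fp_mem fp_basic fp_comp[OF assms(3)] assms(2))
  show "poly_bounded (\<lambda>x. sz (Y x))" by (rule fp_size[OF assms(2)])
  show "sz ((expand (M x) (Y x) ^^ i) (filter (\<lambda>v. mem v [a x]) (Y x))) \<le> sz (Y x)" for x i
    by (cases i) (auto simp: expand_def sz_filter simp del: mem_iff)
qed (intro fp_length assms(2))

lemma fp_avoid: assumes "fp M" "fp X" "fp c" shows "fp (\<lambda>x. avoid (M x) (X x) (c x))"
  unfolding avoid_def
  by (intro fp_filter fp_logic fp_edge fp_basic fp_comp[OF assms(1)] fp_comp[OF assms(3)] assms(2))

lemma fp_asteroid:
  assumes "fp M" "fp X" "fp a" "fp b" "fp c"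
  shows "fp (\<lambda>x. asteroid (M x) (X x) (a x) (b x) (c x))"
  unfolding asteroid_def by (intro fp_logic fp_mem fp_reached fp_avoid fp_basic assms)

lemma fp_bad0: "fp (\<lambda>z. bad (fst z) (snd z))"
  unfolding bad_def by (intro fp_bex fp_asteroid fp_basic)

lemma fp_bad: assumes "fp M" "fp X" shows "fp (\<lambda>x. bad (M x) (X x))"
  using fp_comp[OF fp_bad0 fp_pair[OF assms]] by simp

lemma fp_shared_list:
  assumes "fp M" "fp K" "fp x" "fp x'" "fp y" "fp y'"
  shows "fp (\<lambda>z. shared_list (M z) (K z) (x z) (x' z) (y z) (y' z))"
  unfolding shared_list_def
  by (intro fp_filter fp_logic fp_edge fp_basic fp_comp[OF assms(1)] fp_comp[OF assms(3)]
      fp_comp[OF assms(4)] fp_comp[OF assms(5)] fp_comp[OF assms(6)] assms(2))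

lemma fp_shared_lists0: "fp (\<lambda>z. shared_lists (fst z) (snd z))"
  unfolding shared_lists_def by (intro fp_concat fp_map fp_shared_list fp_basic)

lemma fp_component_cuts0: "fp (\<lambda>z. component_cuts (fst z) (snd z))"
  unfolding component_cuts_def by (intro fp_filter fp_logic fp_bad fp_without fp_shared_lists0 fp_basic)

lemma fp_component_cuts: assumes "fp M" "fp X" shows "fp (\<lambda>x. component_cuts (M x) (X x))"
  using fp_comp[OF fp_component_cuts0 fp_pair[OF assms]] by simp

lemma fp_cuts0: "fp (\<lambda>z. cuts (fst z) (snd z))"
  unfolding cuts_def by (intro fp_concat fp_map fp_component_cuts fp_reached fp_basic)

lemma fold_shorter_in:
  "fold (\<lambda>Q best. if length Q \<le> length best then Q else best) Qs Q \<in> insert Q (set Qs)"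
proof (induction Qs arbitrary: Q)
  case (Cons R Qs)
  show ?case using Cons[of "if length R \<le> length Q then R else Q"] by auto
qed simp

lemma fold_shorter_le:
  "R \<in> insert Q (set Qs) \<Longrightarrow> length (fold (\<lambda>Q best. if length Q \<le> length best then Q else best) Qs Q) \<le> length R"
proof (induction Qs arbitrary: Q R)
  case (Cons S Qs)
  let ?Q = "if length S \<le> length Q then S else Q"
  have "length ?Q \<le> length S" "length ?Q \<le> length Q" by auto
  moreover have "length (fold (\<lambda>Q best. if length Q \<le> length best then Q else best) Qs ?Q) \<le> length ?Q"
    using Cons.IH[of ?Q ?Q] by blast
  moreover have "length (fold (\<lambda>Q best. if length Q \<le> length best then Q else best) Qs ?Q) \<le> length R"
    if "R \<in> set Qs" using Cons.IH[of R ?Q] that by blast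
  ultimately show ?case using Cons.prems by (auto simp del: if_split_asm)
qed simp

lemma fp_shortest:
  fixes Qs :: "'a::encodable \<Rightarrow> vertex list list"
  assumes "fp Qs"
  shows "fp (\<lambda>x. shortest (Qs x))"
  unfolding shortest_def
proof (intro fp_case_list assms fp_basic)
  show "fp (\<lambda>x::'a \<times> vertex list \<times> vertex list list.
      fold (\<lambda>Q best. if length Q \<le> length best then Q else best) (snd (snd x)) (fst (snd x)))"
  proof (rule fp_fold)
    show "poly_bounded (\<lambda>x::'a \<times> vertex list \<times> vertex list list. sz (fst (snd x)) + sz (snd (snd x)))"
      by (intro poly_bounded_add fp_size fp_basic)
    fix x :: "'a \<times> vertex list \<times> vertex list list" and i
    let ?r = "fold (\<lambda>Q best. if length Q \<le> length best then Q else best) (take i (snd (snd x))) (fst (snd x))"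
    have "?r \<in> insert (fst (snd x)) (set (take i (snd (snd x))))" by (rule fold_shorter_in)
    then have "?r = fst (snd x) \<or> ?r \<in> set (snd (snd x))" by (meson in_set_takeD insertE)
    then show "sz ?r \<le> sz (fst (snd x)) + sz (snd (snd x))"
    proof
      assume "?r \<in> set (snd (snd x))"
      from sz_elem[OF this] show ?thesis by linarith
    qed simp
  qed (intro fp_logic fp_length fp_basic)+
qed

text \<open>Each \<open>k\<close> has its own program; the induction takes place outside the
  language, so the exponent may depend on \<open>k\<close>.\<close>

lemma fp_words0: "fp (words k)"
proof (induction k)
  case 0
  show ?case by (simp add: fp_const)
next
  case (Suc k)
  show ?case unfolding words.simps by (intro fp_concat fp_map fp_comp[OF Suc] fp_basic)
qed

lemma fp_deletions0: "fp (\<lambda>z. deletions (fst z) (snd z))"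
  unfolding deletions_def
  by (intro fp_case_list fp_filter fp_bad fp_shortest fp_cuts0 fp_map fp_basic fp_comp[OF fp_words0])

lemma fp_deletions: assumes "fp M" "fp X" shows "fp (\<lambda>x. deletions (M x) (X x))"
  using fp_comp[OF fp_deletions0 fp_pair[OF assms]] by simp

lemma fp_finished: "fp finished"
  unfolding finished_def[abs_def] by (intro fp_logic fp_bad fp_basic)

lemma fp_moves: "fp moves"
  unfolding moves_def[abs_def]
  by (intro fp_map fp_filter fp_logic fp_without fp_minus fp_length fp_deletions fp_basic)

section \<open>Correctness of the algorithm\<close>

lemma set_without [simp]: "set (without X Q) = set X - set Q"
  unfolding without_def by auto

lemma set_avoid [simp]: "set (avoid M X c) = set X - G.nb M c"
  unfolding avoid_def by auto

lemma expand_iterate: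
  "set ((expand M Y ^^ i) (filter (\<lambda>v. mem v [a]) Y)) = {v. \<exists>n\<le>i. G.walk M (set Y) n a v}"
proof (induction i)
  case 0
  show ?case by auto
next
  case (Suc i)
  have "v \<in> set (expand M Y ((expand M Y ^^ i) (filter (\<lambda>v. mem v [a]) Y))) \<longleftrightarrow>
    (\<exists>n\<le>Suc i. G.walk M (set Y) n a v)" for v
  proof
    assume "v \<in> set (expand M Y ((expand M Y ^^ i) (filter (\<lambda>v. mem v [a]) Y)))"
    then have v: "v \<in> set Y" "(\<exists>n\<le>i. G.walk M (set Y) n a v) \<or> (\<exists>u. (\<exists>n\<le>i. G.walk M (set Y) n a u) \<and> edge M u v)"
      using Suc unfolding expand_def by auto
    from v(2) show "\<exists>n\<le>Suc i. G.walk M (set Y) n a v"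
    proof
      assume "\<exists>n\<le>i. G.walk M (set Y) n a v"
      then show ?thesis using le_SucI by blast
    next
      assume "\<exists>u. (\<exists>n\<le>i. G.walk M (set Y) n a u) \<and> edge M u v"
      then obtain u n where "n \<le> i" "G.walk M (set Y) n a u" "edge M u v" by blast
      then show ?thesis using G.walk_snoc[of M "set Y" n a u v] v(1) by (intro exI[of _ "Suc n"]) auto
    qed
  next
    assume "\<exists>n\<le>Suc i. G.walk M (set Y) n a v"
    then obtain n where n: "n \<le> Suc i" "G.walk M (set Y) n a v" by blast
    have vY: "v \<in> set Y" using G.walk_in[OF n(2)] by simp
    show "v \<in> set (expand M Y ((expand M Y ^^ i) (filter (\<lambda>v. mem v [a]) Y)))"
    proof (cases "n \<le> i")
      case True
      then show ?thesis using n vY Suc unfolding expand_def by auto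
    next
      case False
      then have "n = i + 1" using n by simp
      then obtain u where u: "G.walk M (set Y) i a u" "G.walk M (set Y) 1 u v"
        using G.walk_split[of M "set Y" i 1 a v] n(2) by blast
      have "edge M u v" using u(2) by (auto elim: G.walkSE)
      have "u \<in> set ((expand M Y ^^ i) (filter (\<lambda>v. mem v [a]) Y))"
        unfolding Suc.IH using u(1) by blast
      with \<open>edge M u v\<close> vY show ?thesis unfolding expand_def[of M Y "(expand M Y ^^ i) _"] by auto
    qed
  qed
  then show ?case by auto
qed

lemma set_reached [simp]: "set (reached M Y a) = G.component M (set Y) a"
  unfolding reached_def expand_iterate G.component_def
proof (intro Collect_cong iffI)
  fix v assume "\<exists>n\<le>length Y. G.walk M (set Y) n a v"
  then show "G.reach M (set Y) a v" unfolding G.reach_def by blast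
next
  fix v assume "G.reach M (set Y) a v"
  from G.walk_short[OF _ this] obtain n where "n < card (set Y)" "G.walk M (set Y) n a v" by auto
  then show "\<exists>n\<le>length Y. G.walk M (set Y) n a v"
    using card_length[of Y] by (intro exI[of _ n]) auto
qed

lemma bad_iff [simp]: "bad M X \<longleftrightarrow> G.has_AT M (set X)"
proof
  assume "bad M X"
  then obtain a b c where abc: "asteroid M X a b c" unfolding bad_def by blast
  then have "\<exists>i. G.walk M (set X - G.nb M c) i a b" "\<exists>j. G.walk M (set X - G.nb M a) j b c"
    "\<exists>k. G.walk M (set X - G.nb M b) k c a"
    unfolding asteroid_def mem_iff set_reached set_avoid G.component_def G.reach_def mem_Collect_eq by simp_all
  then obtain i j k where "G.walk M (set X - G.nb M c) i a b" "G.walk M (set X - G.nb M a) j b c"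
    "G.walk M (set X - G.nb M b) k c a" by (elim exE)
  then have "G.AT M (set X) a b c i j k"
    using abc unfolding asteroid_def mem_iff by (intro G.ATI) auto
  then show "G.has_AT M (set X)" unfolding G.has_AT_def by (intro exI)
next
  assume "G.has_AT M (set X)"
  then obtain a b c i j k where A: "G.AT M (set X) a b c i j k" unfolding G.has_AT_def by blast
  then have "asteroid M X a b c"
    unfolding asteroid_def G.AT_def by (auto simp: G.component_def G.reach_def)
  then show "bad M X" using A unfolding bad_def G.AT_def by blast
qed

lemma set_shared_list: "set (shared_list M K x x' y y') = G.shared M (set K) x x' y y'"
  unfolding shared_list_def G.shared_def by auto

lemma set_cuts: "set ` set (cuts M X) = {Q. G.component_cut M (set X) Q}"
proof -
  have "Q \<in> set ` set (cuts M X) \<longleftrightarrow> G.component_cut M (set X) Q" for Q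
  proof
    assume "Q \<in> set ` set (cuts M X)"
    then obtain L where L: "Q = set L" "L \<in> set (cuts M X)" by blast
    then obtain v x x' y y' where v: "v \<in> set X" "G.has_AT M (G.component M (set X) v)"
      "\<not> G.has_AT M (G.component M (set X) v - set L)"
      "x \<in> G.component M (set X) v" "x' \<in> G.component M (set X) v" "y \<in> G.component M (set X) v"
      "y' \<in> G.component M (set X) v" "L = shared_list M (reached M X v) x x' y y'"
      unfolding cuts_def component_cuts_def shared_lists_def by (auto split: if_splits)
    have "set L = G.shared M (G.component M (set X) v) x x' y y'"
      unfolding v(8) set_shared_list by simp
    then show "G.component_cut M (set X) Q" using v(1-7) L(1) unfolding G.component_cut_def by blast
  next
    assume "G.component_cut M (set X) Q"
    then obtain v x x' y y' where v: "v \<in> set X" "G.has_AT M (G.component M (set X) v)"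
      "\<not> G.has_AT M (G.component M (set X) v - Q)"
      "x \<in> G.component M (set X) v" "x' \<in> G.component M (set X) v" "y \<in> G.component M (set X) v"
      "y' \<in> G.component M (set X) v" "Q = G.shared M (G.component M (set X) v) x x' y y'"
      unfolding G.component_cut_def by blast
    let ?L = "shared_list M (reached M X v) x x' y y'"
    have L: "set ?L = Q" unfolding set_shared_list v(8) by simp
    have "?L \<in> set (shared_lists M (reached M X v))" using v unfolding shared_lists_def by auto
    then have "?L \<in> set (component_cuts M (reached M X v))" using v L unfolding component_cuts_def by auto
    then have "?L \<in> set (cuts M X)" using v unfolding cuts_def by auto
    then show "Q \<in> set ` set (cuts M X)" using L by blast
  qed
  then show ?thesis by blast
qed

lemma distinct_filter_iterate: "distinct Y \<Longrightarrow> distinct (reached M Y a)"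
  unfolding reached_def by (cases "length Y") (auto simp: expand_def)

text \<open>The program compares lengths; distinctness makes them cardinalities.\<close>

lemma cuts_distinct:
  assumes "distinct X" "Q \<in> set (cuts M X)"
  shows "distinct Q"
proof -
  obtain v where "Q \<in> set (component_cuts M (reached M X v))"
    using assms(2) unfolding cuts_def by auto
  then have "Q \<in> set (shared_lists M (reached M X v))"
    unfolding component_cuts_def by (simp split: if_split_asm)
  then obtain x x' y y' where "Q = shared_list M (reached M X v) x x' y y'"
    unfolding shared_lists_def by auto
  then show ?thesis using distinct_filter_iterate[OF assms(1)] unfolding shared_list_def by simp
qed

lemma shortest_cases:
  assumes "Qs \<noteq> []"
  obtains Q where "shortest Qs = [Q]" "Q \<in> set Qs" "\<And>R. R \<in> set Qs \<Longrightarrow> length Q \<le> length R"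
proof -
  obtain R Rs where Qs: "Qs = R # Rs" using assms by (cases Qs) auto
  let ?f = "fold (\<lambda>Q best. if length Q \<le> length best then Q else best) Rs R"
  show thesis
  proof (rule that[of ?f])
    show "shortest Qs = [?f]" unfolding Qs shortest_def by simp
    show "?f \<in> set Qs" unfolding Qs using fold_shorter_in[of Rs R] by simp
    show "length ?f \<le> length S" if "S \<in> set Qs" for S
      using fold_shorter_le[of S R Rs] that unfolding Qs by simp
  qed
qed

lemma set_words: "set (words k X) = {W. length W \<le> k \<and> set W \<subseteq> set X}"
proof (induction k)
  case (Suc k)
  have "W \<in> set (words (Suc k) X) \<longleftrightarrow> length W \<le> Suc k \<and> set W \<subseteq> set X" for W
    using Suc by (cases W) auto
  then show ?case by blast
qed auto

text \<open>A bad word is a small triple, which every solution has to hit. If there is none, the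
  graph is \<open>good\<close> for 1000 and a smallest cut is safe. The second claim makes every
  move lower the budget.\<close>

lemma deletions_correct:
  assumes X: "distinct X" and bad: "bad M X"
  shows "G.solvable M (set X) d \<longleftrightarrow>
    (\<exists>D\<in>set (deletions M X). length D \<le> d \<and> G.solvable M (set X - set D) (d - length D))"
    and "D \<in> set (deletions M X) \<Longrightarrow> D \<noteq> []"
proof -
  let ?S = "filter (\<lambda>W. bad M W) (words width X)"
  have "(G.solvable M (set X) d \<longleftrightarrow>
    (\<exists>D\<in>set (deletions M X). length D \<le> d \<and> G.solvable M (set X - set D) (d - length D))) \<and>
    (\<forall>D\<in>set (deletions M X). D \<noteq> [])"
  proof (cases "?S = []")
    case False
    then obtain W Ws where S: "?S = W # Ws" by (cases ?S) auto
    then have "W \<in> set ?S" by simp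
    then have W: "set W \<subseteq> set X" "G.has_AT M (set W)" by (auto simp: set_words)
    have "deletions M X = map (\<lambda>w. [w]) W" unfolding deletions_def S by simp
    then show ?thesis using G.branch_small[OF _ W, of d] by auto
  next
    case True
    have g: "G.good M 1000 (set X)"
    proof (rule ccontr)
      assume "\<not> ?thesis"
      from G.not_good_small[OF this] obtain W where "length W \<le> 3 * (1000 + 1)" "set W \<subseteq> set X" "G.has_AT M (set W)"
        by blast
      then have "W \<in> set ?S" by (simp add: set_words width_def)
      then show False unfolding True by simp
    qed
    have "\<exists>Q. G.component_cut M (set X) Q" using G.component_cut_exists[OF _ g] bad by simp
    then have "set ` set (cuts M X) \<noteq> {}" unfolding set_cuts by blast
    then have "cuts M X \<noteq> []" by auto
    then obtain Q where Q: "shortest (cuts M X) = [Q]" "Q \<in> set (cuts M X)"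
      "\<And>R. R \<in> set (cuts M X) \<Longrightarrow> length Q \<le> length R" by (rule shortest_cases) blast
    have cQ: "G.component_cut M (set X) (set Q)" using Q(2) set_cuts[of M X] by blast
    have len: "card (set R) = length R" if "R \<in> set (cuts M X)" for R
      using cuts_distinct[OF X that] distinct_card by blast
    have min: "card (set Q) \<le> card Q'" if Q': "G.component_cut M (set X) Q'" for Q'
    proof -
      have "Q' \<in> set ` set (cuts M X)" unfolding set_cuts using Q' by simp
      then obtain R where "R \<in> set (cuts M X)" "Q' = set R" by auto
      then show ?thesis using len[of Q] len[of R] Q(2,3) by simp
    qed
    have "deletions M X = [Q]" unfolding deletions_def True using Q(1) by simp
    moreover have "Q \<noteq> []" using G.component_cut_nonempty[OF cQ] by auto
    ultimately show ?thesis
      using G.branch_cut[OF _ g _ cQ min, of d] len[OF Q(2)] by simp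
  qed
  then show "G.solvable M (set X) d \<longleftrightarrow>
    (\<exists>D\<in>set (deletions M X). length D \<le> d \<and> G.solvable M (set X - set D) (d - length D))"
    "D \<in> set (deletions M X) \<Longrightarrow> D \<noteq> []" by blast+
qed

text \<open>No deletion is empty, so a depth of at least the budget \<open>d\<close>
  suffices.\<close>

lemma search_correct:
  assumes "distinct X" "d \<le> n"
  shows "search finished moves n (M, X, d) \<longleftrightarrow> G.solvable M (set X) d"
  using assms
proof (induction n arbitrary: X d)
  case 0
  then show ?case using G.solvable_0[of "set X" M] by (simp add: finished_def)
next
  case (Suc n)
  show ?case
  proof (cases "bad M X")
    case False
    then show ?thesis using G.solvable_trivial by (simp add: finished_def)
  next
    case True
    have "search finished moves n (M, without X D, d - length D) \<longleftrightarrow> G.solvable M (set X - set D) (d - length D)"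
      if "D \<in> set (deletions M X)" for D
    proof -
      have "length D \<ge> 1" using deletions_correct(2)[OF Suc.prems(1) True that] by (cases D) auto
      then have "d - length D \<le> n" using Suc.prems(2) by linarith
      moreover have "distinct (without X D)" using Suc.prems(1) unfolding without_def by simp
      ultimately show ?thesis using Suc.IH[of "without X D" "d - length D"] by simp
    qed
    moreover have "search finished moves (Suc n) (M, X, d) \<longleftrightarrow>
      (\<exists>D\<in>set (deletions M X). length D \<le> d \<and> search finished moves n (M, without X D, d - length D))"
      using True by (auto simp: finished_def moves_def)
    ultimately show ?thesis using deletions_correct(1)[OF Suc.prems(1) True, of d] by auto
  qed
qed

lemma length_moves: "length (moves s) \<le> width"
proof -
  have "length (deletions M X) \<le> width" for M X
  proof (cases "filter (\<lambda>W. bad M W) (words width X)")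
    case Nil
    then show ?thesis
      unfolding deletions_def Nil shortest_def by (auto split: list.split simp: width_def)
  next
    case (Cons W Ws)
    then have "W \<in> set (filter (\<lambda>W. bad M W) (words width X))" by simp
    then have "length W \<le> width" by (simp add: set_words)
    then show ?thesis unfolding deletions_def Cons by simp
  qed
  then show ?thesis
    unfolding moves_def using length_filter_le le_trans by (metis (no_types, lifting) length_map)
qed

lemma sz_moves: "s' \<in> set (moves s) \<Longrightarrow> sz s' \<le> sz s"
proof -
  assume "s' \<in> set (moves s)"
  then obtain D where D: "s' = (fst s, without (fst (snd s)) D, snd (snd s) - length D)"
    unfolding moves_def by auto
  have "sz (without (fst (snd s)) D) \<le> sz (fst (snd s))" unfolding without_def by (rule sz_filter)
  then show ?thesis unfolding D by (cases s) (simp add: sz_nat)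
qed

section \<open>From matrices to bipartite graphs\<close>

lemma bij_pick: "finite J \<Longrightarrow> bij_betw (pick J) {..<card J} J"
proof -
  assume fin: "finite J"
  have "inj_on (pick J) {..<card J}"
  proof (rule linorder_inj_onI)
    fix a b assume "a < b" "a \<in> {..<card J}" "b \<in> {..<card J}"
    then show "pick J a \<noteq> pick J b" using pick_mono_le[of b J a] by auto
  qed auto
  moreover have "pick J ` {..<card J} \<subseteq> J" using pick_in_set_le by auto
  ultimately have "pick J ` {..<card J} = J"
    using fin by (metis card_image card_lessThan card_subset_eq)
  then show ?thesis using \<open>inj_on _ _\<close> unfolding bij_betw_def by blast
qed

definition interval_below :: "nat \<Rightarrow> (nat \<Rightarrow> bool) \<Rightarrow> bool" where
  "interval_below k P \<longleftrightarrow> (\<forall>a b c. a < b \<longrightarrow> b < c \<longrightarrow> c < k \<longrightarrow> P a \<longrightarrow> P c \<longrightarrow> P b)"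

lemma interval_below_cong:
  assumes "\<And>a. a < k \<Longrightarrow> P a = Q a"
  shows "interval_below k P = interval_below k Q"
proof -
  have "interval_below k Q" if "interval_below k P" "\<And>a. a < k \<Longrightarrow> P a = Q a" for P Q
    unfolding interval_below_def
  proof (intro allI impI)
    fix a b c assume abc: "a < b" "b < c" "c < k" "Q a" "Q c"
    then have "P a" "P c" using that(2)[of a] that(2)[of c] by auto
    then have "P b" using that(1) abc unfolding interval_below_def by blast
    then show "Q b" using that(2)[of b] abc by auto
  qed
  then show ?thesis using assms by blast
qed

text \<open>Enumerates \<open>J\<close> itself, which hides the renumbering of rows and columns in a
  submatrix.\<close>

definition convex_order :: "(nat \<Rightarrow> bool) set \<Rightarrow> nat set \<Rightarrow> (nat \<Rightarrow> nat) \<Rightarrow> bool" where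
  "convex_order F J q \<longleftrightarrow> bij_betw q {..<card J} J \<and> (\<forall>r\<in>F. interval_below (card J) (\<lambda>a. r (q a)))"

text \<open>An enumeration of \<open>J\<close> is a permutation of the indices followed by
  \<open>pick J\<close>.\<close>

lemma permutes_pick:
  assumes fin: "finite J"
  shows "(\<exists>\<pi>. \<pi> permutes {..<card J} \<and> (\<forall>r\<in>F. interval_below (card J) (\<lambda>a. r (pick J (\<pi> a))))) \<longleftrightarrow>
    (\<exists>q. convex_order F J q)"
proof
  assume "\<exists>\<pi>. \<pi> permutes {..<card J} \<and> (\<forall>r\<in>F. interval_below (card J) (\<lambda>a. r (pick J (\<pi> a))))"
  then obtain \<pi> where \<pi>: "\<pi> permutes {..<card J}" "\<forall>r\<in>F. interval_below (card J) (\<lambda>a. r (pick J (\<pi> a)))"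
    by (elim exE conjE)
  have "bij_betw (pick J \<circ> \<pi>) {..<card J} J"
    using bij_betw_trans[OF permutes_imp_bij[OF \<pi>(1)] bij_pick[OF fin]] .
  then have "convex_order F J (pick J \<circ> \<pi>)" using \<pi>(2) unfolding convex_order_def by simp
  then show "\<exists>q. convex_order F J q" by (intro exI)
next
  assume "\<exists>q. convex_order F J q"
  then obtain q where q: "convex_order F J q" by (rule exE)
  \<comment> \<open>Beyond the index range a permutation in the sense of \<open>permutes\<close> has
    to be the identity.\<close>
  define \<pi> where "\<pi> a = (if a < card J then inv_into {..<card J} (pick J) (q a) else a)" for a
  have bq: "bij_betw q {..<card J} J" using q unfolding convex_order_def by (rule conjunct1)
  have "bij_betw (inv_into {..<card J} (pick J) \<circ> q) {..<card J} {..<card J}"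
    using bij_betw_trans[OF bq bij_betw_inv_into[OF bij_pick[OF fin]]] .
  moreover have "\<And>a. a \<in> {..<card J} \<Longrightarrow> \<pi> a = (inv_into {..<card J} (pick J) \<circ> q) a"
    by (simp add: \<pi>_def)
  ultimately have "bij_betw \<pi> {..<card J} {..<card J}" using bij_betw_cong by metis
  then have p: "\<pi> permutes {..<card J}" by (rule bij_imp_permutes) (simp add: \<pi>_def)
  have e: "pick J (\<pi> a) = q a" if "a < card J" for a
  proof -
    have "q a \<in> J" using bq that unfolding bij_betw_def by blast
    then show ?thesis using that bij_betw_inv_into_right[OF bij_pick[OF fin]] unfolding \<pi>_def by simp
  qed
  have "interval_below (card J) (\<lambda>a. r (pick J (\<pi> a)))" if "r \<in> F" for r
  proof -
    have "interval_below (card J) (\<lambda>a. r (q a))" using q that unfolding convex_order_def by simp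
    moreover have "interval_below (card J) (\<lambda>a. r (pick J (\<pi> a))) = interval_below (card J) (\<lambda>a. r (q a))"
      by (rule interval_below_cong) (simp add: e)
    ultimately show ?thesis by simp
  qed
  with p show "\<exists>\<pi>. \<pi> permutes {..<card J} \<and> (\<forall>r\<in>F. interval_below (card J) (\<lambda>a. r (pick J (\<pi> a))))" by blast
qed

lemma C1P_rows_interval:
  "C1P_rows S \<longleftrightarrow> (\<exists>\<pi>. \<pi> permutes {..<dim_col S} \<and> (\<forall>i<dim_row S. interval_below (dim_col S) (\<lambda>a. S $$ (i, \<pi> a))))"
  unfolding C1P_rows_def interval_below_def ..

lemma C1P_cols_interval:
  "C1P_cols S \<longleftrightarrow> (\<exists>\<pi>. \<pi> permutes {..<dim_row S} \<and> (\<forall>j<dim_col S. interval_below (dim_row S) (\<lambda>a. S $$ (\<pi> a, j))))"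
  unfolding C1P_cols_def interval_below_def ..

context
  fixes M :: "bool mat" and I J :: "nat set"
  assumes I: "I \<subseteq> {..<dim_row M}" and J: "J \<subseteq> {..<dim_col M}"
begin

lemma submatrix_sizes:
  "finite I" "finite J" "dim_row (submatrix M I J) = card I" "dim_col (submatrix M I J) = card J"
  "\<And>i j. i < card I \<Longrightarrow> j < card J \<Longrightarrow> submatrix M I J $$ (i, j) = M $$ (pick I i, pick J j)"
proof -
  have "{i. i < dim_row M \<and> i \<in> I} = I" "{j. j < dim_col M \<and> j \<in> J} = J" using I J by auto
  then show "dim_row (submatrix M I J) = card I" "dim_col (submatrix M I J) = card J"
    "\<And>i j. i < card I \<Longrightarrow> j < card J \<Longrightarrow> submatrix M I J $$ (i, j) = M $$ (pick I i, pick J j)"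
    using dim_submatrix[of M I J] submatrix_index[of _ M I _ J] by simp_all
  show "finite I" "finite J" using I J finite_subset by auto
qed

lemma C1P_rows_submatrix:
  "C1P_rows (submatrix M I J) \<longleftrightarrow> (\<exists>q. convex_order ((\<lambda>i j. M $$ (i, j)) ` I) J q)"
proof -
  have "(\<forall>i<card I. interval_below (card J) (\<lambda>a. submatrix M I J $$ (i, \<pi> a))) \<longleftrightarrow>
    (\<forall>r\<in>(\<lambda>i j. M $$ (i, j)) ` I. interval_below (card J) (\<lambda>a. r (pick J (\<pi> a))))"
    if \<pi>: "\<pi> permutes {..<card J}" for \<pi>
  proof -
    have lt: "\<pi> a < card J" if "a < card J" for a using permutes_in_image[OF \<pi>, of a] that by simp
    have "(\<forall>i<card I. interval_below (card J) (\<lambda>a. submatrix M I J $$ (i, \<pi> a))) \<longleftrightarrow>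
      (\<forall>i<card I. interval_below (card J) (\<lambda>a. M $$ (pick I i, pick J (\<pi> a))))"
      by (intro all_cong interval_below_cong) (simp add: submatrix_sizes lt)
    also have "\<dots> \<longleftrightarrow> (\<forall>i\<in>pick I ` {..<card I}. interval_below (card J) (\<lambda>a. M $$ (i, pick J (\<pi> a))))" by auto
    also have "pick I ` {..<card I} = I" using bij_pick[OF submatrix_sizes(1)] unfolding bij_betw_def by simp
    finally show ?thesis by simp
  qed
  then have "C1P_rows (submatrix M I J) \<longleftrightarrow> (\<exists>\<pi>. \<pi> permutes {..<card J} \<and>
    (\<forall>r\<in>(\<lambda>i j. M $$ (i, j)) ` I. interval_below (card J) (\<lambda>a. r (pick J (\<pi> a)))))"
    unfolding C1P_rows_interval submatrix_sizes by (intro ex_cong1 conj_cong refl)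
  then show ?thesis unfolding permutes_pick[OF submatrix_sizes(2)] .
qed

lemma C1P_cols_submatrix:
  "C1P_cols (submatrix M I J) \<longleftrightarrow> (\<exists>q. convex_order ((\<lambda>j i. M $$ (i, j)) ` J) I q)"
proof -
  have "(\<forall>j<card J. interval_below (card I) (\<lambda>a. submatrix M I J $$ (\<pi> a, j))) \<longleftrightarrow>
    (\<forall>r\<in>(\<lambda>j i. M $$ (i, j)) ` J. interval_below (card I) (\<lambda>a. r (pick I (\<pi> a))))"
    if \<pi>: "\<pi> permutes {..<card I}" for \<pi>
  proof -
    have lt: "\<pi> a < card I" if "a < card I" for a using permutes_in_image[OF \<pi>, of a] that by simp
    have "(\<forall>j<card J. interval_below (card I) (\<lambda>a. submatrix M I J $$ (\<pi> a, j))) \<longleftrightarrow>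
      (\<forall>j<card J. interval_below (card I) (\<lambda>a. M $$ (pick I (\<pi> a), pick J j)))"
      by (intro all_cong interval_below_cong) (simp add: submatrix_sizes lt)
    also have "\<dots> \<longleftrightarrow> (\<forall>j\<in>pick J ` {..<card J}. interval_below (card I) (\<lambda>a. M $$ (pick I (\<pi> a), j)))" by auto
    also have "pick J ` {..<card J} = J" using bij_pick[OF submatrix_sizes(2)] unfolding bij_betw_def by simp
    finally show ?thesis by simp
  qed
  then have "C1P_cols (submatrix M I J) \<longleftrightarrow> (\<exists>\<pi>. \<pi> permutes {..<card I} \<and>
    (\<forall>r\<in>(\<lambda>j i. M $$ (i, j)) ` J. interval_below (card I) (\<lambda>a. r (pick I (\<pi> a)))))"
    unfolding C1P_cols_interval submatrix_sizes by (intro ex_cong1 conj_cong refl)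
  then show ?thesis unfolding permutes_pick[OF submatrix_sizes(1)] .
qed

end

lemma convex_order_le:
  assumes "convex_order F J q" "r \<in> F" "a \<le> b" "b \<le> c" "c < card J" "r (q a)" "r (q c)"
  shows "r (q b)"
proof (cases "a = b \<or> b = c")
  case False
  then have "a < b" "b < c" using assms by auto
  then show ?thesis using assms unfolding convex_order_def interval_below_def by blast
qed (use assms in auto)

lemma consec_convex_order:
  assumes cs: "distinct cs" "set cs = Pair \<sigma> ` J" and F: "\<And>r. r \<in> F \<Longrightarrow> consec {v. r (snd v)} cs"
  shows "\<exists>q. convex_order F J q"
proof -
  have "bij_betw (\<lambda>a. cs ! a) {..<length cs} (Pair \<sigma> ` J)"
    using bij_betw_nth[OF cs(1), of "{..<length cs}" "set cs"] cs(2) by simp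
  moreover have "bij_betw snd (Pair \<sigma> ` J) J" by (auto simp: bij_betw_def inj_on_def image_image)
  moreover have len: "length cs = card J"
    using distinct_card[OF cs(1)] cs(2) by (simp add: card_image inj_on_def)
  ultimately have "bij_betw (snd \<circ> (\<lambda>a. cs ! a)) {..<card J} J" using bij_betw_trans by metis
  moreover have "interval_below (card J) (\<lambda>a. r ((snd \<circ> (\<lambda>a. cs ! a)) a))" if "r \<in> F" for r
    unfolding interval_below_def
  proof (intro allI impI)
    fix a b c assume abc: "a < b" "b < c" "c < card J" "r ((snd \<circ> (\<lambda>a. cs ! a)) a)" "r ((snd \<circ> (\<lambda>a. cs ! a)) c)"
    have "cs ! b \<in> {v. r (snd v)}"
      by (rule consec_convex[OF F[OF that], of a b c]) (use abc len in auto)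
    then show "r ((snd \<circ> (\<lambda>a. cs ! a)) b)" by simp
  qed
  ultimately have "convex_order F J (snd \<circ> (\<lambda>a. cs ! a))" unfolding convex_order_def by blast
  then show ?thesis by (intro exI)
qed

lemma consec_cong:
  assumes "consec r cs" "\<And>v. v \<in> set cs \<Longrightarrow> v \<in> r \<longleftrightarrow> v \<in> r'"
  shows "consec r' cs"
proof -
  obtain xs ys zs where e: "cs = xs @ ys @ zs" "set ys \<subseteq> r" "set xs \<inter> r = {}" "set zs \<inter> r = {}"
    using assms(1) unfolding consec_def by blast
  show ?thesis by (rule consecI[OF e(1)]) (use e assms(2) in auto)
qed

context
  fixes M :: "bool mat" and I J :: "nat set"
  assumes I: "I \<subseteq> {..<dim_row M}" and J: "J \<subseteq> {..<dim_col M}"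
begin

lemma entry_mat: "i \<in> I \<Longrightarrow> j \<in> J \<Longrightarrow> entry (mat_to_list M) i j = M $$ (i, j)"
  using I J unfolding entry_def lookup_nth mat_to_list_def by auto

lemma edge_mat:
  "i \<in> I \<Longrightarrow> j \<in> J \<Longrightarrow> edge (mat_to_list M) (False, i) (True, j) = M $$ (i, j)"
  "i \<in> I \<Longrightarrow> j \<in> J \<Longrightarrow> edge (mat_to_list M) (True, j) (False, i) = M $$ (i, j)"
  using entry_mat unfolding edge_def by auto

text \<open>Without a triple, Tucker's theorem orders both sides. Conversely, the positions in the
  two given orders are ranks, and \<open>ranked_no_AT\<close> applies.\<close>

lemma SC1P_submatrix:
  "SC1P (submatrix M I J) \<longleftrightarrow> \<not> G.has_AT (mat_to_list M) (Pair False ` I \<union> Pair True ` J)"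
proof -
  let ?L = "mat_to_list M"
  let ?W = "Pair False ` I \<union> Pair True ` J"
  have fin: "finite I" "finite J" using I J finite_subset by auto
  have W: "{v \<in> ?W. fst v = False} = Pair False ` I" "{v \<in> ?W. fst v = True} = Pair True ` J" by auto
  show ?thesis
  proof
    assume no: "\<not> G.has_AT ?L ?W"
    have "finite ?W" using fin by simp
    note ord = G.no_AT_order[OF this no]
    obtain cs where cs: "distinct cs" "set cs = Pair True ` J" "\<forall>u\<in>?W. consec (G.nb ?L u) cs"
      using ord[of True] unfolding W by (elim exE conjE)
    have 1: "\<exists>q. convex_order ((\<lambda>i j. M $$ (i, j)) ` I) J q"
    proof (rule consec_convex_order[OF cs(1,2)])
      fix r assume "r \<in> (\<lambda>i j. M $$ (i, j)) ` I"
      then obtain i where i: "i \<in> I" "r = (\<lambda>j. M $$ (i, j))" by blast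
      then have "consec (G.nb ?L (False, i)) cs" using cs(3) by blast
      then show "consec {v. r (snd v)} cs"
        by (rule consec_cong) (use cs(2) edge_mat(1)[OF i(1)] i(2) in auto)
    qed
    obtain cs' where cs': "distinct cs'" "set cs' = Pair False ` I" "\<forall>u\<in>?W. consec (G.nb ?L u) cs'"
      using ord[of False] unfolding W by (elim exE conjE)
    have 2: "\<exists>q. convex_order ((\<lambda>j i. M $$ (i, j)) ` J) I q"
    proof (rule consec_convex_order[OF cs'(1,2)])
      fix r assume "r \<in> (\<lambda>j i. M $$ (i, j)) ` J"
      then obtain j where j: "j \<in> J" "r = (\<lambda>i. M $$ (i, j))" by blast
      then have "consec (G.nb ?L (True, j)) cs'" using cs'(3) by blast
      then show "consec {v. r (snd v)} cs'"
        by (rule consec_cong) (use cs'(2) edge_mat(2)[OF _ j(1)] j(2) in auto)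
    qed
    show "SC1P (submatrix M I J)"
      unfolding SC1P_def C1P_rows_submatrix[OF I J] C1P_cols_submatrix[OF I J] by (rule conjI[OF 1 2])
  next
    assume "SC1P (submatrix M I J)"
    then obtain q1 q2 where q1: "convex_order ((\<lambda>i j. M $$ (i, j)) ` I) J q1"
      and q2: "convex_order ((\<lambda>j i. M $$ (i, j)) ` J) I q2"
      unfolding SC1P_def C1P_rows_submatrix[OF I J] C1P_cols_submatrix[OF I J] by (elim exE conjE)
    have b: "bij_betw q1 {..<card J} J" "bij_betw q2 {..<card I} I" using q1 q2 unfolding convex_order_def by auto
    define rk where "rk v = (if fst v then inv_into {..<card J} q1 (snd v) else inv_into {..<card I} q2 (snd v))" for v
    have r1: "rk (True, j) < card J" "q1 (rk (True, j)) = j" if "j \<in> J" for j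
      using bij_betw_inv_into_right[OF b(1) that] bij_betw_apply[OF bij_betw_inv_into[OF b(1)] that]
      unfolding rk_def by auto
    have r2: "rk (False, i) < card I" "q2 (rk (False, i)) = i" if "i \<in> I" for i
      using bij_betw_inv_into_right[OF b(2) that] bij_betw_apply[OF bij_betw_inv_into[OF b(2)] that]
      unfolding rk_def by auto
    have "G.ranked ?L ?W rk"
      unfolding G.ranked_def
    proof (intro conjI ballI impI)
      fix u v assume uv: "u \<in> ?W" "v \<in> ?W" "fst u = fst v" "rk u = rk v"
      show "u = v"
      proof (cases "fst u")
        case True
        obtain j where j: "u = (True, j)" "j \<in> J" using True uv(1) by auto
        obtain j' where j': "v = (True, j')" "j' \<in> J" using True uv(2,3) by auto
        have "j = q1 (rk u)" using r1(2)[OF j(2)] unfolding j(1) by (rule sym)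
        also have "\<dots> = q1 (rk v)" unfolding uv(4) ..
        also have "\<dots> = j'" using r1(2)[OF j'(2)] unfolding j'(1) .
        finally show ?thesis unfolding j(1) j'(1) by (rule arg_cong)
      next
        case False
        obtain j where j: "u = (False, j)" "j \<in> I" using False uv(1) by auto
        obtain j' where j': "v = (False, j')" "j' \<in> I" using False uv(2,3) by auto
        have "j = q2 (rk u)" using r2(2)[OF j(2)] unfolding j(1) by (rule sym)
        also have "\<dots> = q2 (rk v)" unfolding uv(4) ..
        also have "\<dots> = j'" using r2(2)[OF j'(2)] unfolding j'(1) .
        finally show ?thesis unfolding j(1) j'(1) by (rule arg_cong)
      qed
    next
      fix u x y z assume a: "u \<in> ?W" "x \<in> ?W" "y \<in> ?W" "z \<in> ?W" "edge ?L u x" "edge ?L u z" "fst y = fst x"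
        "rk x \<le> rk y" "rk y \<le> rk z"
      have s: "fst u \<noteq> fst x" "fst z = fst x" using a(5,6) unfolding edge_def by auto
      show "edge ?L u y"
      proof (cases "fst x")
        case True
        obtain i where i: "u = (False, i)" "i \<in> I" using a(1) s(1) True by auto
        obtain jx where jx: "x = (True, jx)" "jx \<in> J" using a(2) True by auto
        obtain jy where jy: "y = (True, jy)" "jy \<in> J" using a(3,7) True by auto
        obtain jz where jz: "z = (True, jz)" "jz \<in> J" using a(4) s(2) True by auto
        note e = i(1) jx(1) jy(1) jz(1) i(2) jx(2) jy(2) jz(2)
        have m: "M $$ (i, jx)" "M $$ (i, jz)"
          using a(5,6) edge_mat(1)[OF e(5,6)] edge_mat(1)[OF e(5,8)] unfolding e by simp_all
        have k: "rk x < card J" "rk z < card J" "q1 (rk x) = jx" "q1 (rk y) = jy" "q1 (rk z) = jz"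
          using r1[OF e(6)] r1[OF e(7)] r1[OF e(8)] unfolding e by simp_all
        have "(\<lambda>j. M $$ (i, j)) (q1 (rk y))"
          by (rule convex_order_le[OF q1 _ a(8,9) k(2)]) (use e(5) m k in simp_all)
        then show ?thesis using k(4) edge_mat(1)[OF e(5,7)] unfolding e by simp
      next
        case False
        obtain i where i: "u = (True, i)" "i \<in> J" using a(1) s(1) False by auto
        obtain jx where jx: "x = (False, jx)" "jx \<in> I" using a(2) False by auto
        obtain jy where jy: "y = (False, jy)" "jy \<in> I" using a(3,7) False by auto
        obtain jz where jz: "z = (False, jz)" "jz \<in> I" using a(4) s(2) False by auto
        note e = i(1) jx(1) jy(1) jz(1) i(2) jx(2) jy(2) jz(2)
        have m: "M $$ (jx, i)" "M $$ (jz, i)"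
          using a(5,6) edge_mat(2)[OF e(6,5)] edge_mat(2)[OF e(8,5)] unfolding e by simp_all
        have k: "rk x < card I" "rk z < card I" "q2 (rk x) = jx" "q2 (rk y) = jy" "q2 (rk z) = jz"
          using r2[OF e(6)] r2[OF e(7)] r2[OF e(8)] unfolding e by simp_all
        have "(\<lambda>j. M $$ (j, i)) (q2 (rk y))"
          by (rule convex_order_le[OF q2 _ a(8,9) k(2)]) (use e(5) m k in simp_all)
        then show ?thesis using k(4) edge_mat(2)[OF e(7,5)] unfolding e by simp
      qed
    qed
    then show "\<not> G.has_AT ?L ?W" by (rule G.ranked_no_AT)
  qed
qed

end

text \<open>The list of rows of a matrix without rows does not determine the number of columns, but then nothing has to be deleted.\<close>
definition vertices :: "bool list list \<Rightarrow> vertex list" where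
  "vertices M = map (\<lambda>i. (False, i)) [0..<length M] @ map (\<lambda>j. (True, j)) [0..<length (lookup [] M 0)]"

section \<open>Instances as graphs\<close>

lemma distinct_vertices: "distinct (vertices M)"
  unfolding vertices_def by (auto simp: distinct_map inj_on_def)

lemma set_vertices:
  "dim_row M > 0 \<Longrightarrow> set (vertices (mat_to_list M)) = Pair False ` {..<dim_row M} \<union> Pair True ` {..<dim_col M}"
  unfolding vertices_def lookup_nth by (auto simp: mat_to_list_def)

text \<open>No solution has more than \<open>card X\<close> vertices, so capping the parameter loses
  nothing.\<close>

lemma solvable_min: "finite X \<Longrightarrow> G.solvable M X (min (card X) d) \<longleftrightarrow> G.solvable M X d"
  unfolding G.solvable_def using card_mono by (metis min.bounded_iff)

lemma SC1S_RC_solvable: "SC1S_RC (M, d) \<longleftrightarrow> G.solvable (mat_to_list M) (set (vertices (mat_to_list M))) d"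
proof (cases "dim_row M = 0")
  case True
  have "C1P_rows (delete_rows_cols M {} {})" "C1P_cols (delete_rows_cols M {} {})"
    unfolding C1P_rows_def C1P_cols_def delete_rows_cols_def using True
    by (auto simp: dim_submatrix intro!: exI[of _ id] permutes_id)
  then have "SC1S_RC (M, d)" unfolding SC1S_RC.simps SC1P_def
    by (intro exI[of _ "{}"] conjI) auto
  moreover have "vertices (mat_to_list M) = []" using True unfolding vertices_def lookup_nth mat_to_list_def by simp
  then have "\<not> G.has_AT (mat_to_list M) (set (vertices (mat_to_list M)))" unfolding G.has_AT_def G.AT_def by simp
  ultimately show ?thesis using G.solvable_trivial by blast
next
  case False
  then have V: "set (vertices (mat_to_list M)) = Pair False ` {..<dim_row M} \<union> Pair True ` {..<dim_col M}"
    using set_vertices by simp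
  have diff: "set (vertices (mat_to_list M)) - (Pair False ` R \<union> Pair True ` C) =
    Pair False ` ({..<dim_row M} - R) \<union> Pair True ` ({..<dim_col M} - C)" for R C
    unfolding V by auto
  have eq: "SC1P (delete_rows_cols M R C) \<longleftrightarrow>
    \<not> G.has_AT (mat_to_list M) (set (vertices (mat_to_list M)) - (Pair False ` R \<union> Pair True ` C))" for R C
    unfolding diff delete_rows_cols_def by (rule SC1P_submatrix) auto
  have card: "card (Pair False ` R \<union> Pair True ` C) = card R + card C" if "finite R" "finite C" for R C :: "nat set"
  proof -
    have "card (Pair False ` R \<union> Pair True ` C) = card (Pair False ` R) + card (Pair True ` C)"
      using that by (intro card_Un_disjoint) auto
    then show ?thesis by (simp add: card_image inj_on_def)
  qed
  show ?thesis
  proof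
    assume "SC1S_RC (M, d)"
    then obtain R C where RC: "R \<subseteq> {..<dim_row M}" "C \<subseteq> {..<dim_col M}" "card R + card C \<le> d"
      "SC1P (delete_rows_cols M R C)" unfolding SC1S_RC.simps by (elim exE conjE)
    have "finite R" "finite C" using RC(1,2) finite_subset by auto
    then have "card (Pair False ` R \<union> Pair True ` C) \<le> d" using card RC(3) by simp
    moreover have "Pair False ` R \<union> Pair True ` C \<subseteq> set (vertices (mat_to_list M))" unfolding V using RC(1,2) by auto
    ultimately show "G.solvable (mat_to_list M) (set (vertices (mat_to_list M))) d"
      unfolding G.solvable_def using RC(4)[unfolded eq] by blast
  next
    assume "G.solvable (mat_to_list M) (set (vertices (mat_to_list M))) d"
    then obtain S where S: "S \<subseteq> set (vertices (mat_to_list M))" "card S \<le> d"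
      "\<not> G.has_AT (mat_to_list M) (set (vertices (mat_to_list M)) - S)" unfolding G.solvable_def by blast
    define R where "R = {i. (False, i) \<in> S}"
    define C where "C = {j. (True, j) \<in> S}"
    have RC: "R \<subseteq> {..<dim_row M}" "C \<subseteq> {..<dim_col M}" using S(1) unfolding V R_def C_def by auto
    have Seq: "S = Pair False ` R \<union> Pair True ` C"
    proof
      show "S \<subseteq> Pair False ` R \<union> Pair True ` C"
      proof
        fix v assume "v \<in> S"
        then show "v \<in> Pair False ` R \<union> Pair True ` C"
          unfolding R_def C_def by (cases v; cases "fst v") auto
      qed
    qed (auto simp: R_def C_def)
    have "finite R" "finite C" using RC finite_subset by auto
    then have "card R + card C \<le> d" using card S(2) unfolding Seq by simp
    then show "SC1S_RC (M, d)" unfolding SC1S_RC.simps using RC S(3) eq unfolding Seq by blast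
  qed
qed

text \<open>The capped parameter is both the depth of the search and the budget of the initial
  state.\<close>

definition start :: "bool list list \<times> bool list \<Rightarrow> nat \<times> state" where
  "start z = (capped (length (vertices (fst z))) (snd z),
     (fst z, vertices (fst z), capped (length (vertices (fst z))) (snd z)))"

lemma fp_vertices: assumes "fp M" shows "fp (\<lambda>x. vertices (M x))"
  unfolding vertices_def by (intro fp_append fp_map fp_upt fp_length fp_lookup fp_basic assms)

lemma fp_start: "fp start"
  unfolding start_def[abs_def] by (intro fp_capped fp_length fp_vertices fp_basic)

lemma search_start:
  "search finished moves (fst (start (mat_to_list M, bits d))) (snd (start (mat_to_list M, bits d))) \<longleftrightarrow> SC1S_RC (M, d)"
proof -
  let ?V = "vertices (mat_to_list M)"
  have "search finished moves (fst (start (mat_to_list M, bits d))) (snd (start (mat_to_list M, bits d))) \<longleftrightarrow>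
    G.solvable (mat_to_list M) (set ?V) (min (length ?V) d)"
    unfolding start_def fst_conv snd_conv capped_bits by (rule search_correct[OF distinct_vertices order_refl])
  also have "\<dots> \<longleftrightarrow> G.solvable (mat_to_list M) (set ?V) d"
    using solvable_min[of "set ?V"] distinct_card[OF distinct_vertices, of "mat_to_list M"] by simp
  finally show ?thesis unfolding SC1S_RC_solvable .
qed

section \<open>The running time of the solver\<close>

lemma venc_instance: "enc_instance (M, d) = venc (mat_to_list M, bits d)"
proof -
  have "(venc :: bool list list \<Rightarrow> val) = enc_list (enc_list enc_bool)"
    unfolding venc_list_def venc_bool_def ..
  then show ?thesis by (simp add: venc_bits)
qed

lemma sz_instance: "val_size (enc_instance (M, d)) = sz (mat_to_list M, bits d)"
  unfolding venc_instance sz_def ..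

lemma sz_ge_3: "sz (a, b) \<ge> 3"
  using sz_pos[of a] sz_pos[of b] by simp

lemma solver:
  "\<exists>P C k. \<forall>M d. \<exists>t. run P (enc_instance (M, d)) (enc_bool (SC1S_RC (M, d))) t \<and>
     t \<le> C ^ d * val_size (enc_instance (M, d)) ^ k \<and> 1 \<le> C"
proof -
  have ex: "\<exists>Z V. Z \<noteq> [] \<and> poly_bounded V \<and> (\<forall>x. evalb Z [venc x] (Z ! 0)
    (venc (search finished moves (fst (start x)) (snd (start x)))) ((width + 2) ^ fst (start x) * V x))"
    by (rule search_program[OF fp_finished fp_moves fp_start length_moves]) (rule sz_moves)
  obtain Z V where Z: "Z \<noteq> []" "poly_bounded V" "\<forall>x. evalb Z [venc x] (Z ! 0)
    (venc (search finished moves (fst (start x)) (snd (start x)))) ((width + 2) ^ fst (start x) * V x)"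
    using ex by (elim exE conjE)
  obtain k where k: "\<forall>x. V x \<le> (sz x + 1) ^ k" using Z(2) unfolding poly_bounded_def by (rule exE)
  define C where "C = width + 2"
  have "\<exists>t. run Z (enc_instance (M, d)) (enc_bool (SC1S_RC (M, d))) t \<and>
     t \<le> C ^ d * val_size (enc_instance (M, d)) ^ (2 * k) \<and> 1 \<le> C" for M d
  proof -
    let ?x = "(mat_to_list M, bits d)"
    obtain t where t: "t \<le> C ^ fst (start ?x) * V ?x"
      "eval Z [venc ?x] (Z ! 0) (venc (search finished moves (fst (start ?x)) (snd (start ?x)))) t"
      using spec[OF Z(3), of ?x] unfolding evalb_def C_def by blast
    have "fst (start ?x) \<le> d" unfolding start_def by (simp add: capped_bits)
    then have c: "C ^ fst (start ?x) \<le> C ^ d" by (rule power_increasing) (simp add: C_def)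
    have s: "sz ?x \<ge> 3" by (rule sz_ge_3)
    \<comment> \<open>Turns the base \<open>sz ?x + 1\<close> of the polynomial bound into
      \<open>sz ?x\<close> by doubling the exponent.\<close>
    have "sz ?x + 1 \<le> sz ?x * 2" using s by linarith
    also have "\<dots> \<le> sz ?x * sz ?x" using s by (intro mult_left_mono) auto
    finally have "sz ?x + 1 \<le> sz ?x ^ 2" by (simp only: power2_eq_square)
    then have "(sz ?x + 1) ^ k \<le> (sz ?x ^ 2) ^ k" by (rule power_mono) simp
    then have "V ?x \<le> sz ?x ^ (2 * k)" using spec[OF k, of ?x] by (simp only: power_mult)
    with c have "C ^ fst (start ?x) * V ?x \<le> C ^ d * sz ?x ^ (2 * k)" by (rule mult_le_mono)
    then have "t \<le> C ^ d * val_size (enc_instance (M, d)) ^ (2 * k)" using t(1) unfolding sz_instance by linarith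
    moreover have "run Z (enc_instance (M, d)) (enc_bool (SC1S_RC (M, d))) t"
      using t(2) Z(1) unfolding run_def venc_instance search_start venc_bool_def by simp
    ultimately show ?thesis unfolding C_def by auto
  qed
  then show ?thesis by blast
qed

section \<open>Computability of the parameter dependence\<close>

definition zeros :: "nat \<Rightarrow> val \<Rightarrow> val" where "zeros k v = (Node Leaf ^^ k) v"

text \<open>
  Maps \<open>(n, v)\<close> to \<open>zeros (e * n) v\<close> without any arithmetic: since \<open>n = 2 * (n div 2) + n mod 2\<close>, two recursive
  calls on \<open>n div 2\<close> and one conditional step suffice.
\<close>
definition pow_body :: "nat \<Rightarrow> expr" where
  "pow_body e = EIf (ELeft (EVar 0))
    (ECall 1 (ENode (ERight (ELeft (EVar 0))) (ECall 1 (ENode (ERight (ELeft (EVar 0)))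
       (EIf (ELeft (ELeft (EVar 0))) ((ENode ELeaf ^^ e) (ERight (EVar 0))) (ERight (EVar 0)))))))
    (ERight (EVar 0))"

definition pow_prog :: "nat \<Rightarrow> prog" where
  "pow_prog e = [ECall 1 (ENode (EVar 0) (ENode (ENode ELeaf ELeaf) ELeaf)), pow_body e]"

lemma eval_zeros: "eval P env x v t \<Longrightarrow> \<exists>t. eval P env ((ENode ELeaf ^^ e) x) (zeros e v) t"
proof (induction e)
  case (Suc e)
  then obtain t' where "eval P env ((ENode ELeaf ^^ e) x) (zeros e v) t'" by blast
  from eval.ENode[OF eval.ELeaf this] show ?case unfolding zeros_def by auto
qed (auto simp: zeros_def)

lemma zeros_add: "zeros a (zeros b v) = zeros (a + b) v"
  unfolding zeros_def by (simp add: funpow_add)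

lemma eval_pow_body: "\<exists>t. eval (pow_prog e) [Node (enc_nat n) v] (pow_body e) (zeros (e * n) v) t"
proof (induction n arbitrary: v rule: less_induct)
  case (less n)
  let ?P = "pow_prog e" and ?env = "[Node (enc_nat n) v]"
  have P: "1 < length ?P" "?P ! 1 = pow_body e" unfolding pow_prog_def by auto
  have var: "eval ?P ?env (EVar 0) (Node (enc_nat n) v) 1"
    using eval.Var[of 0 ?env ?P] by simp
  have l: "eval ?P ?env (ELeft (EVar 0)) (enc_nat n) (1 + 1)" using eval.ELeft[OF var] by simp
  have r: "eval ?P ?env (ERight (EVar 0)) v (1 + 1)" using eval.ERight[OF var] by simp
  show ?case
  proof (cases "n = 0")
    case True
    then have n: "enc_nat n = Leaf" by (subst enc_nat.simps) simp
    have "zeros (e * n) v = v" using True unfolding zeros_def by simp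
    then show ?thesis using eval.IfFalse[OF l n r] unfolding pow_body_def by auto
  next
    case False
    then have n: "enc_nat n = Node (enc_bool (odd n)) (enc_nat (n div 2))" by (subst enc_nat.simps) simp
    have nl: "enc_nat n \<noteq> Leaf" unfolding n by simp
    let ?w = "if odd n then zeros e v else v"
    have lr: "eval ?P ?env (ERight (ELeft (EVar 0))) (enc_nat (n div 2)) (1 + 1 + 1)"
      using eval.ERight[OF l] unfolding n by simp
    have ll: "eval ?P ?env (ELeft (ELeft (EVar 0))) (enc_bool (odd n)) (1 + 1 + 1)"
      using eval.ELeft[OF l] unfolding n by simp
    obtain tz where tz: "eval ?P ?env ((ENode ELeaf ^^ e) (ERight (EVar 0))) (zeros e v) tz"
      using eval_zeros[OF r] by blast
    have "\<exists>t. eval ?P ?env (EIf (ELeft (ELeft (EVar 0))) ((ENode ELeaf ^^ e) (ERight (EVar 0))) (ERight (EVar 0))) ?w t"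
    proof (cases "odd n")
      case True
      then have "enc_bool (odd n) \<noteq> Leaf" by simp
      from eval.IfTrue[OF ll this tz] show ?thesis using True by auto
    next
      case False
      then have "enc_bool (odd n) = Leaf" by simp
      from eval.IfFalse[OF ll this r] show ?thesis using False by auto
    qed
    then obtain t1 where t1: "eval ?P ?env (EIf (ELeft (ELeft (EVar 0))) ((ENode ELeaf ^^ e) (ERight (EVar 0))) (ERight (EVar 0))) ?w t1"
      by (rule exE)
    have lt: "n div 2 < n" using False by simp
    obtain t2 where t2: "eval ?P [Node (enc_nat (n div 2)) ?w] (?P ! 1) (zeros (e * (n div 2)) ?w) t2"
      using less.IH[OF lt, of ?w] unfolding P(2) by (rule exE)
    obtain t3 where t3: "eval ?P [Node (enc_nat (n div 2)) (zeros (e * (n div 2)) ?w)] (?P ! 1)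
        (zeros (e * (n div 2)) (zeros (e * (n div 2)) ?w)) t3"
      using less.IH[OF lt, of "zeros (e * (n div 2)) ?w"] unfolding P(2) by (rule exE)
    note c = eval.Call[OF eval.ENode[OF lr eval.Call[OF eval.ENode[OF lr t1] P(1) t2]] P(1) t3]
    have "zeros (e * (n div 2)) (zeros (e * (n div 2)) ?w) = zeros (e * n) v"
    proof -
      have "?w = zeros (e * (n mod 2)) v" by (cases "odd n") (auto simp: zeros_def odd_iff_mod_2_eq_one)
      then have "zeros (e * (n div 2)) (zeros (e * (n div 2)) ?w) = zeros (e * (n div 2) + (e * (n div 2) + e * (n mod 2))) v"
        by (simp only: zeros_add)
      also have "e * (n div 2) + (e * (n div 2) + e * (n mod 2)) = e * (2 * (n div 2) + n mod 2)"
        by (simp only: algebra_simps)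
      also have "2 * (n div 2) + n mod 2 = n" by (rule mult_div_mod_eq)
      finally show ?thesis .
    qed
    then show ?thesis using eval.IfTrue[OF l nl c] unfolding pow_body_def by auto
  qed
qed

text \<open>With the least significant bit first, a power of two is the encoding of 1 behind
  \<open>k\<close> zero bits.\<close>

lemma enc_power: "enc_nat (2 ^ k) = zeros k (enc_nat 1)"
proof (induction k)
  case 0
  show ?case by (simp add: zeros_def)
next
  case (Suc k)
  have "enc_nat (2 ^ Suc k) = Node (enc_bool (odd (2 ^ Suc k :: nat))) (enc_nat (2 ^ Suc k div 2))"
    by (subst enc_nat.simps) simp
  also have "\<dots> = Node Leaf (enc_nat (2 ^ k))" by simp
  finally show ?case using Suc unfolding zeros_def by simp
qed

lemma enc_1: "enc_nat 1 = Node (Node Leaf Leaf) Leaf"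
  by (subst enc_nat.simps, subst enc_nat.simps) simp

lemma computable_power: "computable (\<lambda>n. 2 ^ (e * n))"
  unfolding computable_def
proof (rule exI[of _ "pow_prog e"], rule allI)
  fix n
  show "\<exists>t. run (pow_prog e) (enc_nat n) (enc_nat (2 ^ (e * n))) t"
  proof -
    let ?P = "pow_prog e"
    have P: "0 < length ?P" "1 < length ?P" "?P ! 1 = pow_body e"
      "?P ! 0 = ECall 1 (ENode (EVar 0) (ENode (ENode ELeaf ELeaf) ELeaf))" unfolding pow_prog_def by auto
    have var: "eval ?P [enc_nat n] (EVar 0) (enc_nat n) 1" using eval.Var[of 0 "[enc_nat n]" ?P] by simp
    obtain t where t: "eval ?P [Node (enc_nat n) (Node (Node Leaf Leaf) Leaf)] (?P ! 1) (enc_nat (2 ^ (e * n))) t"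
      using eval_pow_body[of e n "enc_nat 1"] unfolding P(3) enc_power enc_1 by (rule exE)
    show ?thesis
      unfolding run_def P(4)
      using eval.Call[OF eval.ENode[OF var eval.ENode[OF eval.ENode[OF eval.ELeaf eval.ELeaf] eval.ELeaf]] P(2) t] P(1)
      by blast
  qed
qed

text \<open>The power of two equals \<open>d ^ d\<close> for positive \<open>d\<close>. It dominates
  \<open>C ^ d\<close> for \<open>d > C\<close>, and for \<open>d \<le> C\<close> the factor
  \<open>C ^ C\<close> does.\<close>

lemma power_le_d_log_d:
  fixes C d :: nat
  assumes "1 \<le> C"
  shows "real C ^ d \<le> real C ^ C * 2 powr (real d * log 2 (real d))"
proof (cases "d = 0")
  case True
  \<comment> \<open>For \<open>d = 0\<close> the exponent vanishes whatever the value of the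
    logarithm.\<close>
  then show ?thesis using assms by (simp add: log_def one_le_power)
next
  case False
  have "2 powr (real d * log 2 (real d)) = (2 powr log 2 (real d)) powr real d"
    by (simp only: powr_powr mult.commute)
  also have "\<dots> = real d powr real d" using False by simp
  also have "\<dots> = real d ^ d" using False by (simp add: powr_realpow)
  finally have e: "2 powr (real d * log 2 (real d)) = real d ^ d" .
  show ?thesis
  proof (cases "d \<le> C")
    case True
    have "real C ^ d \<le> real C ^ C" using True assms by (intro power_increasing) auto
    also have "\<dots> \<le> real C ^ C * real d ^ d" using False assms by (simp add: one_le_power)
    finally show ?thesis unfolding e .
  next
    case dC: False
    have "real C ^ d \<le> 1 * real d ^ d" using dC by (simp add: power_mono)
    also have "\<dots> \<le> real C ^ C * real d ^ d" using assms by (intro mult_right_mono) (auto simp: one_le_power)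
    finally show ?thesis unfolding e .
  qed
qed

theorem theorem8:
  shows "fixed_parameter_tractable enc_instance snd SC1S_RC \<and>
    solvable_in_O_star enc_instance snd SC1S_RC (\<lambda>d. 2 powr (real d * log 2 (real d)))"
proof -
  obtain P C k where s: "\<And>M d. \<exists>t. run P (enc_instance (M, d)) (enc_bool (SC1S_RC (M, d))) t \<and>
     t \<le> C ^ d * val_size (enc_instance (M, d)) ^ k \<and> 1 \<le> C" using solver by blast
  have C: "1 \<le> C" using s by blast
  have n3: "3 \<le> val_size (enc_instance (M, d))" for M d unfolding sz_instance by (rule sz_ge_3)
  \<comment> \<open>Tractability asks for a computable bound; \<open>2 ^ (C * d)\<close> exceeds
    \<open>C ^ d\<close> and can be written down by prepending zeros.\<close>
  have "solvable_in_O_star enc_instance snd SC1S_RC (\<lambda>d. real (2 ^ (C * d)))"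
    unfolding solvable_in_O_star_def
  proof (rule exI[of _ P], rule exI[of _ k], rule allI)
    fix x :: "bool mat \<times> nat"
    obtain M d where x: "x = (M, d)" by (cases x)
    obtain t where t: "run P (enc_instance (M, d)) (enc_bool (SC1S_RC (M, d))) t"
      "t \<le> C ^ d * val_size (enc_instance (M, d)) ^ k" using s[of M d] by blast
    have "C ^ d \<le> (2 ^ C) ^ d" by (intro power_mono) (simp_all add: less_imp_le)
    then have "t \<le> 2 ^ (C * d) * val_size (enc_instance (M, d)) ^ k"
      using t(2) order_trans mult_right_mono by (metis le0 power_mult)
    then have "real t \<le> real (2 ^ (C * d) * val_size (enc_instance (M, d)) ^ k)" by (rule of_nat_mono)
    then have "real t \<le> real (2 ^ (C * d)) * real (val_size (enc_instance (M, d))) ^ k" by (simp only: of_nat_mult of_nat_power)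
    then show "\<exists>t. run P (enc_instance x) (enc_bool (SC1S_RC x)) t \<and>
      real t \<le> real (2 ^ (C * snd x)) * real (val_size (enc_instance x)) ^ k"
      using t(1) unfolding x snd_conv by blast
  qed
  then have fpt: "fixed_parameter_tractable enc_instance snd SC1S_RC"
    unfolding fixed_parameter_tractable_def
    by (intro exI[of _ "\<lambda>n. 2 ^ (C * n)"] conjI computable_power)
  \<comment> \<open>The definition of solvability allows no constant factor, so \<open>C ^ C\<close>
    is absorbed into the polynomial, using that the input size is at least 3.\<close>
  obtain c where c: "C ^ C \<le> 3 ^ c"
  proof -
    have "C ^ C \<le> 3 ^ (C ^ C)" by (rule less_imp_le[OF power_gt_expt]) simp
    then show thesis by (rule that)
  qed
  have "solvable_in_O_star enc_instance snd SC1S_RC (\<lambda>d. 2 powr (real d * log 2 (real d)))"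
    unfolding solvable_in_O_star_def
  proof (rule exI[of _ P], rule exI[of _ "c + k"], rule allI)
    fix x :: "bool mat \<times> nat"
    obtain M d where x: "x = (M, d)" by (cases x)
    let ?N = "val_size (enc_instance (M, d))" and ?f = "2 powr (real d * log 2 (real d))"
    obtain t where t: "run P (enc_instance (M, d)) (enc_bool (SC1S_RC (M, d))) t" "t \<le> C ^ d * ?N ^ k"
      using s[of M d] by blast
    have "C ^ C \<le> ?N ^ c" using c power_mono[OF n3[of M d], of c] by linarith
    then have "real (C ^ C) \<le> real (?N ^ c)" by (rule of_nat_mono)
    then have cN: "real C ^ C \<le> real ?N ^ c" by (simp only: of_nat_power)
    have "real t \<le> real (C ^ d * ?N ^ k)" using t(2) by (rule of_nat_mono)
    also have "\<dots> = real C ^ d * real ?N ^ k" by (simp only: of_nat_mult of_nat_power)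
    also have "\<dots> \<le> (real C ^ C * ?f) * real ?N ^ k"
      by (intro mult_right_mono power_le_d_log_d C) simp
    also have "\<dots> \<le> (real ?N ^ c * ?f) * real ?N ^ k"
      using cN by (intro mult_right_mono) simp_all
    also have "\<dots> = ?f * real ?N ^ (c + k)" by (simp only: power_add mult.assoc mult.commute mult.left_commute)
    finally show "\<exists>t. run P (enc_instance x) (enc_bool (SC1S_RC x)) t \<and>
      real t \<le> 2 powr (real (snd x) * log 2 (real (snd x))) * real (val_size (enc_instance x)) ^ (c + k)"
      using t(1) unfolding x snd_conv by blast
  qed
  with fpt show ?thesis by (rule conjI)
qed

end
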